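(* Let $n,d$ be positive integers, let $N=\binom{n+d}{d}-1$, and let $(h_t)_{t\in\mathbb{N}}$ be a sequence of non-negative integers such that $h_0=1$ and $h_1=N+1$. There exists a projective variety $\mathbb{X}\subseteq V_{n,d}\subseteq\mathbb{P}^N$ such that $H_{\mathbb{X}}(t)=h_t$ for all $t\in\mathbb{N}$ if and only if $(h_t)_{t\in\mathbb{N}}$ is a differentiable $(d-1)$-sequence.
   Context: $\mathbb{K}$ is an algebraically closed field of characteristic $0$; $\mathbb{N}$ includes $0$. A projective variety means a reduced closed subscheme of projective space over $\mathbb{K}$ (not necessarily irreducible); $H_{\mathbb{X}}(t)$ is the Hilbert function of the homogeneous coordinate ring of $\mathbb{X}$ (polynomial ring modulo the radical homogeneous ideal of $\mathbb{X}$). The Veronese variety $V_{n,d}\subseteq\mathbb{P}^N$ is the image of $\nu_{n,d}:\mathbb{P}^n\to\mathbb{P}^N$, which sends $[x_0,\dots,x_n]$ to the point whose coordinates are all monomials of degree $d$ in $x_0,\dots,x_n$. For integers $a\geq 1$, $t\ge1$, write the $t$-binomial (Macaulay) expansion $a=\binom{m_t}{t}+\binom{m_{t-1}}{t-1}+\dots+\binom{m_j}{j}$ with $m_t>m_{t-1}>\dots>m_j\ge j\ge1$, and set $a^{\langle t\rangle}=\binom{m_t+1}{t+1}+\binom{m_{t-1}+1}{t}+\dots+\binom{m_j+1}{j+1}$; also $0^{\langle t\rangle}=0$. A sequence of non-negative integers $(c_t)_{t\in\mathbb{N}}$ is a $0$-sequence if $c_0=1$ and $c_{t+1}\le c_t^{\langle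 t\rangle}$ for all $t\ge1$. A $0$-sequence $(b_t)$ is differentiable if the sequence $b_t-b_{t-1}$ (with $b_{-1}=0$) is again a $0$-sequence. For an integer $e\ge0$, a $0$-sequence $(b_t)$ is a differentiable $e$-sequence if there exists a differentiable $0$-sequence $(c_t)$ such that $b_t=c_{(e+1)t}$ for all $t$. In particular a differentiable $(d-1)$-sequence is a $0$-sequence of the form $b_t=c_{dt}$ with $(c_t)$ a differentiable $0$-sequence. *)

theory Defs
  imports
    "HOL-Library.Poly_Mapping"
    "HOL-Library.Multiset"
    "HOL-Computational_Algebra.Polynomial"
    "HOL-Algebra.QuotRing"
    "HOL-Algebra.Embedded_Algebras"
begin

section \<open>Polynomial rings in finitely many variables\<close>

type_synonym monom = "nat \<Rightarrow>\<^sub>0 nat"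

type_synonym 'k mpoly = "monom \<Rightarrow>\<^sub>0 'k"

definition mdeg :: "monom \<Rightarrow> nat" where
  "mdeg m = (\<Sum>i\<in>Poly_Mapping.keys m. Poly_Mapping.lookup m i)"

definition eval_monom :: "(nat \<Rightarrow> 'k::comm_ring_1) \<Rightarrow> monom \<Rightarrow> 'k" where
  "eval_monom v m = (\<Prod>i\<in>Poly_Mapping.keys m. v i ^ Poly_Mapping.lookup m i)"

definition eval_mpoly :: "(nat \<Rightarrow> 'k::comm_ring_1) \<Rightarrow> 'k mpoly \<Rightarrow> 'k" where
  "eval_mpoly v p = (\<Sum>m\<in>Poly_Mapping.keys p. Poly_Mapping.lookup p m * eval_monom v m)"

text \<open>\<open>mpoly_ring N\<close> is the polynomial ring in the \<open>N + 1\<close> variables with indices \<open>0, \<dots>, N\<close>.\<close>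

definition mpoly_ring :: "nat \<Rightarrow> 'k::comm_ring_1 mpoly ring" where
  "mpoly_ring N = \<lparr>carrier = {p. \<forall>m\<in>Poly_Mapping.keys p. Poly_Mapping.keys m \<subseteq> {..N}},
     mult = (*), one = 1, zero = 0, add = (+)\<rparr>"

definition homogeneous_part :: "nat \<Rightarrow> nat \<Rightarrow> 'k::comm_ring_1 mpoly set" where
  "homogeneous_part N t = {p \<in> carrier (mpoly_ring N). \<forall>m\<in>Poly_Mapping.keys p. mdeg m = t}"


section \<open>Projective varieties and their Hilbert functions\<close>

text \<open>A vector with \<open>N + 1\<close> coordinates is a function that vanishes beyond \<open>N\<close>; a point of
  projective space is the set of all its representatives.\<close>

definition nonzero_vectors :: "nat \<Rightarrow> (nat \<Rightarrow> 'k::field) set" where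
  "nonzero_vectors N = {v. (\<forall>i>N. v i = 0) \<and> (\<exists>i\<le>N. v i \<noteq> 0)}"

definition proj_point :: "(nat \<Rightarrow> 'k::field) \<Rightarrow> (nat \<Rightarrow> 'k) set" where
  "proj_point v = {\<lambda>i. c * v i | c. c \<noteq> 0}"

definition proj_space :: "nat \<Rightarrow> (nat \<Rightarrow> 'k::field) set set" where
  "proj_space N = proj_point ` nonzero_vectors N"

text \<open>Over an algebraically closed field, reduced closed subschemes of projective space
  correspond to Zariski-closed sets of points; inclusion of subschemes is inclusion of sets.\<close>

definition projective_variety :: "nat \<Rightarrow> (nat \<Rightarrow> 'k::field) set set \<Rightarrow> bool" where
  "projective_variety N X \<longleftrightarrow>
     (\<exists>F \<subseteq> (\<Union>t. homogeneous_part N t).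
        X = {P \<in> proj_space N. \<forall>f\<in>F. \<forall>v\<in>P. eval_mpoly v f = 0})"

text \<open>Requiring \<open>f\<close> to vanish at every representative makes this ideal homogeneous when the field
  is infinite.\<close>

definition vanishing_ideal :: "nat \<Rightarrow> (nat \<Rightarrow> 'k::field) set set \<Rightarrow> 'k mpoly set" where
  "vanishing_ideal N X =
     {f \<in> carrier (mpoly_ring N). \<forall>P\<in>X. \<forall>v\<in>P. eval_mpoly v f = 0}"

definition coordinate_ring :: "nat \<Rightarrow> (nat \<Rightarrow> 'k::field) set set \<Rightarrow> 'k mpoly set ring" where
  "coordinate_ring N X = mpoly_ring N Quot vanishing_ideal N X"

definition coordinate_ring_scalars :: "nat \<Rightarrow> (nat \<Rightarrow> 'k::field) set set \<Rightarrow> 'k mpoly set set" where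
  "coordinate_ring_scalars N X =
     range (\<lambda>c. vanishing_ideal N X +>\<^bsub>mpoly_ring N\<^esub> Poly_Mapping.single 0 c)"

definition coordinate_ring_part ::
    "nat \<Rightarrow> (nat \<Rightarrow> 'k::field) set set \<Rightarrow> nat \<Rightarrow> 'k mpoly set set" where
  "coordinate_ring_part N X t =
     (\<lambda>f. vanishing_ideal N X +>\<^bsub>mpoly_ring N\<^esub> f) ` homogeneous_part N t"

definition hilbert_function :: "nat \<Rightarrow> (nat \<Rightarrow> 'k::field) set set \<Rightarrow> nat \<Rightarrow> nat" where
  "hilbert_function N X t =
     ring.dim (coordinate_ring N X) (coordinate_ring_scalars N X) (coordinate_ring_part N X t)"


section \<open>Veronese varieties\<close>

definition monoms_of_degree :: "nat \<Rightarrow> nat \<Rightarrow> monom set" where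
  "monoms_of_degree n d = {m. Poly_Mapping.keys m \<subseteq> {..n} \<and> mdeg m = d}"

text \<open>The list \<open>e 0, \<dots>, e N\<close> fixes the order in which the monomials of degree \<open>d\<close> are used as
  coordinates.\<close>

definition veronese_vector ::
    "nat \<Rightarrow> (nat \<Rightarrow> monom) \<Rightarrow> (nat \<Rightarrow> 'k::field) \<Rightarrow> nat \<Rightarrow> 'k" where
  "veronese_vector N e v = (\<lambda>i. if i \<le> N then eval_monom v (e i) else 0)"

definition veronese_variety :: "nat \<Rightarrow> nat \<Rightarrow> (nat \<Rightarrow> monom) \<Rightarrow> (nat \<Rightarrow> 'k::field) set set" where
  "veronese_variety n N e = (\<lambda>v. proj_point (veronese_vector N e v)) ` nonzero_vectors n"

lemma bij_betw_monoms_multisets: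
  "bij_betw (\<lambda>M. Abs_poly_mapping (count M)) (multisets_of_size {..n} d) (monoms_of_degree n d)"
proof (rule bij_betw_byWitness[where f' = "\<lambda>m. Abs_multiset (Poly_Mapping.lookup m)"])
  have fin: "finite {x. count M x \<noteq> 0}" for M :: "nat multiset"
    using finite_set_mset[of M] by (simp add: set_mset_def del: count_greater_zero_iff)
  have lk: "Poly_Mapping.lookup (Abs_poly_mapping (count M)) = count M" for M :: "nat multiset"
    by (rule lookup_Abs_poly_mapping[OF fin])
  have ks: "Poly_Mapping.keys (Abs_poly_mapping (count M)) = set_mset M" for M :: "nat multiset"
    by (simp add: keys.rep_eq lk)
  have "finite {x. Poly_Mapping.lookup m x > 0}" for m :: monom
    using finite_keys[of m] unfolding keys.rep_eq by simp
  then have ct: "count (Abs_multiset (Poly_Mapping.lookup m)) = Poly_Mapping.lookup m" for m :: monom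
    by (rule count_Abs_multiset)
  have st: "set_mset (Abs_multiset (Poly_Mapping.lookup m)) = Poly_Mapping.keys m" for m :: monom
    unfolding set_mset_def ct keys.rep_eq by simp
  show "\<forall>M\<in>multisets_of_size {..n} d. Abs_multiset (Poly_Mapping.lookup (Abs_poly_mapping (count M))) = M"
    by (simp add: lk count_inverse)
  show "\<forall>m\<in>monoms_of_degree n d. Abs_poly_mapping (count (Abs_multiset (Poly_Mapping.lookup m))) = m"
    by (simp add: ct)
  show "(\<lambda>M. Abs_poly_mapping (count M)) ` multisets_of_size {..n} d \<subseteq> monoms_of_degree n d"
    by (auto simp: monoms_of_degree_def mdeg_def multisets_of_size_def ks lk size_multiset_overloaded_eq)
  show "(\<lambda>m. Abs_multiset (Poly_Mapping.lookup m)) ` monoms_of_degree n d \<subseteq> multisets_of_size {..n} d"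
    by (auto simp: monoms_of_degree_def mdeg_def multisets_of_size_def st ct size_multiset_overloaded_eq)
qed

lemma card_monoms_of_degree: "card (monoms_of_degree n d) = (n + d) choose d"
  using bij_betw_same_card[OF bij_betw_monoms_multisets[of n d]]
  by (simp add: card_multisets_of_size)

lemma ex_monom_enumeration:
  "\<exists>e. bij_betw e {..((n + d) choose d) - 1} (monoms_of_degree n d)"
proof (rule finite_same_card_bij)
  show "finite (monoms_of_degree n d)"
    using bij_betw_finite[OF bij_betw_monoms_multisets[of n d]] by blast
  show "card {..((n + d) choose d) - 1} = card (monoms_of_degree n d)"
    using zero_less_binomial[of d "n + d"] by (simp add: card_monoms_of_degree)
qed simp


section \<open>Macaulay growth and differentiable sequences\<close>

definition macaulay_expansion :: "nat \<Rightarrow> nat \<Rightarrow> nat \<Rightarrow> (nat \<Rightarrow> nat) \<Rightarrow> bool" where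
  "macaulay_expansion a t j m \<longleftrightarrow>
     1 \<le> j \<and> j \<le> t \<and> j \<le> m j \<and> (\<forall>i. j \<le> i \<and> i < t \<longrightarrow> m i < m (Suc i)) \<and>
     a = (\<Sum>i=j..t. m i choose i)"

text \<open>The expansion exists and is unique for \<open>a, t \<ge> 1\<close>.\<close>

definition macaulay_upper :: "nat \<Rightarrow> nat \<Rightarrow> nat" where
  "macaulay_upper a t =
     (if a = 0 then 0
      else THE b. \<exists>j m. macaulay_expansion a t j m \<and> b = (\<Sum>i=j..t. (m i + 1) choose (i + 1)))"

definition zero_sequence :: "(nat \<Rightarrow> nat) \<Rightarrow> bool" where
  "zero_sequence c \<longleftrightarrow> c 0 = 1 \<and> (\<forall>t\<ge>1. c (t + 1) \<le> macaulay_upper (c t) t)"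

text \<open>The differences are taken in the integers, so they are required to be non-negative.\<close>

definition differentiable_zero_sequence :: "(nat \<Rightarrow> nat) \<Rightarrow> bool" where
  "differentiable_zero_sequence b \<longleftrightarrow>
     zero_sequence b \<and>
     (\<exists>c. zero_sequence c \<and>
        (\<forall>t. int (c t) = int (b t) - (if t = 0 then 0 else int (b (t - 1)))))"

definition differentiable_e_sequence :: "nat \<Rightarrow> (nat \<Rightarrow> nat) \<Rightarrow> bool" where
  "differentiable_e_sequence e b \<longleftrightarrow>
     zero_sequence b \<and>
     (\<exists>c. differentiable_zero_sequence c \<and> (\<forall>t. b t = c ((e + 1) * t)))"

end

theory Submission
  imports Defs "HOL-Library.Multiset_Order" "HOL-Library.Function_Algebras"
begin

text \<open>
  If \<open>X = \<nu>(Y)\<close> with \<open>Y \<subseteq> P\<^sup>n\<close>, pulling back forms gives \<open>H\<^sub>X(t) = H\<^sub>Y(dt)\<close>, so everything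
  reduces to the Hilbert functions of subsets of \<open>P\<^sup>n\<close>.

  Necessity. Monomials that are not combinations of smaller ones, as functions on \<open>Y\<close>, form an order
  ideal counted by the Hilbert function, and Macaulay's bound for order ideals gives a \<open>0\<close>-sequence.
  The growth condition on the first difference involves three consecutive degrees only, in which \<open>Y\<close>
  can be replaced by a finite subset; dividing by powers of a linear form that vanishes nowhere on it
  turns the difference into the count of an order ideal as well.

  Macaulay's bound is proved by making the order ideal stable under lowering the index of a variable
  (two-variable compressions) and comparing a stable set with initial segments of the
  multiset order, in the style of Green's restriction theorem.

  Sufficiency. \<open>c\<^sub>d = (n+d choose d)\<close> forces maximal growth up to degree \<open>d\<close> after truncation, so the
  difference sequence may be taken to start with \<open>1, n\<close>. The order ideal of its lexicographic initial
  segments is lifted to \<open>P\<^sup>n\<close> by distraction: \<open>x\<^sub>i\<^sup>a\<close> becomes \<open>\<Prod>j<a. (x\<^sub>i - j x\<^sub>n)\<close>. The zero set of the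
  distracted monomials outside the order ideal contains the points \<open>(m, 1)\<close> for \<open>m\<close> inside it, and
  these separate the remaining distracted monomials triangularly.
\<close>


section \<open>Stable sets of monomials\<close>

text \<open>A graded piece of the coordinate ring is the span of the monomials of one degree,
  restricted to the affine cone. Its dimension is therefore the rank of a finite family of
  functions, and everything except the comparison with the quotient ring is linear algebra of
  functions. Passing to a finite subset is unavoidable for differences: a set of positive dimension
  meets every hyperplane, so no linear form is invertible on it. Finitely many points carrying all
  relations up to the top degree in play do admit such a form. Macaulay's bound is stated for a
  finite family of monomials and its lower shadow, since the order ideals to which it applies are
  only known through a greedy basis. Conversely, a monomial ideal is in general not radical.
  Distraction replaces powers by products of distinct linear factors, so that reduced points
  suffice; the homogenizing variable turns counts per degree into partial sums, which is why the
  first difference is what gets prescribed. Only degrees divisible by d are visible on the Veronese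
  variety, which leaves the freedom to alter a sequence strictly between 0 and d.\<close>

lemma less_multiset_iff_top:
  fixes M N :: "'a::linorder multiset"
  shows "M < N \<longleftrightarrow> (\<exists>k. count M k < count N k \<and> (\<forall>x>k. count M x = count N x))"
proof
  assume MN: "M < N"
  define D where "D = {x. count M x \<noteq> count N x}"
  have "D \<subseteq> set_mset M \<union> set_mset N"
    unfolding D_def by (auto simp: count_eq_zero_iff) (metis count_eq_zero_iff)
  then have fin: "finite D" by (rule finite_subset) auto
  have "M \<noteq> N" using MN by auto
  then have "D \<noteq> {}" by (auto simp: D_def multiset_eq_iff)
  \<comment> \<open>The largest index where the multiplicities differ decides: a surplus of
    \<open>M\<close> there would have to be offset by a deficit at a larger index, and there is
    none.\<close>
  then have k: "Max D \<in> D" "\<And>x. x \<in> D \<Longrightarrow> x \<le> Max D" using fin by auto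
  have above: "\<forall>x>Max D. count M x = count N x"
    using k(2) unfolding D_def by fastforce
  have "\<not> count N (Max D) < count M (Max D)"
    using MN above unfolding less_multiset\<^sub>H\<^sub>O by (metis less_not_refl)
  then have "count M (Max D) < count N (Max D)"
    using k(1) by (auto simp: D_def)
  with above show "\<exists>k. count M k < count N k \<and> (\<forall>x>k. count M x = count N x)" by blast
next
  assume "\<exists>k. count M k < count N k \<and> (\<forall>x>k. count M x = count N x)"
  then obtain k where k: "count M k < count N k" "\<forall>x>k. count M x = count N x" by blast
  have "\<exists>x>y. count M x < count N x" if "count N y < count M y" for y
  proof -
    have "y < k" using that k by (metis linorder_neqE order.asym order.irrefl)
    then show ?thesis using k(1) by blast
  qed
  then show "M < N" using k(1) unfolding less_multiset\<^sub>H\<^sub>O by auto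
qed

lemma le_multiset_bound:
  fixes v w :: "'a::linorder multiset"
  assumes "v \<le> w" "x \<in># v"
  shows "\<exists>y\<in>#w. x \<le> y"
proof (cases "count w x < count v x")
  case True
  then obtain y where "y > x" "count v y < count w y"
    using assms(1) unfolding less_eq_multiset\<^sub>H\<^sub>O by blast
  then show ?thesis by (metis count_eq_zero_iff less_imp_le not_less_zero)
next
  case False
  then have "x \<in># w" using assms(2) by (metis count_eq_zero_iff not_gr_zero)
  then show ?thesis by blast
qed

lemma finite_multisets_le: "finite {v. size v = t \<and> v \<le> w}" for w :: "nat multiset"
proof (rule finite_subset)
  show "{v. size v = t \<and> v \<le> w} \<subseteq> multisets_of_size {..Max (insert 0 (set_mset w))} t"
  proof
    fix v assume v: "v \<in> {v. size v = t \<and> v \<le> w}"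
    have "x \<le> Max (insert 0 (set_mset w))" if x: "x \<in># v" for x
    proof -
      obtain y where "y \<in># w" "x \<le> y" using le_multiset_bound[of v w x] v x by auto
      moreover have "y \<le> Max (insert 0 (set_mset w))" using \<open>y \<in># w\<close> by (intro Max_ge) auto
      ultimately show ?thesis by linarith
    qed
    then show "v \<in> multisets_of_size {..Max (insert 0 (set_mset w))} t"
      using v by (auto simp: multisets_of_size_def)
  qed
qed auto

text \<open>A multiset of natural numbers is a monomial; the multiset order compares exponents
  lexicographically, variables of higher index first. The parameter \<open>z\<close> below is the least index in use.\<close>

definition stable :: "nat \<Rightarrow> nat multiset set \<Rightarrow> bool" where
  "stable z S \<longleftrightarrow> (\<forall>m\<in>S. set_mset m \<subseteq> {z..} \<and>
     (\<forall>j\<in>#m. \<forall>i\<in>{z..<j}. add_mset i (m - {#j#}) \<in> S))"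

definition seg :: "nat \<Rightarrow> nat \<Rightarrow> nat multiset \<Rightarrow> nat multiset set" where
  "seg z t w = {v. size v = t \<and> set_mset v \<subseteq> {z..} \<and> v \<le> w}"

text \<open>Together with \<open>free\<close> this mimics division by a variable and setting it to
  zero, the two ends of the exact sequence of multiplication by that variable;
  \<open>card_free_quot\<close> is its count.\<close>

definition quot :: "nat \<Rightarrow> nat multiset set \<Rightarrow> nat multiset set" where
  "quot z S = {u. add_mset z u \<in> S}"

definition free :: "nat \<Rightarrow> nat multiset set \<Rightarrow> nat multiset set" where
  "free z S = {v \<in> S. z \<notin># v}"

lemma finite_seg: "finite (seg z t w)"
  by (rule finite_subset[OF _ finite_multisets_le[of t w]]) (auto simp: seg_def)

lemma finite_quot: "finite S \<Longrightarrow> finite (quot z S)"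
  unfolding quot_def using finite_vimageI[of S "add_mset z"] by (simp add: vimage_def inj_def)

lemma quot_mono: "S \<subseteq> T \<Longrightarrow> quot z S \<subseteq> quot z T"
  by (auto simp: quot_def)

lemma card_free_quot:
  assumes "finite S"
  shows "card S = card (free z S) + card (quot z S)"
proof -
  have "S = free z S \<union> add_mset z ` quot z S"
    by (auto simp: free_def quot_def image_iff) (metis insert_DiffM)
  moreover have "free z S \<inter> add_mset z ` quot z S = {}"
    by (auto simp: free_def)
  moreover have "finite (free z S)" using assms by (simp add: free_def)
  ultimately have "card S = card (free z S) + card (add_mset z ` quot z S)"
    using card_Un_disjoint[of "free z S" "add_mset z ` quot z S"] finite_quot[OF assms] by auto
  then show ?thesis by (simp add: card_image inj_on_def)
qed

lemma stableD:
  assumes "stable z S" "m \<in> S"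
  shows "set_mset m \<subseteq> {z..}" and "\<lbrakk>j \<in># m; z \<le> i; i < j\<rbrakk> \<Longrightarrow> add_mset i (m - {#j#}) \<in> S"
  using assms by (auto simp: stable_def)

lemma stable_quot: "stable z S \<Longrightarrow> stable z (quot z S)"
  unfolding stable_def[of z "quot z S"]
proof (intro ballI conjI)
  fix m assume S: "stable z S" and m: "m \<in> quot z S"
  then have m': "add_mset z m \<in> S" by (simp add: quot_def)
  show "set_mset m \<subseteq> {z..}" using stableD(1)[OF S m'] by simp
  fix j i assume "j \<in># m" "i \<in> {z..<j}"
  then have "add_mset i (add_mset z m - {#j#}) \<in> S" using stableD(2)[OF S m'] by auto
  then show "add_mset i (m - {#j#}) \<in> quot z S"
    using \<open>i \<in> {z..<j}\<close> by (simp add: quot_def add_mset_commute)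
qed

lemma stable_free: "stable z S \<Longrightarrow> stable (Suc z) (free z S)"
  unfolding stable_def[of "Suc z"]
proof (intro ballI conjI)
  fix m assume S: "stable z S" and m: "m \<in> free z S"
  then have m': "m \<in> S" "z \<notin># m" by (auto simp: free_def)
  show "set_mset m \<subseteq> {Suc z..}"
    using stableD(1)[OF S m'(1)] m'(2) by (auto simp: Suc_le_eq) (metis atLeast_iff le_neq_implies_less subsetD)
  fix j i assume "j \<in># m" "i \<in> {Suc z..<j}"
  then show "add_mset i (m - {#j#}) \<in> free z S"
    using stableD(2)[OF S m'(1)] m'(2) by (auto simp: free_def dest: in_diffD)
qed

section \<open>Initial segments under restriction and division\<close>

lemma free_seg:
  "free z (seg z t w) = seg (Suc z) t w"
proof -
  have "z \<notin># v \<and> set_mset v \<subseteq> {z..} \<longleftrightarrow> set_mset v \<subseteq> {Suc z..}" for v :: "nat multiset"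
    by (auto simp: subset_iff Suc_le_eq le_less)
  then show ?thesis by (auto simp: free_def seg_def)
qed

text \<open>If \<open>w\<close> were smaller than \<open>u\<close>, the deciding index would lie
  above \<open>k\<close>: otherwise \<open>w\<close> would be a proper factor of \<open>u\<close>,
  against equal sizes. The added variables \<open>z\<close> and \<open>k\<close> are too small to
  affect it.\<close>

lemma add_least_le_imp_le:
  fixes u w :: "nat multiset"
  assumes "size u = size w" "\<forall>x\<in>#w. k \<le> x" "z < k" "add_mset z u \<le> add_mset k w"
  shows "u \<le> w"
proof (rule ccontr)
  assume "\<not> u \<le> w"
  then have "w < u" by simp
  then obtain p where p: "count w p < count u p" "\<forall>x>p. count w x = count u x"
    by (auto simp: less_multiset_iff_top)
  have "k < p"
  proof (rule ccontr)
    assume "\<not> k < p"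
    have "count w x \<le> count u x" for x
    proof (cases "x < p")
      case True
      then have "x \<notin># w" using assms(2) \<open>\<not> k < p\<close> by fastforce
      then show ?thesis by (metis count_eq_zero_iff zero_le)
    next
      case False
      then show ?thesis using p by (cases "x = p") auto
    qed
    then have "w \<subset># u" using p(1) by (auto simp: subset_mset_def subseteq_mset_def)
    then show False using mset_subset_size assms(1) by fastforce
  qed
  then have "add_mset k w < add_mset z u"
    using p assms(3) unfolding less_multiset_iff_top by (intro exI[of _ p]) auto
  then show False using assms(4) by simp
qed

text \<open>Dividing a segment by \<open>z\<close> yields a segment again, whose last monomial has
  lost its least variable. This keeps the segment side of the induction inside the class of
  segments.\<close>

lemma quot_seg_min:
  assumes "size w = t" "\<forall>x\<in>#w. k \<le> x" "z < k"
  shows "quot z (seg z (Suc t) (add_mset k w)) = seg z t w"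
proof (intro equalityI subsetI)
  fix u assume "u \<in> quot z (seg z (Suc t) (add_mset k w))"
  then show "u \<in> seg z t w"
    using add_least_le_imp_le[of u w k z] assms by (auto simp: quot_def seg_def)
next
  fix u assume "u \<in> seg z t w"
  then show "u \<in> quot z (seg z (Suc t) (add_mset k w))"
    using assms by (auto simp: quot_def seg_def intro!: add_mset_le_le_le)
qed

text \<open>The first conjunct bounds the lower shadow of a stable set, which is its quotient by the least
  variable; the second is the form of Green's restriction theorem that makes the induction work, by
  splitting off the multiples of the least variable.\<close>

lemma stable_quot_seg_le:
  assumes "finite S" "\<forall>m\<in>S. size m = t" "stable z S" "size w = t" "set_mset w \<subseteq> {z..}"
  shows "(card (seg z t w) \<le> card S \<longrightarrow> card (quot z (seg z t w)) \<le> card (quot z S)) \<and>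
    (z \<notin># w \<longrightarrow> card (free z (seg z t w)) \<le> card (free z S) \<longrightarrow>
       card (quot z (seg z t w)) \<le> card (quot z S))"
  using assms
proof (induction "card S" arbitrary: S t z w rule: less_induct)
  case less
  note S = less.prems(1-3)
  have G: "card (quot z (seg z t w)) \<le> card (quot z S)"
    if w: "size w = t" "set_mset w \<subseteq> {z..}" "z \<notin># w"
      and le: "card (free z (seg z t w)) \<le> card (free z S)" for w
  proof (cases t)
    case 0
    then have "quot z (seg z t w) = {}" by (auto simp: quot_def seg_def)
    then show ?thesis by simp
  next
    case (Suc t')
    then have wne: "w \<noteq> {#}" using w(1) by auto
    define k where "k = Min_mset w"
    define w' where "w' = w - {#k#}"
    have kw: "k \<in># w" using wne by (simp add: k_def)
    then have weq: "w = add_mset k w'" by (simp add: w'_def)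
    have kmin: "\<forall>x\<in>#w'. k \<le> x" by (auto simp: k_def w'_def dest!: in_diffD)
    have zk: "z < k" using kw w(2,3) by (metis atLeast_iff le_neq_implies_less subsetD)
    have sw': "size w' = t'" "set_mset w' \<subseteq> {z..}" "z \<notin># w'"
      using weq w Suc by auto
    have q: "quot z (seg z t w) = seg z t' w'"
      using quot_seg_min[OF sw'(1) kmin zk] weq Suc by simp
    have "w \<in> free z (seg z t w)" using w by (auto simp: free_def seg_def)
    then have fpos: "card (free z S) > 0"
      using le card_gt_0_iff[of "free z (seg z t w)"] finite_seg[of z t w] by (auto simp: free_def)
    have qlt: "card (quot z S) < card S" using card_free_quot[OF S(1), of z] fpos by simp
    \<comment> \<open>Lowering a variable of some \<open>z\<close>-free element to \<open>z\<close>
      stays in \<open>S\<close> by stability, so \<open>S\<close> also has an element divisible by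
      \<open>z\<close>.\<close>
    have flt: "card (free z S) < card S"
    proof -
      obtain m where m: "m \<in> S" "z \<notin># m" using fpos by (auto simp: free_def card_gt_0_iff)
      then obtain j where j: "j \<in># m" using S(2) Suc by fastforce
      then have "z < j" using m stableD(1)[OF S(3) m(1)] by (metis atLeast_iff le_neq_implies_less subsetD)
      then have "add_mset z (m - {#j#}) \<in> S" using stableD(2)[OF S(3) m(1) j] by simp
      then have "m - {#j#} \<in> quot z S" by (simp add: quot_def)
      then have "card (quot z S) > 0" using finite_quot[OF S(1)] by (auto simp: card_gt_0_iff)
      then show ?thesis using card_free_quot[OF S(1), of z] by simp
    qed
    \<comment> \<open>Restriction drops the variable \<open>z\<close>, so the first conjunct applies
      with \<open>Suc z\<close> as least variable.\<close>
    have IH1: "card (quot (Suc z) (seg (Suc z) t w)) \<le> card (quot (Suc z) (free z S))"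
    proof -
      have "set_mset w \<subseteq> {Suc z..}" using w(2,3) by (auto simp: subset_iff Suc_le_eq le_less)
      moreover have "finite (free z S)" "\<forall>m\<in>free z S. size m = t" using S by (auto simp: free_def)
      moreover have "card (seg (Suc z) t w) \<le> card (free z S)" using le by (simp add: free_seg)
      ultimately show ?thesis
        using less.hyps[OF flt _ _ stable_free[OF S(3)] w(1)] by blast
    qed
    \<comment> \<open>As \<open>Suc z\<close> is at most \<open>k\<close>, multiplying by
      \<open>Suc z\<close> carries monomials up to \<open>w'\<close> to monomials up to
      \<open>w\<close>.\<close>
    have "card (free z (seg z t' w')) \<le> card (quot (Suc z) (seg (Suc z) t w))"
    proof (rule card_mono[OF finite_quot[OF finite_seg]])
      show "free z (seg z t' w') \<subseteq> quot (Suc z) (seg (Suc z) t w)"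
        unfolding free_seg using zk Suc weq
        by (auto simp: quot_def seg_def intro!: add_mset_le_le_le)
    qed
    also have "\<dots> \<le> card (quot (Suc z) (free z S))" by (rule IH1)
    \<comment> \<open>Stability trades the factor \<open>Suc z\<close> for \<open>z\<close>. The
      resulting bound is the hypothesis of the second conjunct for the smaller set
      \<open>quot z S\<close> and \<open>w'\<close>.\<close>
    also have "\<dots> \<le> card (free z (quot z S))"
    proof (rule card_mono)
      show "finite (free z (quot z S))" using finite_quot[OF S(1)] by (simp add: free_def)
      show "quot (Suc z) (free z S) \<subseteq> free z (quot z S)"
        using stableD(2)[OF S(3), of _ "Suc z" z] by (fastforce simp: quot_def free_def)
    qed
    finally have fle: "card (free z (seg z t' w')) \<le> card (free z (quot z S))" .
    have qsz: "\<forall>m\<in>quot z S. size m = t'" using S(2) Suc by (auto simp: quot_def)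
    have "card (quot z (seg z t' w')) \<le> card (quot z (quot z S))"
      using less.hyps[OF qlt finite_quot[OF S(1)] qsz stable_quot[OF S(3)] sw'(1,2)] sw'(3) fle by blast
    then show ?thesis
      unfolding q using fle card_free_quot[OF finite_seg, of z t' w' z]
        card_free_quot[OF finite_quot[OF S(1)], of z z] by simp
  qed
  have "card (quot z (seg z t w)) \<le> card (quot z S)"
    if le: "card (seg z t w) \<le> card S"
  proof (cases "card (free z S) \<le> card (free z (seg z t w))")
    case True
    then show ?thesis
      using le card_free_quot[OF finite_seg, of z t w z] card_free_quot[OF S(1), of z] by simp
  next
    case False
    then have f: "card (free z (seg z t w)) < card (free z S)" by simp
    show ?thesis
    proof (cases t)
      case 0
      then have "quot z (seg z t w) = {}" by (auto simp: quot_def seg_def)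
      then show ?thesis by simp
    next
      case (Suc t')
      let ?P = "\<lambda>v. size v = t \<and> set_mset v \<subseteq> {Suc z..} \<and> w < v"
      have ex: "?P (replicate_mset t (Suc z + Max (insert 0 (set_mset w))))"
      proof -
        have "x < Suc z + Max (insert 0 (set_mset w))" if "x \<in># w" for x
          using Max_ge[of "insert 0 (set_mset w)" x] that by (simp add: less_Suc_eq_le trans_le_add2 del: Max_insert)
        then have "w < replicate_mset t (Suc z + Max (insert 0 (set_mset w)))"
          using Suc by (intro ex_gt_imp_less_multiset) auto
        then show ?thesis by auto
      qed
      \<comment> \<open>The next \<open>z\<close>-free monomial after \<open>w\<close>. Extending
        the segment to it adds only one \<open>z\<close>-free element, which the strict inequality
        \<open>f\<close> can afford, and makes \<open>G\<close> applicable even if \<open>w\<close>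
        involves \<open>z\<close>.\<close>
      define w0 where "w0 = (LEAST v. ?P v)"
      have w0: "?P w0" unfolding w0_def using ex by (rule LeastI)
      have least: "w0 \<le> v" if "?P v" for v unfolding w0_def using that by (rule Least_le)
      have "free z (seg z t w0) \<subseteq> insert w0 (free z (seg z t w))"
      proof
        fix v assume "v \<in> free z (seg z t w0)"
        then have v: "size v = t" "set_mset v \<subseteq> {Suc z..}" "v \<le> w0"
          unfolding free_seg by (auto simp: seg_def)
        show "v \<in> insert w0 (free z (seg z t w))"
        proof (cases "v \<le> w")
          case True
          then show ?thesis using v unfolding free_seg by (simp add: seg_def)
        next
          case False
          then have "w0 \<le> v" using v by (intro least) simp
          then show ?thesis using v by simp
        qed
      qed
      then have "card (free z (seg z t w0)) \<le> card (insert w0 (free z (seg z t w)))"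
        by (intro card_mono) (auto simp: free_def finite_seg)
      also have "\<dots> \<le> Suc (card (free z (seg z t w)))"
        using finite_seg[of "Suc z" t w] by (simp add: free_seg card_insert_if)
      also have "\<dots> \<le> card (free z S)" using f by simp
      finally have "card (quot z (seg z t w0)) \<le> card (quot z S)"
        using w0 by (intro G) auto
      moreover have "seg z t w \<subseteq> seg z t w0" using w0 by (auto simp: seg_def)
      then have "card (quot z (seg z t w)) \<le> card (quot z (seg z t w0))"
        by (intro card_mono quot_mono finite_quot finite_seg)
      ultimately show ?thesis by simp
    qed
  qed
  then show ?case using G less.prems(4,5) by blast
qed

section \<open>Compression\<close>

definition shadow :: "nat multiset set \<Rightarrow> nat multiset set" where
  "shadow B = {m - {#k#} | m k. m \<in> B \<and> k \<in># m}"

lemma shadowI: "m \<in> B \<Longrightarrow> k \<in># m \<Longrightarrow> m - {#k#} \<in> shadow B"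
  by (auto simp: shadow_def)

lemma finite_shadow: "finite B \<Longrightarrow> finite (shadow B)"
proof -
  assume "finite B"
  have "shadow B = (\<Union>m\<in>B. (\<lambda>k. m - {#k#}) ` set_mset m)" by (auto simp: shadow_def)
  then show ?thesis using \<open>finite B\<close> by simp
qed

locale compression =
  fixes i j :: nat
  assumes ij: "i < j"
begin

definition rest :: "nat multiset \<Rightarrow> nat multiset" where
  "rest m = filter_mset (\<lambda>x. x \<noteq> i \<and> x \<noteq> j) m"

text \<open>Monomials with equal \<open>key\<close> differ only in how a fixed degree is shared
  between \<open>i\<close> and \<open>j\<close>, so the exponent at \<open>j\<close> is a coordinate
  on each fiber.\<close>

definition key :: "nat multiset \<Rightarrow> nat multiset \<times> nat" where
  "key m = (rest m, count m i + count m j)"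

definition fiber :: "nat multiset set \<Rightarrow> nat multiset \<Rightarrow> nat multiset set" where
  "fiber S m = {m' \<in> S. key m' = key m}"

definition rk :: "nat multiset set \<Rightarrow> nat multiset \<Rightarrow> nat" where
  "rk S m = card {m' \<in> fiber S m. count m' j < count m j}"

definition mk :: "nat multiset \<times> nat \<Rightarrow> nat \<Rightarrow> nat multiset" where
  "mk k b = fst k + replicate_mset (snd k - b) i + replicate_mset b j"

text \<open>\<open>mk k b\<close> is the element of the fiber over \<open>k\<close> with exponent \<open>b\<close> at \<open>j\<close>; \<open>push\<close> replaces the
  exponents occurring in each fiber by \<open>0, 1, 2, \<dots>\<close> without changing their order.\<close>

definition push :: "nat multiset set \<Rightarrow> nat multiset \<Rightarrow> nat multiset" where
  "push S m = mk (key m) (rk S m)"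

lemma mk_key: "mk (key m) (count m j) = m"
  using ij by (auto simp: mk_def key_def rest_def multiset_eq_iff)

lemma key_inj: "key m = key m' \<Longrightarrow> count m j = count m' j \<Longrightarrow> m = m'"
  by (metis mk_key)

lemma count_le_key: "count m j \<le> snd (key m)"
  by (simp add: key_def)

lemma key_mk: "b \<le> snd (key m) \<Longrightarrow> key (mk (key m) b) = key m"
  using ij by (auto simp: mk_def key_def rest_def multiset_eq_iff)

lemma count_mk: "count (mk (key m) b) j = b"
  using ij by (auto simp: mk_def key_def rest_def)

lemma inj_on_fiber: "inj_on (\<lambda>m. count m j) (fiber S m)"
  by (auto simp: inj_on_def fiber_def intro: key_inj)

lemma rk_le: "rk S m \<le> count m j"
proof -
  have "rk S m = card ((\<lambda>m. count m j) ` {m' \<in> fiber S m. count m' j < count m j})"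
    unfolding rk_def by (intro card_image[symmetric] inj_on_subset[OF inj_on_fiber]) auto
  also have "\<dots> \<le> card {..<count m j}" by (intro card_mono) auto
  finally show ?thesis by simp
qed

lemma key_push: "key (push S m) = key m"
  unfolding push_def using rk_le[of S m] count_le_key[of m] by (intro key_mk) simp

lemma count_push: "count (push S m) j = rk S m"
  unfolding push_def by (rule count_mk)

lemma rk_strict_mono:
  assumes "finite S" "m \<in> S" "key m = key m'" "count m j < count m' j"
  shows "rk S m < rk S m'"
  unfolding rk_def using assms
  by (intro psubset_card_mono) (auto simp: fiber_def)

lemma inj_on_push:
  assumes "finite S"
  shows "inj_on (push S) S"
proof (rule inj_onI)
  fix m m' assume m: "m \<in> S" "m' \<in> S" "push S m = push S m'"
  then have k: "key m = key m'" "rk S m = rk S m'" by (metis key_push, metis count_push)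
  then have "count m j = count m' j"
    using rk_strict_mono[OF assms] m by (metis less_irrefl linorder_neqE_nat)
  then show "m = m'" using k key_inj by blast
qed

text \<open>The ranks in a fiber of size r are exactly 0, ..., r - 1. Membership in the compressed
  family thus depends only on fiber sizes, which turns inclusions into comparisons of
  cardinalities.\<close>

lemma mem_push_iff:
  assumes "finite S"
  shows "v \<in> push S ` S \<longleftrightarrow> count v j < card (fiber S v)"
proof
  assume "v \<in> push S ` S"
  then obtain m where m: "m \<in> S" "v = push S m" by blast
  have "rk S m < card (fiber S m)"
    unfolding rk_def using m assms by (intro psubset_card_mono) (auto simp: fiber_def)
  then show "count v j < card (fiber S v)"
    unfolding m(2) count_push by (simp add: fiber_def key_push)
next
  assume v: "count v j < card (fiber S v)"
  have fin: "finite (fiber S v)" using assms by (simp add: fiber_def)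
  have inj: "inj_on (rk S) (fiber S v)"
  proof (rule inj_onI)
    fix m m' assume m: "m \<in> fiber S v" "m' \<in> fiber S v" "rk S m = rk S m'"
    then have "count m j = count m' j"
      using rk_strict_mono[OF assms, of m m'] rk_strict_mono[OF assms, of m' m]
      unfolding fiber_def by (metis (mono_tags, lifting) less_irrefl linorder_neqE_nat mem_Collect_eq)
    then show "m = m'" using m by (intro key_inj) (auto simp: fiber_def)
  qed
  have "rk S m < card (fiber S v)" if "m \<in> fiber S v" for m
  proof -
    have "fiber S m = fiber S v" using that by (auto simp: fiber_def)
    then show ?thesis
      unfolding rk_def using that fin by (intro psubset_card_mono) (auto simp: fiber_def)
  qed
  then have "rk S ` fiber S v \<subseteq> {..<card (fiber S v)}" by auto
  then have "rk S ` fiber S v = {..<card (fiber S v)}"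
    using card_image[OF inj] by (intro card_subset_eq) auto
  then obtain m where m: "m \<in> fiber S v" "rk S m = count v j"
    using v by (metis imageE lessThan_iff)
  then have "push S m = v" by (intro key_inj) (auto simp: key_push count_push fiber_def)
  then show "v \<in> push S ` S" using m by (auto simp: fiber_def)
qed

lemma key_remove_other: "k \<noteq> i \<Longrightarrow> k \<noteq> j \<Longrightarrow> key (m - {#k#}) = (rest m - {#k#}, snd (key m))"
  by (simp add: key_def rest_def)

lemma key_remove:
  assumes "k = i \<or> k = j" "k \<in># m"
  shows "key (m - {#k#}) = (rest m, snd (key m) - 1)"
proof -
  have "count m k > 0" using assms(2) by simp
  then show ?thesis using assms(1) ij by (auto simp: key_def rest_def multiset_eq_iff)
qed

text \<open>A set \<open>X \<subseteq> {0..s}\<close> of exponents has at least \<open>min (card X) s\<close> lower neighbours in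
  \<open>{0..s - 1}\<close>: keep the elements below a gap \<open>g\<close> and lower the elements above it.\<close>

lemma card_fiber_shadow:
  assumes B: "finite B" and k: "k = i \<or> k = j" "k \<in># v"
  shows "min (card (fiber B v)) (snd (key v)) \<le> card (fiber (shadow B) (v - {#k#}))"
proof -
  define s where "s = snd (key v)"
  let ?F = "fiber B v"
  have le_s: "count m j \<le> s" if "m \<in> ?F" for m
    using that count_le_key[of m] by (auto simp: fiber_def s_def)
  obtain g where g: "g \<le> s" "min (card ?F) s \<le> card {m \<in> ?F. count m j \<noteq> g}"
  proof (cases "\<exists>g\<le>s. g \<notin> (\<lambda>m. count m j) ` ?F")
    case True
    then obtain g where g: "g \<le> s" "g \<notin> (\<lambda>m. count m j) ` ?F" by blast
    then have "{m \<in> ?F. count m j \<noteq> g} = ?F" by auto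
    then show ?thesis using that[OF g(1)] by simp
  next
    \<comment> \<open>No exponent is missing, so one element has to be sacrificed: dropping the top
      exponent \<open>s\<close> leaves \<open>s\<close> elements.\<close>
    case False
    have "card {m \<in> ?F. count m j \<noteq> s} = card ((\<lambda>m. count m j) ` {m \<in> ?F. count m j \<noteq> s})"
      by (intro card_image[symmetric] inj_on_subset[OF inj_on_fiber[of B v]]) auto
    also have "(\<lambda>m. count m j) ` {m \<in> ?F. count m j \<noteq> s} = {..<s}"
      using False le_s by (auto simp: image_iff order_le_less)
    finally show ?thesis using that[of s] by simp
  qed
  \<comment> \<open>Removing \<open>i\<close> keeps the exponent at \<open>j\<close>, removing
    \<open>j\<close> lowers it by one. Exponents below \<open>g\<close> stay below, those above
    remain at least \<open>g\<close>, so no two elements collide.\<close>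
  define f where "f m = (if count m j < g then m - {#i#} else m - {#j#})" for m
  have mem: "f m \<in> fiber (shadow B) (v - {#k#})"
    and cnt: "count (f m) j = (if count m j < g then count m j else count m j - 1)"
    if m: "m \<in> ?F" "count m j \<noteq> g" for m
  proof -
    have mB: "m \<in> B" "key m = key v" using m by (auto simp: fiber_def)
    then have rest: "rest m = rest v" and s: "count m i + count m j = s"
      by (auto simp: key_def s_def)
    have kv: "key (v - {#k#}) = (rest v, s - 1)" using key_remove[OF k] by (simp add: s_def)
    show "f m \<in> fiber (shadow B) (v - {#k#})"
    proof (cases "count m j < g")
      case True
      then have "i \<in># m" using s g(1) by (intro count_inI) auto
      then show ?thesis using True shadowI[OF mB(1)] key_remove[of i m] mB rest
        unfolding fiber_def kv by (simp add: f_def s_def)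
    next
      case False
      then have "j \<in># m" using m by (intro count_inI) auto
      then show ?thesis using False shadowI[OF mB(1)] key_remove[of j m] mB rest
        unfolding fiber_def kv by (simp add: f_def s_def)
    qed
    show "count (f m) j = (if count m j < g then count m j else count m j - 1)"
      using ij by (auto simp: f_def)
  qed
  have "inj_on f {m \<in> ?F. count m j \<noteq> g}"
  proof (rule inj_onI)
    fix m m' assume m: "m \<in> {m \<in> ?F. count m j \<noteq> g}" "m' \<in> {m \<in> ?F. count m j \<noteq> g}" "f m = f m'"
    then have "count m j = count m' j"
      using cnt[of m] cnt[of m'] by (auto split: if_splits)
    then show "m = m'" using m by (intro key_inj) (auto simp: fiber_def)
  qed
  moreover have "f ` {m \<in> ?F. count m j \<noteq> g} \<subseteq> fiber (shadow B) (v - {#k#})" using mem by auto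
  moreover have "finite (fiber (shadow B) (v - {#k#}))"
    using finite_shadow[OF B] by (simp add: fiber_def)
  ultimately have "card {m \<in> ?F. count m j \<noteq> g} \<le> card (fiber (shadow B) (v - {#k#}))"
    by (rule card_inj_on_le)
  then show ?thesis using g by (simp add: s_def)
qed

text \<open>By \<open>mem_push_iff\<close> only fiber sizes matter. Dividing by a third variable
  maps fibers injectively into fibers of the shadow; dividing by \<open>i\<close> or
  \<open>j\<close> is the case of \<open>card_fiber_shadow\<close>.\<close>

lemma shadow_push_subset:
  assumes B: "finite B"
  shows "shadow (push B ` B) \<subseteq> push (shadow B) ` shadow B"
proof
  fix u assume "u \<in> shadow (push B ` B)"
  then obtain v k where v: "v \<in> push B ` B" "k \<in># v" and u: "u = v - {#k#}"
    by (auto simp: shadow_def)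
  have c: "count v j < card (fiber B v)" using v mem_push_iff[OF B] by blast
  have "count u j < card (fiber (shadow B) u)"
  proof (cases "k = i \<or> k = j")
    case True
    \<comment> \<open>The second bound answers the \<open>min\<close> in
      \<open>card_fiber_shadow\<close>: an occurrence of \<open>i\<close> keeps the exponent at
      \<open>j\<close> below the total, and removing \<open>j\<close> lowers that exponent by
      one.\<close>
    have "count u j < card (fiber B v) \<and> count u j < snd (key v)"
    proof (cases "k = i")
      case True
      then have "count v i > 0" using v by simp
      then show ?thesis using c ij by (simp add: u True key_def)
    next
      case False
      then have "k = j" using True by simp
      then have "count v j > 0" using v by simp
      then show ?thesis using c unfolding u \<open>k = j\<close> key_def by (auto simp: less_diff_conv2)
    qed
    then show ?thesis using card_fiber_shadow[OF B True v(2), folded u] by linarith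
  next
    case False
    have sub: "(\<lambda>m. m - {#k#}) ` fiber B v \<subseteq> fiber (shadow B) u"
    proof (rule image_subsetI)
      fix m assume m: "m \<in> fiber B v"
      then have e: "rest m = rest v" "snd (key m) = snd (key v)" by (auto simp: fiber_def key_def)
      have "k \<in># rest v" using v False by (simp add: rest_def)
      then have "k \<in># m" using e by (metis rest_def mem_Collect_eq set_mset_filter)
      then show "m - {#k#} \<in> fiber (shadow B) u"
        using m key_remove_other[of k m] key_remove_other[of k v] e False
        by (auto simp: fiber_def u intro: shadowI)
    qed
    have "inj_on (\<lambda>m. m - {#k#}) (fiber B v)"
    proof (rule inj_onI)
      fix m m' assume m: "m \<in> fiber B v" "m' \<in> fiber B v" "m - {#k#} = m' - {#k#}"
      then have "count m j = count m' j" using False by (metis count_add_mset count_diff count_single diff_zero)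
      then show "m = m'" using m by (intro key_inj) (auto simp: fiber_def)
    qed
    then have "card (fiber B v) \<le> card (fiber (shadow B) u)"
      using sub finite_shadow[OF B] by (intro card_inj_on_le) (auto simp: fiber_def)
    then show ?thesis using c False by (simp add: u)
  qed
  then show "u \<in> push (shadow B) ` shadow B" using mem_push_iff[OF finite_shadow[OF B]] by blast
qed

lemma card_shadow_push:
  assumes "finite B"
  shows "card (shadow (push B ` B)) \<le> card (shadow B)"
proof -
  have fin: "finite (shadow B)" using assms by (rule finite_shadow)
  have "card (shadow (push B ` B)) \<le> card (push (shadow B) ` shadow B)"
    using fin shadow_push_subset[OF assms] by (intro card_mono finite_imageI)
  also have "\<dots> \<le> card (shadow B)" using fin by (rule card_image_le)
  finally show ?thesis .
qed

section \<open>Compression preserves the degree and lowers the sum of the indices\<close>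

lemma size_mk: "b \<le> snd k \<Longrightarrow> size (mk k b) = size (fst k) + snd k"
  by (simp add: mk_def)

lemma size_push: "size (push S m) = size m"
proof -
  have "size (push S m) = size (fst (key m)) + snd (key m)"
    unfolding push_def using rk_le[of S m] count_le_key[of m] by (intro size_mk) simp
  also have "\<dots> = size m" using size_mk[OF count_le_key[of m]] by (simp add: mk_key)
  finally show ?thesis .
qed

lemma sum_mset_mk_less: "b < b' \<Longrightarrow> b' \<le> snd k \<Longrightarrow> \<Sum>\<^sub># (mk k b) < \<Sum>\<^sub># (mk k b')"
proof -
  assume b: "b < b'" "b' \<le> snd k"
  define e r where "e = b' - b" and "r = snd k - b'"
  have e: "b' = b + e" "snd k = b + e + r" using b by (auto simp: e_def r_def)
  have "e * i < e * j" using ij b by (simp add: e_def)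
  then show ?thesis by (simp add: mk_def e add_mult_distrib)
qed

lemma sum_mset_push_le: "\<Sum>\<^sub># (push S m) \<le> \<Sum>\<^sub># m"
  and sum_mset_push_less: "rk S m \<noteq> count m j \<Longrightarrow> \<Sum>\<^sub># (push S m) < \<Sum>\<^sub># m"
proof -
  show 1: "\<Sum>\<^sub># (push S m) < \<Sum>\<^sub># m" if "rk S m \<noteq> count m j"
  proof -
    have "rk S m < count m j" using that rk_le[of S m] by simp
    then have "\<Sum>\<^sub># (push S m) < \<Sum>\<^sub># (mk (key m) (count m j))"
      unfolding push_def by (intro sum_mset_mk_less count_le_key)
    then show ?thesis by (simp add: mk_key)
  qed
  show "\<Sum>\<^sub># (push S m) \<le> \<Sum>\<^sub># m"
  proof (cases "rk S m = count m j")
    case True then show ?thesis by (simp add: push_def mk_key)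
  qed (use 1 in simp)
qed

text \<open>A rank equal to the exponent means that all smaller exponents occur in the fiber, in
  particular the next smaller one, which is the exchanged monomial.\<close>

lemma shifted_mem:
  assumes "finite S" "m \<in> S" "j \<in># m" "rk S m = count m j"
  shows "add_mset i (m - {#j#}) \<in> S"
proof -
  let ?X = "{m' \<in> fiber S m. count m' j < count m j}"
  have "card ((\<lambda>m. count m j) ` ?X) = count m j"
    using assms(4) unfolding rk_def
    by (subst card_image) (auto intro: inj_on_subset[OF inj_on_fiber])
  then have "(\<lambda>m. count m j) ` ?X = {..<count m j}"
    by (intro card_subset_eq) auto
  moreover have "count m j > 0" using assms(3) by simp
  ultimately have "count m j - 1 \<in> (\<lambda>m. count m j) ` ?X" by simp
  then obtain m' where m': "m' \<in> S" "key m' = key m" "count m' j = count m j - 1"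
    by (auto simp: fiber_def)
  have "key (add_mset i (m - {#j#})) = key m"
    using \<open>count m j > 0\<close> ij by (auto simp: key_def rest_def multiset_eq_iff)
  then have "m' = add_mset i (m - {#j#})"
    using m' ij by (intro key_inj) auto
  then show ?thesis using m' by simp
qed

end

text \<open>Instead of iterating compressions, take an admissible family with least total index sum.
  Any compression that moved an element would lower this sum, so all exponents equal their ranks,
  and \<open>shifted_mem\<close> gives stability.\<close>

lemma ex_stable_small_shadow:
  assumes "finite B" "\<forall>m\<in>B. size m = t"
  shows "\<exists>B'. finite B' \<and> (\<forall>m\<in>B'. size m = t) \<and> card B' = card B \<and>
    card (shadow B') \<le> card (shadow B) \<and> stable 0 B'"
proof -
  let ?Q = "\<lambda>B'. finite B' \<and> (\<forall>m\<in>B'. size m = t) \<and> card B' = card B \<and> card (shadow B') \<le> card (shadow B)"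
  let ?W = "\<lambda>B'. (\<Sum>m\<in>B'. \<Sum>\<^sub># m)"
  obtain B' where Q: "?Q B'" and min: "\<And>C. ?Q C \<Longrightarrow> ?W B' \<le> ?W C"
    using ex_has_least_nat[of ?Q B ?W] assms by blast
  have "stable 0 B'"
    unfolding stable_def
  proof (intro ballI conjI)
    fix m j i assume m: "m \<in> B'" "j \<in># m" "i \<in> {0..<j}"
    then interpret compression i j by unfold_locales simp
    let ?C = "push B' ` B'"
    have "?Q ?C"
      using Q card_shadow_push[of B'] by (auto simp: size_push card_image inj_on_push)
    then have "?W B' \<le> ?W ?C" by (rule min)
    also have "?W ?C = (\<Sum>m\<in>B'. \<Sum>\<^sub># (push B' m))"
      using Q by (simp add: sum.reindex inj_on_push)
    finally have "\<not> (\<Sum>m\<in>B'. \<Sum>\<^sub># (push B' m)) < ?W B'" by simp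
    then have "rk B' m = count m j"
      using Q m sum_mset_push_le[of B'] sum_mset_push_less[of B' m]
        sum_strict_mono_ex1[of B' "\<lambda>m. \<Sum>\<^sub># (push B' m)" "\<lambda>m. \<Sum>\<^sub># m"] by blast
    then show "add_mset i (m - {#j#}) \<in> B'" using shifted_mem Q m by blast
  qed auto
  then show ?thesis using Q by blast
qed

section \<open>Macaulay's bound\<close>

text \<open>The rank of a monomial in its degree is a sum of binomial coefficients that is its Macaulay
  expansion, and multiplication by the variable of index \<open>0\<close> turns \<open>a\<close> into \<open>macaulay_upper a t\<close>.\<close>

definition below :: "nat \<Rightarrow> nat multiset \<Rightarrow> nat multiset set" where
  "below t m = {v. size v = t \<and> v < m}"

lemma finite_below: "finite (below t m)"
  by (rule finite_subset[OF _ finite_multisets_le[of t m]]) (auto simp: below_def)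

lemma card_below_less: "size m = t \<Longrightarrow> m < m' \<Longrightarrow> card (below t m) < card (below t m')"
  by (intro psubset_card_mono finite_below) (auto simp: below_def)

lemma card_below_inj:
  "size m = t \<Longrightarrow> size m' = t \<Longrightarrow> card (below t m) = card (below t m') \<Longrightarrow> m = m'"
  using card_below_less[of m t m'] card_below_less[of m' t m] by (metis less_irrefl linorder_neqE)

lemma below_zero: "below t (replicate_mset t 0) = {}"
proof -
  have False if "size v = t" and lt: "v < replicate_mset t 0" for v :: "nat multiset"
  proof -
    have "x = 0" if "x \<in># v" for x
      using le_multiset_bound[OF less_imp_le[OF lt] that] by (auto split: if_splits)
    then have "v = replicate_mset t 0"
      using \<open>size v = t\<close> by (metis set_mset_subset_singletonD singleton_iff subsetI)
    then show False using that by simp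
  qed
  then show ?thesis by (auto simp: below_def)
qed

text \<open>Monomials avoiding the top variable \<open>x\<close> are all smaller; those containing
  it are compared after cancelling it. The first kind contributes the leading binomial coefficient
  of the expansion.\<close>

lemma below_add_max:
  fixes x :: nat
  assumes "\<forall>y\<in>#M. y \<le> x"
  shows "below (Suc t) (add_mset x M) = multisets_of_size {..<x} (Suc t) \<union> add_mset x ` below t M"
proof (intro equalityI subsetI)
  fix v assume v: "v \<in> below (Suc t) (add_mset x M)"
  have le: "y \<le> x" if "y \<in># v" for y
    using le_multiset_bound[of v "add_mset x M" y] v that assms unfolding below_def by fastforce
  show "v \<in> multisets_of_size {..<x} (Suc t) \<union> add_mset x ` below t M"
  proof (cases "x \<in># v")
    case True
    then obtain v' where "v = add_mset x v'" by (metis insert_DiffM)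
    then show ?thesis using v by (auto simp: below_def)
  next
    case False
    then have "\<forall>y\<in>#v. y < x" using le by (metis le_neq_implies_less)
    then show ?thesis using v by (auto simp: below_def multisets_of_size_def)
  qed
next
  fix v assume "v \<in> multisets_of_size {..<x} (Suc t) \<union> add_mset x ` below t M"
  then show "v \<in> below (Suc t) (add_mset x M)"
  proof
    assume "v \<in> multisets_of_size {..<x} (Suc t)"
    then show ?thesis
      by (auto simp: below_def multisets_of_size_def intro!: ex_gt_imp_less_multiset)
  qed (auto simp: below_def)
qed

text \<open>For nondecreasing \<open>f\<close> this lists the variables of a monomial in order. The
  substitution m_k = f k + k - 1 turns weakly increasing indices into the strictly increasing tops
  of a Macaulay expansion.\<close>

definition mset_upto :: "(nat \<Rightarrow> nat) \<Rightarrow> nat \<Rightarrow> nat multiset" where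
  "mset_upto f t = mset (map f [1..<Suc t])"

lemma mset_upto_Suc: "mset_upto f (Suc t) = add_mset (f (Suc t)) (mset_upto f t)"
  by (simp add: mset_upto_def)

lemma size_mset_upto [simp]: "size (mset_upto f t) = t"
  by (simp add: mset_upto_def)

lemma card_below_mset_upto:
  assumes "\<And>k. 1 \<le> k \<Longrightarrow> k < t \<Longrightarrow> f k \<le> f (Suc k)"
  shows "card (below t (mset_upto f t)) = (\<Sum>k=1..t. (f k + k - 1) choose k)"
  using assms
proof (induction t)
  case 0
  then show ?case by (simp add: below_def mset_upto_def)
next
  case (Suc t)
  have mono: "f k \<le> f (Suc t)" if "1 \<le> k" "k \<le> t" for k
    using that(2,1)
  proof (induction rule: inc_induct)
    case base
    then show ?case using Suc.prems[of t] by (cases "k = t") auto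
  next
    case (step k)
    then show ?case using Suc.prems[of k] by simp
  qed
  have "\<forall>y\<in>#mset_upto f t. y \<le> f (Suc t)" using mono by (auto simp: mset_upto_def)
  note eq = below_add_max[OF this, of t]
  have "card (below (Suc t) (mset_upto f (Suc t))) =
      card (multisets_of_size {..<f (Suc t)} (Suc t)) + card (add_mset (f (Suc t)) ` below t (mset_upto f t))"
    unfolding mset_upto_Suc eq
  proof (rule card_Un_disjoint)
    show "multisets_of_size {..<f (Suc t)} (Suc t) \<inter> add_mset (f (Suc t)) ` below t (mset_upto f t) = {}"
      by (auto simp: multisets_of_size_def)
  qed (auto simp: finite_below)
  then show ?case using Suc.IH Suc.prems by (simp add: card_multisets_of_size card_image inj_on_def)
qed

lemma ex_mset_upto:
  assumes "size M = t"
  shows "\<exists>f. M = mset_upto f t \<and> (\<forall>k. 1 \<le> k \<longrightarrow> k < t \<longrightarrow> f k \<le> f (Suc k))"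
proof -
  let ?xs = "sorted_list_of_multiset M"
  have len: "length ?xs = t" using assms by (metis mset_sorted_list_of_multiset size_mset)
  define f where "f k = ?xs ! (k - 1)" for k
  have "map f [1..<Suc t] = ?xs"
    by (rule nth_equalityI) (auto simp: f_def len simp del: upt_Suc)
  then have "M = mset_upto f t" by (simp add: mset_upto_def del: upt_Suc)
  moreover have "f k \<le> f (Suc k)" if "1 \<le> k" "k < t" for k
    using that len sorted_nth_mono[of ?xs "k - 1" k] by (simp add: f_def)
  ultimately show ?thesis by blast
qed

text \<open>An extra index 0 moves every entry of the sorted list one place up, which raises both
  entries of its binomial coefficient by one. The new first place contributes nothing.\<close>

lemma card_below_add_zero:
  assumes "\<And>k. 1 \<le> k \<Longrightarrow> k < t \<Longrightarrow> f k \<le> f (Suc k)"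
  shows "card (below (Suc t) (add_mset 0 (mset_upto f t))) = (\<Sum>k=1..t. (f k + k) choose Suc k)"
proof -
  define g where "g k = (if k \<le> 1 then 0 else f (k - 1))" for k
  have "[1..<Suc (Suc t)] = 1 # map Suc [1..<Suc t]" by (metis One_nat_def map_Suc_upt upt_conv_Cons less_Suc_eq_0_disj Suc_less_eq zero_less_Suc)
  then have "mset_upto g (Suc t) = add_mset 0 (mset_upto f t)"
    unfolding mset_upto_def by (auto simp: g_def simp del: upt_Suc intro!: image_mset_cong arg_cong[where f = mset])
  moreover have "card (below (Suc t) (mset_upto g (Suc t))) = (\<Sum>k=1..Suc t. (g k + k - 1) choose k)"
  proof (rule card_below_mset_upto)
    fix k assume "1 \<le> k" "k < Suc t"
    then show "g k \<le> g (Suc k)" using assms[of "k - 1"] by (auto simp: g_def)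
  qed
  moreover have "(\<Sum>k=1..Suc t. (g k + k - 1) choose k) = (\<Sum>k=1..t. (g (Suc k) + Suc k - 1) choose Suc k)"
    by (simp add: sum.atLeast_Suc_atMost g_def sum.shift_bounds_cl_Suc_ivl del: sum.cl_ivl_Suc)
  ultimately show ?thesis by (simp add: g_def)
qed

text \<open>Every expansion of \<open>a\<close>, not just a chosen one, comes from a monomial of
  rank \<open>a\<close>; the uniqueness behind \<open>macaulay_upper\<close> rests on this.\<close>

lemma macaulay_expansion_below:
  assumes "macaulay_expansion a t j m"
  shows "\<exists>M. size M = t \<and> card (below t M) = a \<and>
    card (below (Suc t) (add_mset 0 M)) = (\<Sum>i=j..t. (m i + 1) choose (i + 1))"
proof -
  have j: "1 \<le> j" "j \<le> t" "j \<le> m j" and mono: "\<And>i. j \<le> i \<Longrightarrow> i < t \<Longrightarrow> m i < m (Suc i)"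
    and a: "a = (\<Sum>i=j..t. m i choose i)"
    using assms by (auto simp: macaulay_expansion_def)
  have ge: "k \<le> m k" if "j \<le> k" "k \<le> t" for k
    using that
  proof (induction rule: dec_induct)
    case (step k) then show ?case using mono[of k] by simp
  qed (rule j)
  \<comment> \<open>This inverts m_k = f k + k - 1. Places below \<open>j\<close> receive index 0,
    whose binomial coefficients vanish.\<close>
  define f where "f k = (if k < j then 0 else m k + 1 - k)" for k
  have f: "f k \<le> f (Suc k)" if "1 \<le> k" "k < t" for k
    using that mono[of k] by (auto simp: f_def)
  have split: "{1..t} = {1..<j} \<union> {j..t}" using j by auto
  have "card (below t (mset_upto f t)) = (\<Sum>k=1..t. (f k + k - 1) choose k)"
    by (rule card_below_mset_upto) (rule f)
  also have "\<dots> = (\<Sum>k\<in>{1..<j}. (f k + k - 1) choose k) + (\<Sum>k=j..t. (f k + k - 1) choose k)"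
    unfolding split by (rule sum.union_disjoint) auto
  also have "(\<Sum>k\<in>{1..<j}. (f k + k - 1) choose k) = 0" by (auto simp: f_def binomial_eq_0)
  also have "(\<Sum>k=j..t. (f k + k - 1) choose k) = a"
    unfolding a using j ge by (intro sum.cong) (auto simp: f_def le_SucI)
  finally have 1: "card (below t (mset_upto f t)) = a" by simp
  have "card (below (Suc t) (add_mset 0 (mset_upto f t))) = (\<Sum>k=1..t. (f k + k) choose Suc k)"
    by (rule card_below_add_zero) (rule f)
  also have "\<dots> = (\<Sum>k\<in>{1..<j}. (f k + k) choose Suc k) + (\<Sum>k=j..t. (f k + k) choose Suc k)"
    unfolding split by (rule sum.union_disjoint) auto
  also have "(\<Sum>k\<in>{1..<j}. (f k + k) choose Suc k) = 0" by (auto simp: f_def binomial_eq_0)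
  also have "(\<Sum>k=j..t. (f k + k) choose Suc k) = (\<Sum>i=j..t. (m i + 1) choose (i + 1))"
  proof (rule sum.cong)
    fix k assume "k \<in> {j..t}"
    then have "f k + k = m k + 1" using ge[of k] by (simp add: f_def)
    then show "(f k + k) choose Suc k = (m k + 1) choose (k + 1)" by simp
  qed simp
  finally show ?thesis using 1 by (intro exI[of _ "mset_upto f t"]) simp
qed

lemma ex_macaulay_expansion:
  assumes "size M = t" "card (below t M) > 0"
  shows "\<exists>j m. macaulay_expansion (card (below t M)) t j m"
proof -
  obtain f where f: "M = mset_upto f t" "\<And>k. 1 \<le> k \<Longrightarrow> k < t \<Longrightarrow> f k \<le> f (Suc k)"
    using ex_mset_upto[OF assms(1)] by blast
  have card: "card (below t M) = (\<Sum>k=1..t. (f k + k - 1) choose k)"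
    unfolding f(1) by (rule card_below_mset_upto) (rule f(2))
  have "\<exists>k\<in>{1..t}. f k > 0"
  proof (rule ccontr)
    assume "\<not> ?thesis"
    then have "(f k + k - 1) choose k = 0" if "k \<in> {1..t}" for k
      using that by (auto intro: binomial_eq_0)
    then have "(\<Sum>k=1..t. (f k + k - 1) choose k) = 0" by (intro sum.neutral) blast
    then show False using card assms(2) by linarith
  qed
  then obtain k where k: "1 \<le> k" "k \<le> t" "f k > 0" by auto
  \<comment> \<open>The expansion starts at the first positive index, since a place \<open>k\<close>
    with index 0 contributes \<open>(k - 1) choose k\<close>, which is 0.\<close>
  define j where "j = (LEAST k. 1 \<le> k \<and> f k > 0)"
  have j: "1 \<le> j" "f j > 0" using LeastI[of "\<lambda>k. 1 \<le> k \<and> f k > 0" k] k by (auto simp: j_def)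
  have low: "f i = 0" if "1 \<le> i" "i < j" for i
    using not_less_Least[of i "\<lambda>k. 1 \<le> k \<and> f k > 0"] that by (auto simp: j_def)
  have "j \<le> t" using Least_le[of "\<lambda>k. 1 \<le> k \<and> f k > 0" k] k by (auto simp: j_def)
  have split: "{1..t} = {1..<j} \<union> {j..t}" using j \<open>j \<le> t\<close> by auto
  have "(\<Sum>k=1..t. (f k + k - 1) choose k) =
      (\<Sum>k\<in>{1..<j}. (f k + k - 1) choose k) + (\<Sum>k=j..t. (f k + k - 1) choose k)"
    unfolding split by (rule sum.union_disjoint) auto
  also have "(\<Sum>k\<in>{1..<j}. (f k + k - 1) choose k) = 0" by (auto simp: low binomial_eq_0)
  finally have sum: "card (below t M) = (\<Sum>k=j..t. (f k + k - 1) choose k)" using card by simp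
  have "f i + i - 1 < f (Suc i) + Suc i - 1" if "j \<le> i" "i < t" for i
    using f(2)[of i] that j by simp
  then have "macaulay_expansion (card (below t M)) t j (\<lambda>k. f k + k - 1)"
    unfolding macaulay_expansion_def using j \<open>j \<le> t\<close> sum by auto
  then show ?thesis by blast
qed

text \<open>Two expansions of one number give monomials of equal rank, hence the same monomial, so
  the value chosen by \<open>THE\<close> is well defined. Rank 0 is the power of the variable 0 and
  is treated apart, because 0 has no expansion.\<close>

lemma macaulay_upper_below:
  assumes "t \<ge> 1" "size M = t"
  shows "macaulay_upper (card (below t M)) t = card (below (Suc t) (add_mset 0 M))"
proof (cases "card (below t M) = 0")
  case True
  then have "\<not> replicate_mset t 0 < M" using finite_below[of t M] by (auto simp: below_def)
  moreover have "\<not> M < replicate_mset t 0" using below_zero[of t] assms(2) by (auto simp: below_def)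
  ultimately have "M = replicate_mset t 0" by (metis linorder_neqE)
  then have "add_mset 0 M = replicate_mset (Suc t) 0" by simp
  then show ?thesis using True below_zero[of "Suc t"] by (simp add: macaulay_upper_def)
next
  case False
  let ?E = "\<lambda>b. \<exists>j m. macaulay_expansion (card (below t M)) t j m \<and> b = (\<Sum>i=j..t. (m i + 1) choose (i + 1))"
  have uniq: "b = card (below (Suc t) (add_mset 0 M))" if "?E b" for b
    using that macaulay_expansion_below[of "card (below t M)" t] card_below_inj[OF assms(2)] by metis
  obtain j m where jm: "macaulay_expansion (card (below t M)) t j m"
    using ex_macaulay_expansion[OF assms(2)] False by auto
  then have E: "?E (\<Sum>i=j..t. (m i + 1) choose (i + 1))" by blast
  have "(THE b. ?E b) = card (below (Suc t) (add_mset 0 M))"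
  proof (rule the_equality)
    show "?E (card (below (Suc t) (add_mset 0 M)))" using E unfolding uniq[OF E] .
  qed (rule uniq)
  then show ?thesis using False by (simp add: macaulay_upper_def)
qed

text \<open>Ranks have neither gaps nor an upper bound: with infinitely many variables each monomial
  of positive degree has an immediate successor in its degree.\<close>

lemma ex_card_below:
  assumes "t \<ge> 1"
  shows "\<exists>M. size M = t \<and> card (below t M) = a"
proof (induction a)
  case 0
  show ?case by (rule exI[of _ "replicate_mset t 0"]) (simp add: below_zero)
next
  case (Suc a)
  then obtain M where M: "size M = t" "card (below t M) = a" by blast
  let ?P = "\<lambda>v. size v = t \<and> M < v"
  have "x < Suc (Max (insert 0 (set_mset M)))" if "x \<in># M" for x
    using Max_ge[of "insert 0 (set_mset M)" x] that by (simp add: less_Suc_eq_le del: Max_insert)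
  then have "M < replicate_mset t (Suc (Max (insert 0 (set_mset M))))"
    using assms by (intro ex_gt_imp_less_multiset) auto
  then have ex: "?P (replicate_mset t (Suc (Max (insert 0 (set_mset M)))))" by simp
  define M' where "M' = (LEAST v. ?P v)"
  have M': "?P M'" unfolding M'_def using ex by (rule LeastI)
  have least: "M' \<le> v" if "?P v" for v unfolding M'_def using that by (rule Least_le)
  have "below t M' = insert M (below t M)"
    using M' M(1) least by (auto simp: below_def) (metis leD linorder_neqE)
  then show ?case using M M' finite_below[of t M] by (intro exI[of _ M']) (auto simp: below_def)
qed

text \<open>A stable replacement of \<open>B\<close> is compared with the segment of the same
  cardinality, whose quotient by the least variable then has at most \<open>card A\<close> elements.
  This limits how far the segment can reach.\<close>

theorem macaulay_bound:
  assumes t: "t \<ge> 1" and A: "finite A" "\<forall>m\<in>A. size m = t"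
    and B: "finite B" "\<forall>m\<in>B. size m = Suc t" and sub: "shadow B \<subseteq> A"
  shows "card B \<le> macaulay_upper (card A) t"
proof (cases "B = {}")
  case False
  obtain C where C: "finite C" "\<forall>m\<in>C. size m = Suc t" "card C = card B"
    "card (shadow C) \<le> card (shadow B)" "stable 0 C"
    using ex_stable_small_shadow[OF B] by blast
  have pos: "card B > 0" using False B(1) by (simp add: card_gt_0_iff)
  obtain w where w: "size w = Suc t" "card (below (Suc t) w) = card B - 1"
    using ex_card_below[of "Suc t" "card B - 1"] by auto
  have "seg 0 (Suc t) w = insert w (below (Suc t) w)"
    using w(1) by (auto simp: seg_def below_def)
  then have seg: "card (seg 0 (Suc t) w) = card B"
    using w pos finite_below[of "Suc t" w] by (simp add: below_def)
  have "card (quot 0 (seg 0 (Suc t) w)) \<le> card (quot 0 C)"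
    using stable_quot_seg_le[OF C(1,2,5) w(1)] seg C(3) by simp
  also have "quot 0 C \<subseteq> shadow C"
    by (auto simp: quot_def shadow_def) (metis add_mset_remove_trivial union_single_eq_member)
  then have "card (quot 0 C) \<le> card (shadow C)"
    by (intro card_mono finite_shadow C(1))
  also have "\<dots> \<le> card A" using C(4) card_mono[OF A(1) sub] by simp
  finally have le: "card (quot 0 (seg 0 (Suc t) w)) \<le> card A" by simp
  obtain M where M: "size M = t" "card (below t M) = card A" using ex_card_below[OF t] by blast
  \<comment> \<open>If the segment reached \<open>add_mset 0 M\<close>, its quotient would contain
    \<open>M\<close> and everything below it, which is one monomial too many.\<close>
  have "seg 0 (Suc t) w \<subseteq> below (Suc t) (add_mset 0 M)"
  proof (rule ccontr)
    assume "\<not> ?thesis"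
    then have ge: "add_mset 0 M \<le> w" by (force simp: seg_def below_def)
    have "insert M (below t M) \<subseteq> quot 0 (seg 0 (Suc t) w)"
      using ge M(1) by (auto simp: seg_def below_def quot_def intro: order_trans[OF add_mset_le_right_le[OF less_imp_le]])
    then have "card (insert M (below t M)) \<le> card (quot 0 (seg 0 (Suc t) w))"
      by (intro card_mono finite_quot finite_seg)
    then show False using le M finite_below[of t M] by (simp add: below_def)
  qed
  then have "card B \<le> card (below (Suc t) (add_mset 0 M))"
    using seg card_mono[OF finite_below] by metis
  then show ?thesis using macaulay_upper_below[OF t M(1)] M(2) by simp
qed simp

section \<open>Linear algebra of families of functions\<close>

definition fscale :: "'k::field \<Rightarrow> ('b \<Rightarrow> 'k) \<Rightarrow> 'b \<Rightarrow> 'k" where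
  "fscale c f = (\<lambda>x. c * f x)"

interpretation fs: vector_space "fscale :: 'k::field \<Rightarrow> ('b \<Rightarrow> 'k) \<Rightarrow> 'b \<Rightarrow> 'k"
  by unfold_locales (auto simp: fscale_def algebra_simps fun_eq_iff)

lemma fscale_apply: "fscale c f x = c * f x"
  by (simp add: fscale_def)

lemma sum_fun_apply: "(\<Sum>a\<in>A. f a) x = (\<Sum>a\<in>A. f a x)" for f :: "'a \<Rightarrow> 'b \<Rightarrow> 'c::comm_monoid_add"
  by (induction A rule: infinite_finite_induct) auto

lemma dim_insert_finite:
  fixes S :: "('b \<Rightarrow> 'k::field) set"
  assumes "finite S"
  shows "fs.dim (insert x S) = (if x \<in> fs.span S then fs.dim S else Suc (fs.dim S))"
proof (cases "x \<in> fs.span S")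
  case True
  then show ?thesis using fs.span_redundant[OF True] by (metis fs.dim_span)
next
  case False
  obtain B where B: "B \<subseteq> S" "fs.independent B" "S \<subseteq> fs.span B" "card B = fs.dim S"
    by (rule fs.basis_exists)
  have "x \<notin> fs.span B" using False fs.span_mono[OF B(1)] by blast
  then have "fs.independent (insert x B)" using B(2) by (rule fs.independent_insertI)
  moreover have "insert x S \<subseteq> fs.span (insert x B)"
    using B(3) fs.span_mono[of B "insert x B"] by (auto intro: fs.span_base)
  moreover have "x \<notin> B" using \<open>x \<notin> fs.span B\<close> fs.span_base by blast
  moreover have "finite B" using B(1) assms by (rule finite_subset)
  ultimately show ?thesis
    using fs.basis_card_eq_dim[of "insert x B" "insert x S"] B(4) False insert_mono[OF B(1)] by simp
qed

lemma mem_span_image: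
  fixes \<phi> :: "'a \<Rightarrow> 'b \<Rightarrow> 'k::field"
  assumes "finite A"
  shows "f \<in> fs.span (\<phi> ` A) \<longleftrightarrow> (\<exists>c. \<forall>x. f x = (\<Sum>a\<in>A. c a * \<phi> a x))"
proof
  assume "f \<in> fs.span (\<phi> ` A)"
  then show "\<exists>c. \<forall>x. f x = (\<Sum>a\<in>A. c a * \<phi> a x)"
  proof (induction rule: fs.span_induct_alt)
    case base
    show ?case by (rule exI[of _ "\<lambda>_. 0"]) simp
  next
    case (step k g h)
    then obtain a c where a: "a \<in> A" "g = \<phi> a" and c: "\<And>x. h x = (\<Sum>a\<in>A. c a * \<phi> a x)" by blast
    have "(fscale k g + h) x = (\<Sum>b\<in>A. (c b + (if b = a then k else 0)) * \<phi> b x)" for x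
      using a assms by (simp add: fscale_apply c distrib_right sum.distrib if_distrib[of "\<lambda>z. z * _"] sum.delta cong: if_cong)
    then show ?case by (intro exI[of _ "\<lambda>b. c b + (if b = a then k else 0)"]) blast
  qed
next
  assume "\<exists>c. \<forall>x. f x = (\<Sum>a\<in>A. c a * \<phi> a x)"
  then obtain c where "\<And>x. f x = (\<Sum>a\<in>A. c a * \<phi> a x)" by blast
  then have "f = (\<Sum>a\<in>A. fscale (c a) (\<phi> a))" by (simp add: fun_eq_iff sum_fun_apply fscale_apply)
  then show "f \<in> fs.span (\<phi> ` A)" by (simp only:) (intro fs.span_sum fs.span_scale fs.span_base imageI)
qed

text \<open>The dimension of a finite family depends only on its linear relations, so functions on
  different sets can be compared: each insertion raises both dimensions or neither.\<close>

lemma dim_image_cong: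
  fixes \<phi> :: "'a \<Rightarrow> 'b \<Rightarrow> 'k::field" and \<psi> :: "'a \<Rightarrow> 'c \<Rightarrow> 'k"
  assumes "finite A"
    and "\<And>c. (\<forall>x. (\<Sum>a\<in>A. c a * \<phi> a x) = 0) \<longleftrightarrow> (\<forall>y. (\<Sum>a\<in>A. c a * \<psi> a y) = 0)"
  shows "fs.dim (\<phi> ` A) = fs.dim (\<psi> ` A)"
  using assms
proof (induction A rule: finite_induct)
  case empty
  have "fs.dim ({} :: ('b \<Rightarrow> 'k) set) = 0" "fs.dim ({} :: ('c \<Rightarrow> 'k) set) = 0"
    using fs.dim_eq_card_independent[OF fs.independent_empty] by auto
  then show ?case by simp
next
  case (insert a A)
  have rel: "(\<forall>x. (\<Sum>b\<in>A. c b * \<phi> b x) = 0) \<longleftrightarrow> (\<forall>y. (\<Sum>b\<in>A. c b * \<psi> b y) = 0)" for c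
  proof -
    have "(\<Sum>b\<in>A. (c(a := 0)) b * \<phi> b x) = (\<Sum>b\<in>A. c b * \<phi> b x)"
      "(\<Sum>b\<in>A. (c(a := 0)) b * \<psi> b y) = (\<Sum>b\<in>A. c b * \<psi> b y)" for x y
      using insert.hyps(2) by (auto intro!: sum.cong)
    then show ?thesis using insert.prems[of "c(a := 0)"] insert.hyps by simp
  qed
  have rel1: "(\<forall>x. \<phi> a x = (\<Sum>b\<in>A. c b * \<phi> b x)) \<longleftrightarrow> (\<forall>y. \<psi> a y = (\<Sum>b\<in>A. c b * \<psi> b y))" for c
  proof -
    have "(\<Sum>b\<in>A. ((\<lambda>b. - c b)(a := 1)) b * \<phi> b x) = - (\<Sum>b\<in>A. c b * \<phi> b x)"
      "(\<Sum>b\<in>A. ((\<lambda>b. - c b)(a := 1)) b * \<psi> b y) = - (\<Sum>b\<in>A. c b * \<psi> b y)" for x y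
      using insert.hyps(2) by (auto simp: sum_negf[symmetric] intro!: sum.cong)
    then show ?thesis using insert.prems[of "(\<lambda>b. - c b)(a := 1)"] insert.hyps by simp
  qed
  have "\<phi> a \<in> fs.span (\<phi> ` A) \<longleftrightarrow> \<psi> a \<in> fs.span (\<psi> ` A)"
    unfolding mem_span_image[OF insert.hyps(1)] using rel1 by blast
  then show ?case using insert.IH[OF rel] insert.hyps by (simp add: dim_insert_finite)
qed

text \<open>The indices surviving the greedy choice of a basis along \<open>R\<close>.\<close>

definition std_monoms :: "('a \<Rightarrow> 'b \<Rightarrow> 'k::field) \<Rightarrow> ('a \<Rightarrow> 'a \<Rightarrow> bool) \<Rightarrow> 'a set \<Rightarrow> 'a set" where
  "std_monoms \<phi> R A = {m \<in> A. \<phi> m \<notin> fs.span (\<phi> ` {m' \<in> A. R m' m})}"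

text \<open>The order is a parameter because three are used: the multiset order, its refinement of
  degree, and the variant in which larger degrees come first.\<close>

lemma card_std_monoms:
  assumes "finite A" "asymp_on A R" "transp_on A R" "totalp_on A R"
  shows "card (std_monoms \<phi> R A) = fs.dim (\<phi> ` A)"
  using assms
proof (induction "card A" arbitrary: A)
  case 0
  then show ?case using fs.dim_eq_card_independent[OF fs.independent_empty] by (auto simp: std_monoms_def)
next
  case (Suc n)
  have "A \<noteq> {}" using Suc.hyps(2) by auto
  then obtain m where m: "m \<in> A" "\<And>x. x \<in> A \<Longrightarrow> x \<noteq> m \<Longrightarrow> \<not> R m x"
    using Finite_Set.bex_max_element[OF Suc.prems(1,2,3)] by blast
  have lt: "R x m" if "x \<in> A" "x \<noteq> m" for x
    using m that Suc.prems(4) by (auto dest: totalp_onD)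
  have irr: "\<not> R m m" using m(1) Suc.prems(2) by (auto dest: asymp_onD)
  let ?A = "A - {m}"
  have IH: "card (std_monoms \<phi> R ?A) = fs.dim (\<phi> ` ?A)"
    using Suc.prems m(1) Suc.hyps(2)
    by (intro Suc.hyps(1)) (auto intro: asymp_on_subset transp_on_subset totalp_on_subset)
  have below_m: "{m' \<in> A. R m' m} = ?A" using lt irr by auto
  have "m \<in> std_monoms \<phi> R A \<longleftrightarrow> \<phi> m \<notin> fs.span (\<phi> ` ?A)" using m(1) by (simp add: std_monoms_def below_m)
  moreover have "x \<in> std_monoms \<phi> R A \<longleftrightarrow> x \<in> std_monoms \<phi> R ?A" if "x \<noteq> m" for x
  proof (cases "x \<in> A")
    case True
    then have "{m' \<in> A. R m' x} = {m' \<in> ?A. R m' x}" using m(2) that by auto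
    then show ?thesis using True that unfolding std_monoms_def by simp
  qed (simp add: std_monoms_def)
  moreover have "m \<notin> std_monoms \<phi> R ?A" by (simp add: std_monoms_def)
  ultimately have "x \<in> std_monoms \<phi> R A \<longleftrightarrow> x \<in> (if \<phi> m \<in> fs.span (\<phi> ` ?A) then {} else {m}) \<union> std_monoms \<phi> R ?A" for x
    by (cases "x = m") simp_all
  then have "std_monoms \<phi> R A = (if \<phi> m \<in> fs.span (\<phi> ` ?A) then {} else {m}) \<union> std_monoms \<phi> R ?A"
    by blast
  moreover have "finite (std_monoms \<phi> R ?A)" "m \<notin> std_monoms \<phi> R ?A" using Suc.prems(1) by (auto simp: std_monoms_def)
  ultimately have "card (std_monoms \<phi> R A) = (if \<phi> m \<in> fs.span (\<phi> ` ?A) then fs.dim (\<phi> ` ?A) else Suc (fs.dim (\<phi> ` ?A)))"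
    using IH by simp
  also have "\<dots> = fs.dim (insert (\<phi> m) (\<phi> ` ?A))" using Suc.prems(1) by (simp add: dim_insert_finite)
  also have "insert (\<phi> m) (\<phi> ` ?A) = \<phi> ` A" using m(1) by auto
  finally show ?case .
qed

text \<open>Multiplying a relation that expresses \<phi> m through earlier functions by \<chi>
  expresses \<phi> (m + k) through earlier ones. Two index sets are allowed because multiplication
  may change the degree.\<close>

lemma std_monoms_factor_closed:
  assumes mem: "m + k \<in> std_monoms \<phi> R A'" and m: "m \<in> A"
    and mult: "\<And>m. \<phi> (m + k) = \<phi> m * \<chi>"
    and R: "\<And>m'. m' \<in> A \<Longrightarrow> R m' m \<Longrightarrow> m' + k \<in> A' \<and> R (m' + k) (m + k)"
  shows "m \<in> std_monoms \<phi> R A"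
proof (rule ccontr)
  assume "m \<notin> std_monoms \<phi> R A"
  then have "\<phi> m \<in> fs.span (\<phi> ` {m' \<in> A. R m' m})" using m by (simp add: std_monoms_def)
  then have "\<phi> m * \<chi> \<in> fs.span (\<phi> ` {m' \<in> A'. R m' (m + k)})"
  proof (induction rule: fs.span_induct_alt)
    case base
    have "0 * \<chi> = 0" by (simp add: fun_eq_iff)
    then show ?case by (simp only: fs.span_zero)
  next
    case (step c x y)
    then obtain m' where m': "m' \<in> A" "R m' m" "x = \<phi> m'" by blast
    have "x * \<chi> = \<phi> (m' + k)" by (simp add: mult m')
    then have "x * \<chi> \<in> fs.span (\<phi> ` {m' \<in> A'. R m' (m + k)})"
      using R[OF m'(1,2)] by (auto intro: fs.span_base)
    moreover have "(fscale c x + y) * \<chi> = fscale c (x * \<chi>) + y * \<chi>"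
      by (simp add: fun_eq_iff fscale_apply algebra_simps)
    ultimately show ?case using step.IH by (simp only: fs.span_add fs.span_scale)
  qed
  then show False using mem by (simp add: std_monoms_def mult)
qed

text \<open>Inserting one function adds at most one dimension of relations that hold on the chosen
  points but not on \<open>S\<close>, and a single further point removes it.\<close>

lemma ex_finite_determining_subset:
  fixes \<phi> :: "'a \<Rightarrow> 'b \<Rightarrow> 'k::field"
  assumes "finite A"
  shows "\<exists>S'\<subseteq>S. finite S' \<and> (\<forall>c. (\<forall>v\<in>S'. (\<Sum>a\<in>A. c a * \<phi> a v) = 0) \<longrightarrow> (\<forall>v\<in>S. (\<Sum>a\<in>A. c a * \<phi> a v) = 0))"
  using assms
proof (induction A rule: finite_induct)
  case empty
  show ?case by (rule exI[of _ "{}"]) simp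
next
  case (insert a A)
  then obtain S0 where S0: "S0 \<subseteq> S" "finite S0"
    "\<And>c. (\<forall>v\<in>S0. (\<Sum>a\<in>A. c a * \<phi> a v) = 0) \<Longrightarrow> (\<forall>v\<in>S. (\<Sum>a\<in>A. c a * \<phi> a v) = 0)"
    by blast
  let ?r = "\<lambda>c v. (\<Sum>b\<in>insert a A. c b * \<phi> b v)"
  show ?case
  proof (cases "\<exists>g s. s \<in> S \<and> (\<forall>v\<in>S0. ?r g v = 0) \<and> ?r g s \<noteq> 0")
    case False
    then show ?thesis using S0 by (intro exI[of _ S0]) blast
  next
    case True
    then obtain g s where g: "s \<in> S" "\<forall>v\<in>S0. ?r g v = 0" "?r g s \<noteq> 0" by blast
    have ga: "g a \<noteq> 0"
    proof
      assume "g a = 0"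
      then have "?r g v = (\<Sum>b\<in>A. g b * \<phi> b v)" for v using insert.hyps by simp
      then show False using S0(3)[of g] g by simp
    qed
    have "\<forall>v\<in>S. ?r c v = 0" if c: "\<forall>v\<in>insert s S0. ?r c v = 0" for c
    proof -
      \<comment> \<open>Subtracting the multiple of the spurious relation \<open>g\<close> that
        cancels the coefficient at \<open>a\<close> leaves a relation among the old functions, to
        which \<open>S0(3)\<close> applies.\<close>
      define e where "e b = c b - c a / g a * g b" for b
      have re: "?r e v = ?r c v - c a / g a * ?r g v" for v
        by (simp add: e_def left_diff_distrib sum_subtractf sum_distrib_left mult.assoc)
      have ea: "e a = 0" using ga by (simp add: e_def)
      then have re': "?r e v = (\<Sum>b\<in>A. e b * \<phi> b v)" for v using insert.hyps by simp
      have "\<forall>v\<in>S0. ?r e v = 0" using re c g(2) by simp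
      then have z: "\<forall>v\<in>S. ?r e v = 0" using S0(3)[of e] re' by simp
      then have "c a / g a * ?r g s = 0" using re[of s] c g(1) by simp
      then have "c a = 0" using g(3) ga by simp
      then show ?thesis using re z by simp
    qed
    then show ?thesis using S0(1,2) g(1) by (intro exI[of _ "insert s S0"]) blast
  qed
qed

section \<open>Hilbert functions of sets of vectors\<close>

abbreviation msets :: "nat \<Rightarrow> nat \<Rightarrow> nat multiset set" where
  "msets n t \<equiv> multisets_of_size {..n} t"

definition ev :: "(nat \<Rightarrow> 'k::field) \<Rightarrow> nat multiset \<Rightarrow> 'k" where
  "ev v M = prod_mset (image_mset v M)"

lemma ev_empty [simp]: "ev v {#} = 1"
  and ev_add_mset [simp]: "ev v (add_mset i M) = v i * ev v M"
  and ev_union [simp]: "ev v (M + M') = ev v M * ev v M'"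
  by (simp_all add: ev_def)

lemma ev_scale: "ev (\<lambda>i. c * v i) M = c ^ size M * ev v M"
  by (induction M) (simp_all add: mult_ac)

text \<open>Extension by zero keeps all functions on one type, while relations between them are
  tested on \<open>S\<close> alone.\<close>

definition rest_ev :: "(nat \<Rightarrow> 'k::field) set \<Rightarrow> nat multiset \<Rightarrow> (nat \<Rightarrow> 'k) \<Rightarrow> 'k" where
  "rest_ev S M v = (if v \<in> S then ev v M else 0)"

definition hfun :: "(nat \<Rightarrow> 'k::field) set \<Rightarrow> nat \<Rightarrow> nat \<Rightarrow> nat" where
  "hfun S n t = fs.dim (rest_ev S ` msets n t)"

lemma finite_msets: "finite (msets n t)"
  by auto

lemma msets_iff: "M \<in> msets n t \<longleftrightarrow> set_mset M \<subseteq> {..n} \<and> size M = t"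
  by (auto simp: multisets_of_size_def)

lemma dim_singleton: "f \<noteq> 0 \<Longrightarrow> fs.dim {f} = Suc 0"
  using dim_insert_finite[of "{}" f] fs.dim_eq_card_independent[OF fs.independent_empty] by simp

lemma hfun_0:
  assumes "S \<noteq> {}"
  shows "hfun S n 0 = 1"
proof -
  have "msets n 0 = {{#}}" by (auto simp: msets_iff)
  moreover obtain v where "v \<in> S" using assms by blast
  then have "rest_ev S {#} v \<noteq> 0" by (simp add: rest_ev_def)
  then have "rest_ev S {#} \<noteq> 0" by (metis zero_fun_apply)
  ultimately show ?thesis by (simp add: hfun_def dim_singleton)
qed

lemma rest_ev_add: "rest_ev S (M + K) = rest_ev S M * (\<lambda>v. ev v K)"
  by (simp add: fun_eq_iff rest_ev_def)

lemma hfun_growth: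
  assumes "t \<ge> 1"
  shows "hfun S n (Suc t) \<le> macaulay_upper (hfun S n t) t"
proof -
  let ?M = "\<lambda>t. std_monoms (rest_ev S) (<) (msets n t)"
  have card: "card (?M t) = hfun S n t" for t
    unfolding hfun_def by (rule card_std_monoms) (auto intro: finite_msets)
  have "shadow (?M (Suc t)) \<subseteq> ?M t"
  proof
    fix u assume "u \<in> shadow (?M (Suc t))"
    then obtain m k where m: "m \<in> ?M (Suc t)" "k \<in># m" "u = m - {#k#}" by (auto simp: shadow_def)
    then have eq: "m = u + {#k#}" by simp
    have mem: "u + {#k#} \<in> msets n (Suc t)" using m(1) by (simp add: std_monoms_def eq)
    show "u \<in> ?M t"
    proof (rule std_monoms_factor_closed[OF m(1)[unfolded eq], of _ "\<lambda>v. ev v {#k#}"])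
      show "u \<in> msets n t" using mem by (simp add: msets_iff)
      show "rest_ev S (m + {#k#}) = rest_ev S m * (\<lambda>v. ev v {#k#})" for m by (rule rest_ev_add)
      fix m' assume "m' \<in> msets n t" "m' < u"
      then show "m' + {#k#} \<in> msets n (Suc t) \<and> m' + {#k#} < u + {#k#}"
        using mem by (simp add: msets_iff)
    qed
  qed
  moreover have "finite (?M t)" for t
    by (rule finite_subset[OF _ finite_msets]) (auto simp: std_monoms_def)
  moreover have "\<forall>m\<in>?M t. size m = t" for t by (simp add: std_monoms_def msets_iff)
  ultimately show ?thesis
    using macaulay_bound[OF assms, of "?M t" "?M (Suc t)"] by (simp add: card)
qed

text \<open>Coefficients on the moment curve reduce the choice to one parameter: each vector
  excludes only the roots of a nonzero polynomial in \<open>a\<close>, and the field is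
  infinite.\<close>

lemma ex_linear_form_nonzero:
  fixes S :: "(nat \<Rightarrow> 'k::{field, ring_char_0}) set"
  assumes "finite S" "S \<subseteq> nonzero_vectors n"
  shows "\<exists>a. \<forall>v\<in>S. (\<Sum>i\<le>n. a ^ i * v i) \<noteq> 0"
proof -
  define p where "p v = (\<Sum>i\<le>n. Polynomial.monom (v i) i)" for v :: "nat \<Rightarrow> 'k"
  have nz: "p v \<noteq> 0" if "v \<in> S" for v
  proof -
    have "v \<in> nonzero_vectors n" using that assms(2) by blast
    then obtain i where i: "i \<le> n" "v i \<noteq> 0" by (auto simp: nonzero_vectors_def)
    have "Polynomial.coeff (p v) i = v i" using i(1) by (simp add: p_def Polynomial.coeff_sum Polynomial.coeff_monom)
    then show ?thesis using i(2) by auto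
  qed
  have "finite (\<Union>v\<in>S. {a. poly (p v) a = 0})"
    using assms(1) nz poly_roots_finite by blast
  then obtain a where "a \<notin> (\<Union>v\<in>S. {a. poly (p v) a = 0})"
    using ex_new_if_finite infinite_UNIV_char_0 by blast
  then show ?thesis
    by (intro exI[of _ a]) (auto simp: p_def poly_sum poly_monom mult.commute)
qed

text \<open>After division by powers of \<open>l\<close>, multiplication by \<open>l\<close> becomes
  the identity, so the spaces of successive degrees form an increasing chain on the finite set. In
  an order comparing degrees first, the standard monomials of degree exactly s count the growth at
  step s.\<close>

lemma hfun_difference_growth:
  fixes S :: "(nat \<Rightarrow> 'k::{field, ring_char_0}) set"
  assumes S: "S \<subseteq> nonzero_vectors n"
  shows "hfun S n t \<le> hfun S n (Suc t) \<and> (t \<ge> 1 \<longrightarrow>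
     hfun S n (Suc t) - hfun S n t \<le> macaulay_upper (hfun S n t - hfun S n (t - 1)) t)"
proof -
  define A where "A s = (\<Union>r\<le>s. msets n r)" for s
  have memA: "M \<in> A s \<longleftrightarrow> set_mset M \<subseteq> {..n} \<and> size M \<le> s" for M s
    by (auto simp: A_def msets_iff)
  have finA: "finite (A s)" for s by (auto simp: A_def)
  \<comment> \<open>The degrees t - 1, t and t + 1 enter the claim; the finite set must carry all
    relations up to the last of them.\<close>
  define T where "T = Suc t"
  obtain S' where S': "S' \<subseteq> S" "finite S'" and det: "\<And>c. (\<forall>v\<in>S'. (\<Sum>M\<in>A T. c M * ev v M) = 0) \<Longrightarrow>
      (\<forall>v\<in>S. (\<Sum>M\<in>A T. c M * ev v M) = 0)"
    using ex_finite_determining_subset[OF finA[of T], of S "\<lambda>M v. ev v M"] by blast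
  obtain a where a: "\<And>v. v \<in> S' \<Longrightarrow> (\<Sum>i\<le>n. a ^ i * v i) \<noteq> 0"
    using ex_linear_form_nonzero[OF S'(2)] S S'(1) by (meson order_trans)
  define l where "l v = (\<Sum>i\<le>n. a ^ i * v i)" for v :: "nat \<Rightarrow> 'k"
  define \<psi> where "\<psi> M v = (if v \<in> S' then ev v M / l v ^ size M else 0)" for M v
  have dim_eq: "fs.dim (\<psi> ` msets n s) = hfun S n s" if "s \<le> T" for s
    unfolding hfun_def
  proof (rule dim_image_cong[OF finite_msets])
    fix c :: "nat multiset \<Rightarrow> 'k"
    have "(\<Sum>M\<in>msets n s. c M * \<psi> M v) =
        (if v \<in> S' then (\<Sum>M\<in>msets n s. c M * ev v M) / l v ^ s else 0)" for v
      by (auto simp: \<psi>_def sum_divide_distrib msets_iff intro!: sum.cong)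
    moreover have "l v \<noteq> 0" if "v \<in> S'" for v using a[OF that] by (simp add: l_def)
    ultimately have "(\<forall>v. (\<Sum>M\<in>msets n s. c M * \<psi> M v) = 0) \<longleftrightarrow> (\<forall>v\<in>S'. (\<Sum>M\<in>msets n s. c M * ev v M) = 0)"
      by auto
    also have "\<dots> \<longleftrightarrow> (\<forall>v\<in>S. (\<Sum>M\<in>msets n s. c M * ev v M) = 0)"
    proof
      let ?c = "\<lambda>M. if M \<in> msets n s then c M else 0"
      have "(\<Sum>M\<in>A T. ?c M * ev v M) = (\<Sum>M\<in>msets n s. c M * ev v M)" for v
        using \<open>s \<le> T\<close> finA by (intro sum.mono_neutral_cong_right) (auto simp: A_def)
      then show "\<forall>v\<in>S. (\<Sum>M\<in>msets n s. c M * ev v M) = 0"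
        if "\<forall>v\<in>S'. (\<Sum>M\<in>msets n s. c M * ev v M) = 0"
        using det[of ?c] that by simp
    qed (use S'(1) in auto)
    also have "\<dots> \<longleftrightarrow> (\<forall>v. (\<Sum>M\<in>msets n s. c M * rest_ev S M v) = 0)"
    proof -
      have "(\<Sum>M\<in>msets n s. c M * rest_ev S M v) = (if v \<in> S then (\<Sum>M\<in>msets n s. c M * ev v M) else 0)" for v
        by (simp add: rest_ev_def)
      then show ?thesis by auto
    qed
    finally show "(\<forall>v. (\<Sum>M\<in>msets n s. c M * \<psi> M v) = 0) \<longleftrightarrow> (\<forall>v. (\<Sum>M\<in>msets n s. c M * rest_ev S M v) = 0)" .
  qed
  have step: "\<psi> ` msets n s \<subseteq> fs.span (\<psi> ` msets n (Suc s))" for s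
  proof (rule image_subsetI)
    fix M assume M: "M \<in> msets n s"
    \<comment> \<open>This is multiplication by 1 = l / l, with the numerator expanded.\<close>
    have "\<psi> M v = (\<Sum>i\<le>n. a ^ i * \<psi> (add_mset i M) v)" for v
    proof (cases "v \<in> S'")
      case True
      then have "l v \<noteq> 0" using a by (simp add: l_def)
      have "(\<Sum>i\<le>n. a ^ i * \<psi> (add_mset i M) v) = (\<Sum>i\<le>n. a ^ i * v i) * ev v M / (l v * l v ^ size M)"
        using True by (simp add: \<psi>_def sum_distrib_right sum_divide_distrib mult.assoc)
      also have "\<dots> = \<psi> M v" using True \<open>l v \<noteq> 0\<close> by (simp add: \<psi>_def l_def[symmetric])
      finally show ?thesis by simp
    qed (simp add: \<psi>_def)
    then have "\<psi> M \<in> fs.span ((\<lambda>i. \<psi> (add_mset i M)) ` {..n})"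
      by (subst mem_span_image) auto
    moreover have "(\<lambda>i. \<psi> (add_mset i M)) ` {..n} \<subseteq> \<psi> ` msets n (Suc s)"
      using M by (auto simp: msets_iff)
    ultimately show "\<psi> M \<in> fs.span (\<psi> ` msets n (Suc s))" using fs.span_mono by blast
  qed
  have up: "\<psi> ` msets n r \<subseteq> fs.span (\<psi> ` msets n s)" if "r \<le> s" for r s
    using that
  proof (induction rule: dec_induct)
    case base
    show ?case by (rule fs.span_superset)
  next
    case (step m)
    have "fs.span (\<psi> ` msets n m) \<subseteq> fs.span (\<psi> ` msets n (Suc m))"
      using \<open>\<And>s. \<psi> ` msets n s \<subseteq> fs.span (\<psi> ` msets n (Suc s))\<close> by (intro fs.span_minimal fs.subspace_span)
    then show ?case using step.IH by blast
  qed
  have dimA: "fs.dim (\<psi> ` A s) = hfun S n s" if "s \<le> T" for s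
  proof -
    have "fs.span (\<psi> ` A s) = fs.span (\<psi> ` msets n s)"
    proof
      have "\<psi> ` A s \<subseteq> fs.span (\<psi> ` msets n s)" using up by (auto simp: A_def)
      then show "fs.span (\<psi> ` A s) \<subseteq> fs.span (\<psi> ` msets n s)" by (intro fs.span_minimal fs.subspace_span)
      show "fs.span (\<psi> ` msets n s) \<subseteq> fs.span (\<psi> ` A s)" by (intro fs.span_mono) (auto simp: A_def)
    qed
    then show ?thesis using dim_eq[OF that] fs.span_eq_dim by metis
  qed
  \<comment> \<open>With lower degrees first, whether a monomial of degree at most s is standard
    does not depend on the higher ones, so one set \<open>W\<close> serves all the
    truncations.\<close>
  define R where "R m' m \<longleftrightarrow> size m' < size m \<or> size m' = size m \<and> m' < m" for m' m :: "nat multiset"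
  have R: "asymp_on X R" "transp_on X R" "totalp_on X R" for X
    by (auto simp: R_def asymp_on_def transp_on_def totalp_on_def)
  define W where "W = std_monoms \<psi> R (A T)"
  have finW: "finite W" unfolding W_def std_monoms_def using finA by simp
  have W: "std_monoms \<psi> R (A s) = {m \<in> W. size m \<le> s}" if "s \<le> T" for s
  proof -
    have "{m' \<in> A s. R m' m} = {m' \<in> A T. R m' m}" if "size m \<le> s" for m
      using that \<open>s \<le> T\<close> by (auto simp: memA R_def)
    then show ?thesis using that by (auto simp: W_def std_monoms_def memA)
  qed
  define D where "D s = {m \<in> W. size m = s}" for s
  have hf: "hfun S n s = card {m \<in> W. size m \<le> s}" if "s \<le> T" for s
    using card_std_monoms[OF finA R, of \<psi> s] dimA[OF that] W[OF that] by simp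
  have hD: "hfun S n (Suc s) = hfun S n s + card (D (Suc s))" if "Suc s \<le> T" for s
  proof -
    have "{m \<in> W. size m \<le> Suc s} = {m \<in> W. size m \<le> s} \<union> D (Suc s)" by (auto simp: D_def)
    moreover have "card ({m \<in> W. size m \<le> s} \<union> D (Suc s)) = card {m \<in> W. size m \<le> s} + card (D (Suc s))"
      using finW by (intro card_Un_disjoint) (auto simp: D_def)
    ultimately show ?thesis using that by (simp add: hf)
  qed
  have "card (D (Suc t)) \<le> macaulay_upper (card (D t)) t" if "t \<ge> 1"
  proof (rule macaulay_bound[OF that])
    show "shadow (D (Suc t)) \<subseteq> D t"
    proof
      fix u assume "u \<in> shadow (D (Suc t))"
      then obtain m k where m: "m \<in> D (Suc t)" "k \<in># m" "u = m - {#k#}" by (auto simp: shadow_def)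
      then have eq: "m = u + {#k#}" by simp
      have mW: "u + {#k#} \<in> std_monoms \<psi> R (A T)" and sz: "size u = t" using m(1) by (auto simp: D_def W_def eq)
      then have memk: "u + {#k#} \<in> A T" by (simp add: std_monoms_def)
      have "u \<in> std_monoms \<psi> R (A T)"
      proof (rule std_monoms_factor_closed[OF mW, of _ "\<lambda>v. ev v {#k#} / l v"])
        show "u \<in> A T" using memk by (simp add: memA)
        show "\<psi> (m + {#k#}) = \<psi> m * (\<lambda>v. ev v {#k#} / l v)" for m
          by (simp add: fun_eq_iff \<psi>_def mult_ac)
        fix m' assume "m' \<in> A T" "R m' u"
        then show "m' + {#k#} \<in> A T \<and> R (m' + {#k#}) (u + {#k#})"
          using memk sz by (auto simp: memA R_def)
      qed
      then show "u \<in> D t" using sz by (simp add: D_def W_def)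
    qed
  qed (use finW in \<open>auto simp: D_def\<close>)
  moreover have "hfun S n (Suc t) = hfun S n t + card (D (Suc t))" by (rule hD) (simp add: T_def)
  moreover have "hfun S n t - hfun S n (t - 1) = card (D t)" if "t \<ge> 1"
    using hD[of "t - 1"] that by (simp add: T_def)
  ultimately show ?thesis by simp
qed

lemma zero_sequence_hfun: "S \<noteq> {} \<Longrightarrow> zero_sequence (hfun S n)"
  using hfun_growth[of _ S n] by (simp add: zero_sequence_def hfun_0)

lemma differentiable_zero_sequence_hfun:
  fixes S :: "(nat \<Rightarrow> 'k::{field, ring_char_0}) set"
  assumes "S \<noteq> {}" "S \<subseteq> nonzero_vectors n"
  shows "differentiable_zero_sequence (hfun S n)"
proof -
  note D = hfun_difference_growth[OF assms(2)]
  let ?c = "\<lambda>t. if t = 0 then 1 else hfun S n t - hfun S n (t - 1)"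
  have "zero_sequence ?c" using D by (simp add: zero_sequence_def)
  moreover have "int (?c t) = int (hfun S n t) - (if t = 0 then 0 else int (hfun S n (t - 1)))" for t
    using D[of "t - 1"] assms(1) by (cases t) (simp_all add: hfun_0 of_nat_diff)
  ultimately show ?thesis
    unfolding differentiable_zero_sequence_def using zero_sequence_hfun[OF assms(1)] by blast
qed

section \<open>The homogeneous coordinate ring\<close>

definition pm :: "nat multiset \<Rightarrow> monom" where
  "pm M = Abs_poly_mapping (count M)"

lemma lookup_pm [simp]: "Poly_Mapping.lookup (pm M) = count M"
  unfolding pm_def
  by (rule lookup_Abs_poly_mapping) (use finite_set_mset[of M] in \<open>simp add: set_mset_def del: count_greater_zero_iff\<close>)

lemma keys_pm [simp]: "Poly_Mapping.keys (pm M) = set_mset M"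
  by (simp add: keys.rep_eq)

lemma pm_surj: "\<exists>M. m = pm M"
proof -
  have "finite {x. Poly_Mapping.lookup m x > 0}"
    using finite_keys[of m] unfolding keys.rep_eq by simp
  then have "count (Abs_multiset (Poly_Mapping.lookup m)) = Poly_Mapping.lookup m"
    by (rule count_Abs_multiset)
  then have "m = pm (Abs_multiset (Poly_Mapping.lookup m))"
    by (intro poly_mapping_eqI) simp
  then show ?thesis by blast
qed

lemma pm_inj [simp]: "pm M = pm M' \<longleftrightarrow> M = M'"
  by (metis lookup_pm multiset_eqI)

lemma pm_empty [simp]: "pm {#} = 0"
  by (intro poly_mapping_eqI) simp

lemma pm_union: "pm (M + M') = pm M + pm M'"
  by (intro poly_mapping_eqI) (simp add: lookup_add)

lemma mdeg_pm [simp]: "mdeg (pm M) = size M"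
  by (simp add: mdeg_def size_multiset_overloaded_eq)

lemma eval_monom_pm [simp]: "eval_monom v (pm M) = ev v M"
  by (simp add: eval_monom_def ev_def image_prod_mset_multiplicity)

lemma monoms_of_degree_eq: "monoms_of_degree n t = pm ` msets n t"
proof (intro equalityI subsetI)
  fix m assume "m \<in> monoms_of_degree n t"
  then show "m \<in> pm ` msets n t"
    using pm_surj[of m] by (auto simp: monoms_of_degree_def msets_iff)
qed (auto simp: monoms_of_degree_def msets_iff)

section \<open>Evaluation is a ring homomorphism\<close>

lemma eval_mpoly_superset:
  assumes "finite A" "Poly_Mapping.keys p \<subseteq> A"
  shows "eval_mpoly v p = (\<Sum>m\<in>A. Poly_Mapping.lookup p m * eval_monom v m)"
  unfolding eval_mpoly_def using assms
  by (intro sum.mono_neutral_left) (auto simp: in_keys_iff)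

lemma eval_mpoly_zero [simp]: "eval_mpoly v 0 = 0"
  by (simp add: eval_mpoly_def)

lemma eval_mpoly_add [simp]: "eval_mpoly v (p + q) = eval_mpoly v p + eval_mpoly v q"
proof -
  let ?A = "Poly_Mapping.keys p \<union> Poly_Mapping.keys q"
  have "Poly_Mapping.keys (p + q) \<subseteq> ?A" by (rule keys_add)
  then show ?thesis
    by (simp add: eval_mpoly_superset[of ?A] lookup_add distrib_right sum.distrib)
qed

lemma eval_mpoly_sum [simp]: "eval_mpoly v (sum f A) = (\<Sum>a\<in>A. eval_mpoly v (f a))"
  by (induction A rule: infinite_finite_induct) auto

lemma eval_mpoly_single [simp]: "eval_mpoly v (Poly_Mapping.single m c) = c * eval_monom v m"
  by (simp add: eval_mpoly_def)

lemma eval_mpoly_uminus [simp]: "eval_mpoly v (- p) = - eval_mpoly v p"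
  using eval_mpoly_add[of v p "- p"] by (simp add: eq_neg_iff_add_eq_0 add.commute)

lemma eval_mpoly_diff [simp]: "eval_mpoly v (p - q) = eval_mpoly v p - eval_mpoly v q"
  using eval_mpoly_add[of v "p - q" q] by (simp add: algebra_simps)

lemma mpoly_eq_sum: "p = (\<Sum>m\<in>Poly_Mapping.keys p. Poly_Mapping.single m (Poly_Mapping.lookup p m))"
  by (intro poly_mapping_eqI)
    (auto simp: lookup_sum lookup_single when_def in_keys_iff sum.delta' split: if_splits)

lemma eval_monom_add [simp]: "eval_monom v (m + m') = eval_monom v m * eval_monom v m'"
  for v :: "nat \<Rightarrow> 'k::field"
proof -
  obtain M M' where "m = pm M" "m' = pm M'" using pm_surj by metis
  then show ?thesis by (simp add: pm_union[symmetric])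
qed

lemma eval_mpoly_mult [simp]: "eval_mpoly v (p * q) = eval_mpoly v p * eval_mpoly v q"
  for v :: "nat \<Rightarrow> 'k::field"
proof -
  let ?s = "\<lambda>p m. Poly_Mapping.single m (Poly_Mapping.lookup p m)"
  have "p * q = (\<Sum>m\<in>Poly_Mapping.keys p. ?s p m) * (\<Sum>m\<in>Poly_Mapping.keys q. ?s q m)"
    using mpoly_eq_sum[of p] mpoly_eq_sum[of q] by simp
  also have "\<dots> = (\<Sum>m\<in>Poly_Mapping.keys p. \<Sum>m'\<in>Poly_Mapping.keys q.
      Poly_Mapping.single (m + m') (Poly_Mapping.lookup p m * Poly_Mapping.lookup q m'))"
    by (simp add: sum_product mult_single)
  finally have "eval_mpoly v (p * q) = (\<Sum>m\<in>Poly_Mapping.keys p. \<Sum>m'\<in>Poly_Mapping.keys q.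
      (Poly_Mapping.lookup p m * eval_monom v m) * (Poly_Mapping.lookup q m' * eval_monom v m'))"
    by (simp add: mult_ac)
  also have "\<dots> = eval_mpoly v p * eval_mpoly v q"
    by (simp add: eval_mpoly_def sum_product)
  finally show ?thesis .
qed

section \<open>The polynomial ring and its quotient by a vanishing ideal\<close>

lemma mpoly_ring_simps [simp]:
  "mult (mpoly_ring N) = (*)" "one (mpoly_ring N) = 1" "zero (mpoly_ring N) = 0" "add (mpoly_ring N) = (+)"
  by (simp_all add: mpoly_ring_def)

lemma mem_mpoly_ring: "p \<in> carrier (mpoly_ring N) \<longleftrightarrow> (\<forall>m\<in>Poly_Mapping.keys p. Poly_Mapping.keys m \<subseteq> {..N})"
  by (simp add: mpoly_ring_def)

lemma mpoly_ring_add: "p \<in> carrier (mpoly_ring N) \<Longrightarrow> q \<in> carrier (mpoly_ring N) \<Longrightarrow> p + q \<in> carrier (mpoly_ring N)"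
  using keys_add[of p q] by (auto simp: mem_mpoly_ring)

lemma mpoly_ring_mult:
  assumes "p \<in> carrier (mpoly_ring N)" "q \<in> carrier (mpoly_ring N)"
  shows "p * q \<in> carrier (mpoly_ring N)"
  unfolding mem_mpoly_ring
proof
  fix m assume "m \<in> Poly_Mapping.keys (p * q)"
  then obtain a b where "m = a + b" "a \<in> Poly_Mapping.keys p" "b \<in> Poly_Mapping.keys q"
    using keys_mult[of p q] by blast
  then show "Poly_Mapping.keys m \<subseteq> {..N}"
    using assms keys_add[of a b] unfolding mem_mpoly_ring by blast
qed

lemma mpoly_ring_uminus: "p \<in> carrier (mpoly_ring N) \<Longrightarrow> - p \<in> carrier (mpoly_ring N)"
proof -
  have "Poly_Mapping.keys (- p) = Poly_Mapping.keys p" by (auto simp: in_keys_iff)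
  then show "p \<in> carrier (mpoly_ring N) \<Longrightarrow> - p \<in> carrier (mpoly_ring N)" by (simp add: mem_mpoly_ring)
qed

lemma cring_mpoly_ring: "cring (mpoly_ring N :: 'k::comm_ring_1 mpoly ring)"
proof (rule cringI)
  have "\<exists>y\<in>carrier (mpoly_ring N). y + x = 0"
    if "x \<in> carrier (mpoly_ring N)" for x :: "'k mpoly"
    by (rule bexI[of _ "- x"]) (simp_all add: mpoly_ring_uminus that)
  then show "abelian_group (mpoly_ring N :: 'k mpoly ring)"
    by (intro abelian_groupI) (auto simp: mpoly_ring_add add.assoc add.commute, auto simp: mem_mpoly_ring)
  show "Group.comm_monoid (mpoly_ring N :: 'k mpoly ring)"
    by (intro Group.comm_monoidI) (auto simp: mpoly_ring_mult mult.assoc mult.commute, auto simp: mem_mpoly_ring)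
qed (simp add: distrib_right)

lemma a_inv_mpoly_ring:
  assumes "p \<in> carrier (mpoly_ring N)"
  shows "\<ominus>\<^bsub>mpoly_ring N\<^esub> p = - p"
proof -
  interpret cring "mpoly_ring N" by (rule cring_mpoly_ring)
  show ?thesis using minus_equality[of "- p" p] assms by (simp add: mpoly_ring_uminus)
qed

lemma vanishing_ideal_ideal: "ideal (vanishing_ideal N X) (mpoly_ring N)"
proof -
  interpret cring "mpoly_ring N" by (rule cring_mpoly_ring)
  show ?thesis
  proof (rule idealI)
    show "subgroup (vanishing_ideal N X) (add_monoid (mpoly_ring N))"
    proof (rule subgroup.intro)
      fix x y assume "x \<in> vanishing_ideal N X" "y \<in> vanishing_ideal N X"
      then show "x \<otimes>\<^bsub>add_monoid (mpoly_ring N)\<^esub> y \<in> vanishing_ideal N X"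
        by (auto simp: vanishing_ideal_def mpoly_ring_add)
    next
      fix x assume x: "x \<in> vanishing_ideal N X"
      then have "x \<in> carrier (mpoly_ring N)" by (simp add: vanishing_ideal_def)
      then have "inv\<^bsub>add_monoid (mpoly_ring N)\<^esub> x = - x" "- x \<in> carrier (mpoly_ring N)"
        using a_inv_mpoly_ring[of x N] mpoly_ring_uminus[of x N] by (simp_all add: a_inv_def)
      then show "inv\<^bsub>add_monoid (mpoly_ring N)\<^esub> x \<in> vanishing_ideal N X"
        using x by (auto simp: vanishing_ideal_def)
    qed (auto simp: vanishing_ideal_def mem_mpoly_ring)
  qed (auto simp: vanishing_ideal_def mpoly_ring_mult intro: ring_axioms)
qed

lemma coset_eq_iff:
  fixes X :: "(nat \<Rightarrow> 'k::field) set set"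
  assumes "p \<in> carrier (mpoly_ring N)" "q \<in> carrier (mpoly_ring N)"
  shows "vanishing_ideal N X +>\<^bsub>mpoly_ring N\<^esub> p = vanishing_ideal N X +>\<^bsub>mpoly_ring N\<^esub> q \<longleftrightarrow>
    (\<forall>v\<in>\<Union>X. eval_mpoly v p = eval_mpoly v q)"
proof -
  interpret cring "mpoly_ring N" by (rule cring_mpoly_ring)
  interpret ideal "vanishing_ideal N X" "mpoly_ring N" by (rule vanishing_ideal_ideal)
  have "vanishing_ideal N X +>\<^bsub>mpoly_ring N\<^esub> p = vanishing_ideal N X +>\<^bsub>mpoly_ring N\<^esub> q \<longleftrightarrow>
      p \<ominus>\<^bsub>mpoly_ring N\<^esub> q \<in> vanishing_ideal N X"
    using quotient_eq_iff_same_a_r_cos[OF vanishing_ideal_ideal assms] by (rule sym)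
  also have "p \<ominus>\<^bsub>mpoly_ring N\<^esub> q = p + - q"
    using assms by (simp add: a_minus_def a_inv_mpoly_ring)
  finally have 1: "vanishing_ideal N X +>\<^bsub>mpoly_ring N\<^esub> p = vanishing_ideal N X +>\<^bsub>mpoly_ring N\<^esub> q \<longleftrightarrow>
      p + - q \<in> vanishing_ideal N X" .
  have "p + - q \<in> carrier (mpoly_ring N)"
    using assms by (intro mpoly_ring_add mpoly_ring_uminus)
  moreover have "eval_mpoly v (p + - q) = 0 \<longleftrightarrow> eval_mpoly v p = eval_mpoly v q" for v
    by (simp only: eval_mpoly_add eval_mpoly_uminus add_uminus_conv_diff eval_mpoly_diff right_minus_eq)
  ultimately have "p + - q \<in> vanishing_ideal N X \<longleftrightarrow> (\<forall>v\<in>\<Union>X. eval_mpoly v p = eval_mpoly v q)"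
    unfolding vanishing_ideal_def by blast
  with 1 show ?thesis by (simp only:)
qed


lemma homogeneous_part_eq: "homogeneous_part N t = {p. Poly_Mapping.keys p \<subseteq> pm ` msets N t}"
proof -
  have "p \<in> homogeneous_part N t \<longleftrightarrow> Poly_Mapping.keys p \<subseteq> monoms_of_degree N t" for p :: "'k::comm_ring_1 mpoly"
    by (auto simp: homogeneous_part_def mem_mpoly_ring monoms_of_degree_def)
  then show ?thesis unfolding monoms_of_degree_eq by blast
qed

lemma subfield_constants: "subfield (range (Poly_Mapping.single 0)) (mpoly_ring N :: 'k::field mpoly ring)"
proof -
  interpret cring "mpoly_ring N :: 'k mpoly ring" by (rule cring_mpoly_ring)
  let ?K = "range (Poly_Mapping.single 0) :: 'k mpoly set"
  have mem: "Poly_Mapping.single 0 c \<in> carrier (mpoly_ring N)" for c :: 'k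
    by (simp add: mem_mpoly_ring)
  have "subring ?K (mpoly_ring N)"
  proof (rule subringI)
    fix h1 h2 assume "h1 \<in> ?K" "h2 \<in> ?K"
    then show "h1 \<otimes>\<^bsub>mpoly_ring N\<^esub> h2 \<in> ?K" "h1 \<oplus>\<^bsub>mpoly_ring N\<^esub> h2 \<in> ?K"
      by (auto simp: mult_single single_add[symmetric])
  next
    fix h assume "h \<in> ?K"
    then obtain c where "h = Poly_Mapping.single 0 c" by blast
    then have "\<ominus>\<^bsub>mpoly_ring N\<^esub> h = Poly_Mapping.single 0 (- c)"
      using a_inv_mpoly_ring[OF mem[of c]] by (simp add: single_uminus)
    then show "\<ominus>\<^bsub>mpoly_ring N\<^esub> h \<in> ?K" by simp
  next
    show "\<one>\<^bsub>mpoly_ring N\<^esub> \<in> ?K" by (simp add: image_iff) (metis single_one)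
  qed (use mem in auto)
  then have "subcring ?K (mpoly_ring N)"
    by (rule subcringI) (auto simp: mult.commute)
  moreover have "Units (mpoly_ring N \<lparr>carrier := ?K\<rparr>) = ?K - {\<zero>\<^bsub>mpoly_ring N\<^esub>}"
  proof (intro equalityI subsetI)
    fix x assume "x \<in> ?K - {\<zero>\<^bsub>mpoly_ring N\<^esub>}"
    then obtain c where c: "x = Poly_Mapping.single 0 c" "x \<noteq> 0" by auto
    then have "c \<noteq> 0" by auto
    with c show "x \<in> Units (mpoly_ring N \<lparr>carrier := ?K\<rparr>)"
      by (auto simp: Units_def mult_single intro!: exI[of _ "inverse c"])
  next
    fix x assume "x \<in> Units (mpoly_ring N \<lparr>carrier := ?K\<rparr>)"
    then show "x \<in> ?K - {\<zero>\<^bsub>mpoly_ring N\<^esub>}" by (auto simp: Units_def)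
  qed
  ultimately show ?thesis by (rule subfieldI)
qed

section \<open>Dimension of a graded piece as a rank of functions\<close>

lemma mem_span_rest_ev_iff:
  assumes "finite A"
  shows "rest_ev S a \<in> fs.span (rest_ev S ` A) \<longleftrightarrow>
    (\<exists>p. Poly_Mapping.keys p \<subseteq> pm ` A \<and> (\<forall>v\<in>S. ev v a = eval_mpoly v p))"
proof
  assume "rest_ev S a \<in> fs.span (rest_ev S ` A)"
  then obtain c where c: "\<And>v. rest_ev S a v = (\<Sum>b\<in>A. c b * rest_ev S b v)"
    unfolding mem_span_image[OF assms] by blast
  let ?p = "\<Sum>b\<in>A. Poly_Mapping.single (pm b) (c b)"
  have "Poly_Mapping.keys ?p \<subseteq> (\<Union>b\<in>A. Poly_Mapping.keys (Poly_Mapping.single (pm b) (c b)))"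
    by (rule keys_sum)
  also have "\<dots> \<subseteq> pm ` A" by (auto split: if_splits)
  finally have "Poly_Mapping.keys ?p \<subseteq> pm ` A" .
  moreover have "ev v a = eval_mpoly v ?p" if "v \<in> S" for v
    using c[of v] that by (simp add: rest_ev_def)
  ultimately show "\<exists>p. Poly_Mapping.keys p \<subseteq> pm ` A \<and> (\<forall>v\<in>S. ev v a = eval_mpoly v p)" by blast
next
  assume "\<exists>p. Poly_Mapping.keys p \<subseteq> pm ` A \<and> (\<forall>v\<in>S. ev v a = eval_mpoly v p)"
  then obtain p where p: "Poly_Mapping.keys p \<subseteq> pm ` A" "\<And>v. v \<in> S \<Longrightarrow> ev v a = eval_mpoly v p" by blast
  have "eval_mpoly v p = (\<Sum>b\<in>A. Poly_Mapping.lookup p (pm b) * ev v b)" for v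
    using eval_mpoly_superset[OF finite_imageI[OF assms] p(1)]
    by (simp add: sum.reindex inj_on_def)
  then have "rest_ev S a v = (\<Sum>b\<in>A. Poly_Mapping.lookup p (pm b) * rest_ev S b v)" for v
    using p(2)[of v] by (simp add: rest_ev_def)
  then show "rest_ev S a \<in> fs.span (rest_ev S ` A)"
    unfolding mem_span_image[OF assms] by (intro exI[of _ "\<lambda>b. Poly_Mapping.lookup p (pm b)"]) blast
qed

lemma keys_insert_decomp:
  fixes q :: "'a \<Rightarrow>\<^sub>0 'b::ab_group_add"
  assumes "Poly_Mapping.keys q \<subseteq> insert m A" "m \<notin> A"
  shows "\<exists>c p. q = Poly_Mapping.single m c + p \<and> Poly_Mapping.keys p \<subseteq> A"
proof -
  let ?p = "q - Poly_Mapping.single m (Poly_Mapping.lookup q m)"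
  have "Poly_Mapping.keys ?p \<subseteq> A"
    using assms by (auto simp: in_keys_iff lookup_minus lookup_single when_def split: if_splits)
  then show ?thesis by (intro exI[of _ "Poly_Mapping.lookup q m"] exI[of _ ?p]) simp
qed

text \<open>The relation \<open>ring.dimension\<close> is built from line extensions, so monomials
  are added one at a time: a new one enlarges the image exactly when its restriction lies outside
  the span of the others, the same alternative as in \<open>dim_insert_finite\<close>.\<close>

theorem hilbert_function_eq_hfun:
  fixes X :: "(nat \<Rightarrow> 'k::field) set set"
  assumes "\<Union>X \<noteq> {}"
  shows "hilbert_function N X t = hfun (\<Union>X) N t"
proof -
  define R where "R = (mpoly_ring N :: 'k mpoly ring)"
  define I where "I = vanishing_ideal N X"
  define Q where "Q = R Quot I"
  define h where "h = (\<lambda>p. I +>\<^bsub>R\<^esub> p)"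
  interpret cring R unfolding R_def by (rule cring_mpoly_ring)
  interpret I: ideal I R unfolding R_def I_def by (rule vanishing_ideal_ideal)
  interpret h: ring_hom_ring R Q h unfolding Q_def h_def by (rule I.rcos_ring_hom_ring)
  have R_ops: "mult R = (*)" "add R = (+)" "one R = 1" "zero R = 0" by (simp_all add: R_def)
  have h_eq: "h p = h q \<longleftrightarrow> (\<forall>v\<in>\<Union>X. eval_mpoly v p = eval_mpoly v q)"
    if "p \<in> carrier R" "q \<in> carrier R" for p q
    unfolding h_def R_def I_def using that by (intro coset_eq_iff) (simp_all add: R_def)
  define K where "K = h ` range (Poly_Mapping.single 0)"
  have K: "subfield K Q"
    unfolding K_def
  proof (rule h.img_is_subfield)
    show "subfield (range (Poly_Mapping.single 0)) R" unfolding R_def by (rule subfield_constants)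
    \<comment> \<open>A vector of the cone separates 1 from 0 in the quotient; without one the
      scalars would not form a field.\<close>
    obtain v where v: "v \<in> \<Union>X" using assms by blast
    have "eval_mpoly v (1 :: 'k mpoly) = 1" by (metis eval_mpoly_single eval_monom_pm ev_empty mult_1 pm_empty single_one)
    then have "h \<one>\<^bsub>R\<^esub> \<noteq> h \<zero>\<^bsub>R\<^esub>" using h_eq[OF one_closed zero_closed] v by (auto simp: R_ops)
    then show "\<one>\<^bsub>Q\<^esub> \<noteq> \<zero>\<^bsub>Q\<^esub>" by simp
  qed
  define E where "E A = h ` {p. Poly_Mapping.keys p \<subseteq> pm ` A}" for A
  have dim: "ring.dimension Q (fs.dim (rest_ev (\<Union>X) ` A)) K (E A)" if "A \<subseteq> msets N t" for A
  proof -
    have "finite A" using that finite_msets by (rule finite_subset)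
    then show ?thesis using that
    proof (induction A rule: finite_induct)
      case empty
      have e: "{p :: 'k mpoly. Poly_Mapping.keys p \<subseteq> pm ` {}} = {\<zero>\<^bsub>R\<^esub>}" by (auto simp: R_ops)
      have "E {} = {\<zero>\<^bsub>Q\<^esub>}" unfolding E_def e by simp
      moreover have "fs.dim (rest_ev (\<Union>X) ` {}) = 0"
        using fs.dim_eq_card_independent[OF fs.independent_empty] by simp
      ultimately show ?case by simp
    next
      case (insert a A)
      have carr: "p \<in> carrier R" if "Poly_Mapping.keys p \<subseteq> pm ` insert a A" for p
        using that insert.prems by (fastforce simp: R_def mem_mpoly_ring msets_iff)
      have const: "Poly_Mapping.single 0 c \<in> carrier R" for c by (simp add: R_def mem_mpoly_ring)
      have hcomb: "h (Poly_Mapping.single 0 c * x + p) = h (Poly_Mapping.single 0 c) \<otimes>\<^bsub>Q\<^esub> h x \<oplus>\<^bsub>Q\<^esub> h p"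
        if "x \<in> carrier R" "p \<in> carrier R" for c x p
        using h.hom_mult[OF const that(1)] h.hom_add[OF m_closed[OF const that(1)] that(2)]
        by (simp add: R_ops)
      let ?x = "Poly_Mapping.single (pm a) (1 :: 'k)"
      have xc: "?x \<in> carrier R" by (rule carr) simp
      have mem: "h ?x \<in> E A \<longleftrightarrow> rest_ev (\<Union>X) a \<in> fs.span (rest_ev (\<Union>X) ` A)"
      proof -
        have "h ?x \<in> E A \<longleftrightarrow> (\<exists>p. Poly_Mapping.keys p \<subseteq> pm ` A \<and> h ?x = h p)" by (auto simp: E_def)
        also have "\<dots> \<longleftrightarrow> (\<exists>p. Poly_Mapping.keys p \<subseteq> pm ` A \<and> (\<forall>v\<in>\<Union>X. ev v a = eval_mpoly v p))"
          using h_eq[OF xc carr] by (intro ex_cong1 conj_cong refl) (auto simp: subset_insertI2)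
        finally show ?thesis unfolding mem_span_rest_ev_iff[OF insert.hyps(1)] .
      qed
      have line: "ring.line_extension Q K (h ?x) (E A) = E (insert a A)"
      proof (intro equalityI subsetI)
        fix u assume "u \<in> ring.line_extension Q K (h ?x) (E A)"
        then obtain c p where p: "Poly_Mapping.keys p \<subseteq> pm ` A"
          "u = h (Poly_Mapping.single 0 c) \<otimes>\<^bsub>Q\<^esub> h ?x \<oplus>\<^bsub>Q\<^esub> h p"
          by (auto simp: h.S.line_extension_mem_iff K_def E_def)
        have pc: "p \<in> carrier R" using p(1) by (intro carr) auto
        have "u = h (Poly_Mapping.single 0 c * ?x + p)"
          using p(2) hcomb[OF xc pc] by simp
        also have "Poly_Mapping.single 0 c * ?x + p = Poly_Mapping.single (pm a) c + p"
          by (simp add: mult_single)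
        finally show "u \<in> E (insert a A)"
          using p(1) keys_add[of "Poly_Mapping.single (pm a) c" p] by (auto simp: E_def split: if_splits)
      next
        fix u assume "u \<in> E (insert a A)"
        then obtain q where q: "Poly_Mapping.keys q \<subseteq> insert (pm a) (pm ` A)" "u = h q" by (auto simp: E_def)
        have "pm a \<notin> pm ` A" using insert.hyps by auto
        then obtain c p where p: "q = Poly_Mapping.single (pm a) c + p" "Poly_Mapping.keys p \<subseteq> pm ` A"
          using keys_insert_decomp[OF q(1)] by blast
        have pc: "p \<in> carrier R" using p(2) by (intro carr) auto
        have q': "q = Poly_Mapping.single 0 c * ?x + p" by (simp add: p(1) mult_single)
        have "u = h (Poly_Mapping.single 0 c) \<otimes>\<^bsub>Q\<^esub> h ?x \<oplus>\<^bsub>Q\<^esub> h p"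
          using hcomb[OF xc pc] unfolding q(2) q' by simp
        then show "u \<in> ring.line_extension Q K (h ?x) (E A)"
          using p(2) by (auto simp: h.S.line_extension_mem_iff K_def E_def)
      qed
      have IH: "ring.dimension Q (fs.dim (rest_ev (\<Union>X) ` A)) K (E A)" using insert by simp
      show ?case
      \<comment> \<open>A class already in \<open>E A\<close> makes the line extension collapse;
        otherwise the extension is one step of the dimension relation.\<close>
      proof (cases "h ?x \<in> E A")
        case True
        then obtain p0 where p0: "Poly_Mapping.keys p0 \<subseteq> pm ` A" "h ?x = h p0" by (auto simp: E_def)
        have pc0: "p0 \<in> carrier R" using p0(1) by (intro carr) auto
        have "E (insert a A) \<subseteq> E A"
          unfolding line[symmetric]
        proof
          fix u assume "u \<in> ring.line_extension Q K (h ?x) (E A)"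
          then obtain c p where p: "Poly_Mapping.keys p \<subseteq> pm ` A"
            "u = h (Poly_Mapping.single 0 c) \<otimes>\<^bsub>Q\<^esub> h p0 \<oplus>\<^bsub>Q\<^esub> h p"
            by (auto simp: h.S.line_extension_mem_iff K_def E_def p0(2))
          have pc: "p \<in> carrier R" using p(1) by (intro carr) auto
          have "u = h (Poly_Mapping.single 0 c * p0 + p)"
            using p(2) hcomb[OF pc0 pc] by simp
          moreover have "Poly_Mapping.keys (Poly_Mapping.single 0 c * p0 + p) \<subseteq> pm ` A"
            using keys_add[of "Poly_Mapping.single 0 c * p0" p] keys_mult[of "Poly_Mapping.single 0 c" p0] p(1) p0(1)
            by (fastforce split: if_splits)
          ultimately show "u \<in> E A" by (auto simp: E_def)
        qed
        moreover have "E A \<subseteq> E (insert a A)" by (auto simp: E_def)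
        ultimately have "E (insert a A) = E A" by blast
        moreover have "fs.dim (rest_ev (\<Union>X) ` insert a A) = fs.dim (rest_ev (\<Union>X) ` A)"
          using True mem insert.hyps(1) by (simp add: dim_insert_finite)
        ultimately show ?thesis using IH by simp
      next
        case False
        then have "fs.dim (rest_ev (\<Union>X) ` insert a A) = Suc (fs.dim (rest_ev (\<Union>X) ` A))"
          using mem insert.hyps(1) by (simp add: dim_insert_finite)
        then show ?thesis
          using h.S.dimension.Suc_dim[OF h.hom_closed[OF xc] False IH] by (simp add: line)
      qed
    qed
  qed
  have "E (msets N t) = coordinate_ring_part N X t"
    by (simp add: E_def coordinate_ring_part_def homogeneous_part_eq h_def R_def I_def)
  moreover have "K = coordinate_ring_scalars N X"
    by (auto simp: K_def coordinate_ring_scalars_def h_def R_def I_def)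
  moreover have "Q = coordinate_ring N X" by (simp add: Q_def coordinate_ring_def R_def I_def)
  ultimately show ?thesis
    using h.S.dimI[OF K dim[OF order_refl]] by (simp add: hilbert_function_def hfun_def over_def)
qed

text \<open>With no points the ideal is the whole ring and the quotient is the zero ring, where the
  scalars are not a field and no vector lies outside a subspace. The value 0 lets the condition
  \<open>h 0 = 1\<close> exclude this case.\<close>

lemma hilbert_function_empty: "hilbert_function N ({} :: (nat \<Rightarrow> 'k::field) set set) t = 0"
proof -
  define R where "R = (mpoly_ring N :: 'k mpoly ring)"
  define I where "I = vanishing_ideal N ({} :: (nat \<Rightarrow> 'k) set set)"
  define Q where "Q = R Quot I"
  interpret cring R unfolding R_def by (rule cring_mpoly_ring)
  interpret I: ideal I R unfolding R_def I_def by (rule vanishing_ideal_ideal)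
  interpret h: ring_hom_ring R Q "\<lambda>p. I +>\<^bsub>R\<^esub> p" unfolding Q_def by (rule I.rcos_ring_hom_ring)
  have eq: "I +>\<^bsub>R\<^esub> p = \<zero>\<^bsub>Q\<^esub>" if "p \<in> carrier R" for p
  proof -
    have "I +>\<^bsub>R\<^esub> p = I +>\<^bsub>R\<^esub> \<zero>\<^bsub>R\<^esub>"
      using coset_eq_iff[OF that[unfolded R_def] zero_closed[unfolded R_def], of "{}"]
      unfolding R_def I_def by blast
    also have "\<dots> = \<zero>\<^bsub>Q\<^esub>" by (rule h.hom_zero)
    finally show ?thesis .
  qed
  have "carrier Q = {\<zero>\<^bsub>Q\<^esub>}"
    using eq unfolding Q_def FactRing_def A_RCOSETS_def' by auto
  note carrier_Q = this
  have dim0: "n = 0" if "ring.dimension Q n K E" for n K E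
    using that
  proof (induction rule: h.S.dimension.induct)
    case (Suc_dim v E n K)
    then have "ring.dimension Q 0 K E" by simp
    then have "E = {\<zero>\<^bsub>Q\<^esub>}" by (cases rule: h.S.dimension.cases) simp_all
    then show ?case using Suc_dim.hyps(1,2) carrier_Q by simp
  qed simp
  have "coordinate_ring_part N ({} :: (nat \<Rightarrow> 'k) set set) t = {\<zero>\<^bsub>Q\<^esub>}"
  proof -
    have "homogeneous_part N t \<subseteq> carrier R" by (auto simp: homogeneous_part_def R_def)
    moreover have "0 \<in> homogeneous_part N t" by (simp add: homogeneous_part_eq)
    ultimately show ?thesis
      unfolding coordinate_ring_part_def R_def[symmetric] I_def[symmetric] using eq by auto
  qed
  moreover have "coordinate_ring N ({} :: (nat \<Rightarrow> 'k) set set) = Q"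
    by (simp add: Q_def coordinate_ring_def R_def I_def)
  moreover have "ring.dim Q K {\<zero>\<^bsub>Q\<^esub>} = 0" for K
    unfolding h.S.dim_def by (rule the_equality) (auto dest: dim0)
  ultimately show ?thesis by (simp add: hilbert_function_def)
qed

section \<open>Order ideals with a prescribed counting function\<close>

text \<open>A single binomial coefficient is its own expansion, with \<open>j = t\<close>. These
  values are the dimensions for a polynomial ring in \<open>x\<close> variables, the case of maximal
  growth.\<close>

lemma macaulay_upper_choose:
  assumes "t \<ge> 1" "x \<ge> 1"
  shows "macaulay_upper ((x + t - 1) choose t) t = (x + t) choose Suc t"
proof -
  have "macaulay_expansion ((x + t - 1) choose t) t t (\<lambda>_. x + t - 1)"
    using assms by (simp add: macaulay_expansion_def)
  then obtain M where "size M = t" "card (below t M) = (x + t - 1) choose t"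
    "card (below (Suc t) (add_mset 0 M)) = (x + t - 1 + 1) choose Suc t"
    using macaulay_expansion_below by fastforce
  then show ?thesis using macaulay_upper_below[OF assms(1)] assms by (metis (no_types, lifting) Suc_eq_plus1 add_diff_cancel_right' Suc_diff_1 add.commute add_gr_0 less_le_trans zero_less_one)
qed

lemma mem_singleton_of_closed:
  assumes closed: "\<And>m k. m \<in> D \<Longrightarrow> k \<in># m \<Longrightarrow> m - {#k#} \<in> D"
    and "m \<in> D" "x \<in># m"
  shows "{#x#} \<in> D"
  using assms(2,3)
proof (induction "size m" arbitrary: m)
  case (Suc s)
  obtain r where r: "m = add_mset x r" using Suc.prems(2) by (metis insert_DiffM)
  show ?case
  proof (cases "r = {#}")
    case True
    then show ?thesis using Suc.prems r by simp
  next
    case False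
    then obtain k where k: "k \<in># r" by blast
    then have "k \<in># m" "x \<in># m - {#k#}" using r by (auto simp: in_diff_count)
    then show ?thesis using Suc.hyps(1)[of "m - {#k#}"] closed[OF Suc.prems(1)] Suc.hyps(2)
      by (metis diff_Suc_1 size_Diff_singleton)
  qed
qed simp

text \<open>The witness consists of the \<open>b t\<close> smallest monomials of each degree \<open>t\<close>.\<close>

lemma ex_order_ideal:
  assumes b: "zero_sequence b" "b 1 = n"
  shows "\<exists>D. {#} \<in> D \<and> (\<forall>m\<in>D. set_mset m \<subseteq> {..<n}) \<and>
    (\<forall>m\<in>D. \<forall>k\<in>#m. m - {#k#} \<in> D) \<and> (\<forall>t. card {m \<in> D. size m = t} = b t)"
proof -
  have "\<exists>w. size w = t \<and> card (below t w) = b t" if "t \<ge> 1" for t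
    by (rule ex_card_below[OF that])
  then obtain w where w: "\<And>t. t \<ge> 1 \<Longrightarrow> size (w t) = t" "\<And>t. t \<ge> 1 \<Longrightarrow> card (below t (w t)) = b t"
    by metis
  define D where "D = {m. m = {#} \<or> m < w (size m)}"
  have closed: "m - {#k#} \<in> D" if "m \<in> D" "k \<in># m" for m k
  proof (cases "m - {#k#} = {#}")
    case True
    then show ?thesis by (simp add: D_def)
  next
    case False
    define t where "t = size (m - {#k#})"
    have t: "t \<ge> 1" using False by (simp add: t_def Suc_le_eq nonempty_has_size)
    have m: "m = add_mset k (m - {#k#})" using that(2) by simp
    then have sm: "size m = Suc t" unfolding t_def by (metis size_add_mset)
    have "b (Suc t) \<le> macaulay_upper (b t) t" using b(1) t by (simp add: zero_sequence_def)
    \<comment> \<open>Read through \<open>macaulay_upper_below\<close>, the growth condition says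
      that the segment in degree \<open>Suc t\<close> ends no later than
      \<open>add_mset 0 (w t)\<close>; closure under division follows.\<close>
    then have "card (below (Suc t) (w (Suc t))) \<le> card (below (Suc t) (add_mset 0 (w t)))"
      using w[of t] w[of "Suc t"] t macaulay_upper_below[OF t, of "w t"] by simp
    then have "\<not> add_mset 0 (w t) < w (Suc t)"
      using card_below_less[of "add_mset 0 (w t)" "Suc t" "w (Suc t)"] w(1)[OF t] by fastforce
    moreover have "m < w (Suc t)" using that sm by (auto simp: D_def)
    ultimately have lt: "m < add_mset 0 (w t)" by simp
    have "\<not> w t \<le> m - {#k#}"
    proof
      assume "w t \<le> m - {#k#}"
      then have "add_mset 0 (w t) \<le> add_mset k (m - {#k#})" by (intro add_mset_le_le_le) auto
      then show False using lt m by simp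
    qed
    then have "m - {#k#} < w (size (m - {#k#}))" by (simp only: t_def linorder_not_le)
    then show ?thesis unfolding D_def by blast
  qed
  have deg: "{m \<in> D. size m = t} = below t (w t)" if "t \<ge> 1" for t
    using that by (auto simp: D_def below_def)
  \<comment> \<open>In degree 1 the segment consists of the first \<open>b 1 = n\<close>
    variables.\<close>
  have "x < n" if x: "{#x#} \<in> D" for x
  proof -
    obtain y where y: "w 1 = {#y#}" using w(1)[of 1] by (metis One_nat_def order_refl size_1_singleton_mset)
    have "below 1 {#y#} = (\<lambda>x. {#x#}) ` {..<y}"
    proof (intro equalityI subsetI)
      fix v assume v: "v \<in> below 1 {#y#}"
      then obtain x where "v = {#x#}" using size_1_singleton_mset[of v] by (auto simp: below_def)
      then show "v \<in> (\<lambda>x. {#x#}) ` {..<y}" using v by (auto simp: below_def)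
    qed (auto simp: below_def)
    then have "card (below 1 {#y#}) = y" by (simp add: card_image inj_on_def)
    then have "y = n" using w(2)[of 1] y b(2) by simp
    then show "x < n" using x y by (simp add: D_def)
  qed
  then have "set_mset m \<subseteq> {..<n}" if "m \<in> D" for m
    using mem_singleton_of_closed[OF closed that] by auto
  moreover have "card {m \<in> D. size m = t} = b t" for t
  proof (cases "t \<ge> 1")
    case False
    then have "t = 0" by simp
    then have "{m \<in> D. size m = t} = {{#}}" by (auto simp: D_def)
    then show ?thesis using b(1) \<open>t = 0\<close> by (simp add: zero_sequence_def)
  qed (use deg w in simp)
  moreover have "{#} \<in> D" by (simp add: D_def)
  ultimately show ?thesis using closed by (intro exI[of _ D] conjI ballI allI) simp_all
qed

text \<open>\<open>c s\<close> may exceed \<open>(n + s) choose s\<close> for \<open>s < d\<close>; there it is replaced by that value.\<close>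

lemma truncated_difference_sequence:
  assumes c: "differentiable_zero_sequence c" and n: "n \<ge> 1" and d: "d \<ge> 1"
    and cd: "c d = (n + d) choose d"
  shows "\<exists>b. zero_sequence b \<and> b 1 = n \<and> (\<forall>t\<ge>d. (\<Sum>s\<le>t. b s) = c t)"
proof -
  obtain \<delta> where \<delta>: "zero_sequence \<delta>"
    "\<And>t. int (\<delta> t) = int (c t) - (if t = 0 then 0 else int (c (t - 1)))"
    using c by (auto simp: differentiable_zero_sequence_def)
  have \<delta>_Suc: "c (Suc t) = c t + \<delta> (Suc t)" for t using \<delta>(2)[of "Suc t"] by simp
  have zc: "c (Suc t) \<le> macaulay_upper (c t) t" if "t \<ge> 1" for t
    using c that by (simp add: differentiable_zero_sequence_def zero_sequence_def)
  \<comment> \<open>Up to degree \<open>d\<close> these are the dimensions for n variables, whose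
    partial sums are \<open>(n + s) choose s\<close> and thus meet \<open>c\<close> at
    \<open>d\<close>.\<close>
  define b where "b s = (if s \<le> d then (n + s - 1) choose s else \<delta> s)" for s
  have "b (Suc s) \<le> macaulay_upper (b s) s" if s: "s \<ge> 1" for s
  proof -
    consider "s < d" | "s = d" | "s > d" by linarith
    then show ?thesis
    proof cases
      case 1
      then show ?thesis using macaulay_upper_choose[OF s n] by (simp add: b_def)
    next
      case 2
      \<comment> \<open>At the junction the growth bound for \<open>c\<close> itself is used:
        subtracting \<open>c d\<close> from \<open>(n + 1 + d) choose Suc d\<close> leaves, by
        Pascal's rule, exactly the bound required of the difference.\<close>
      have "macaulay_upper (c d) d = (n + 1 + d) choose Suc d"
        using macaulay_upper_choose[OF d, of "n + 1"] cd by simp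
      then have "c d + \<delta> (Suc d) \<le> (n + 1 + d) choose Suc d" using zc[OF d] \<delta>_Suc[of d] by simp
      then have "\<delta> (Suc d) \<le> (n + d) choose Suc d" by (simp add: cd)
      then show ?thesis using macaulay_upper_choose[OF d n] by (simp add: b_def 2)
    next
      case 3
      then show ?thesis using \<delta>(1) s by (simp add: b_def zero_sequence_def)
    qed
  qed
  then have "zero_sequence b" by (simp add: zero_sequence_def b_def)
  moreover have "b 1 = n" using d by (simp add: b_def)
  moreover have "(\<Sum>s\<le>t. b s) = c t" if "t \<ge> d" for t
    using that
  proof (induction rule: dec_induct)
    case base
    obtain n' where n': "n = Suc n'" using n by (cases n) auto
    have "(\<Sum>s\<le>d. b s) = (\<Sum>s\<le>d. (n' + s) choose s)" by (intro sum.cong) (auto simp: b_def n')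
    also have "\<dots> = Suc (n' + d) choose d" by (rule sum_choose_lower)
    finally show ?case by (simp add: cd n')
  next
    case (step t)
    then show ?case by (simp add: \<delta>_Suc b_def)
  qed
  ultimately show ?thesis by blast
qed

section \<open>Veronese embeddings\<close>

locale veronese =
  fixes n d N :: nat and e :: "nat \<Rightarrow> monom"
  assumes d_pos: "d \<ge> 1" and e_bij: "bij_betw e {..N} (monoms_of_degree n d)"
begin

definition mon :: "nat \<Rightarrow> nat multiset" where
  "mon i = inv_into UNIV pm (e i)"

definition idx :: "nat multiset \<Rightarrow> nat" where
  "idx M = inv_into {..N} mon M"

text \<open>Pullback of a monomial along the Veronese map: each coordinate is replaced by the
  monomial of degree \<open>d\<close> that it stands for.\<close>

definition expand :: "nat multiset \<Rightarrow> nat multiset" where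
  "expand M = \<Sum>\<^sub># (image_mset mon M)"

lemma pm_mon: "pm (mon i) = e i"
  unfolding mon_def using pm_surj by (intro f_inv_into_f) blast

lemma mon_bij: "bij_betw mon {..N} (msets n d)"
proof -
  have "bij_betw (pm \<circ> mon) {..N} (pm ` msets n d)"
    using e_bij by (simp add: comp_def pm_mon monoms_of_degree_eq)
  moreover have "bij_betw pm (msets n d) (pm ` msets n d)" by (simp add: bij_betw_def inj_on_def)
  moreover have "mon ` {..N} \<subseteq> msets n d"
  proof
    fix M assume "M \<in> mon ` {..N}"
    then have "pm M \<in> pm ` msets n d"
      using e_bij by (auto simp: pm_mon monoms_of_degree_eq bij_betw_def)
    then show "M \<in> msets n d" by auto
  qed
  ultimately show ?thesis using bij_betw_comp_iff2 by blast
qed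

lemma mon_mem: "i \<le> N \<Longrightarrow> mon i \<in> msets n d"
  using mon_bij by (auto simp: bij_betw_def)

lemma mon_idx: "M \<in> msets n d \<Longrightarrow> mon (idx M) = M"
  using mon_bij by (simp add: idx_def bij_betw_def f_inv_into_f)

lemma idx_le: "M \<in> msets n d \<Longrightarrow> idx M \<le> N"
  using mon_bij inv_into_into[of M mon "{..N}"] by (simp add: idx_def bij_betw_def)

lemma expand_simps [simp]:
  "expand {#} = {#}" "expand (add_mset i M) = mon i + expand M" "expand (M + M') = expand M + expand M'"
  by (simp_all add: expand_def)

lemma expand_mem: "M \<in> msets N t \<Longrightarrow> expand M \<in> msets n (d * t)"
proof (induction M arbitrary: t)
  case (add i M)
  then have "mon i \<in> msets n d" "expand M \<in> msets n (d * size M)" "t = Suc (size M)"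
    by (auto simp: msets_iff mon_mem[unfolded msets_iff])
  then show ?case by (auto simp: msets_iff)
qed (simp add: msets_iff)

text \<open>Any way of cutting a monomial of degree \<open>d * t\<close> into blocks of degree
  \<open>d\<close> gives a preimage.\<close>

lemma expand_surj: "K \<in> msets n (d * t) \<Longrightarrow> \<exists>M\<in>msets N t. expand M = K"
proof (induction t arbitrary: K)
  case 0
  then show ?case by (intro bexI[of _ "{#}"]) (auto simp: msets_iff)
next
  case (Suc t)
  obtain xs where xs: "mset xs = K" using ex_mset by blast
  have "length xs = d + d * t" using Suc.prems xs by (metis msets_iff mult_Suc_right size_mset)
  then have "size (mset (take d xs)) = d" "size (mset (drop d xs)) = d * t" by simp_all
  moreover have K: "K = mset (take d xs) + mset (drop d xs)"
    by (metis append_take_drop_id mset_append xs)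
  moreover have "set_mset (mset (take d xs)) \<subseteq> {..n}" "set_mset (mset (drop d xs)) \<subseteq> {..n}"
    using Suc.prems K by (auto simp: msets_iff simp del: set_mset_mset)
  ultimately have t: "mset (take d xs) \<in> msets n d" "mset (drop d xs) \<in> msets n (d * t)"
    by (auto simp: msets_iff simp del: set_mset_mset)
  obtain M where M: "M \<in> msets N t" "expand M = mset (drop d xs)" using Suc.IH[OF t(2)] by blast
  then show ?case using K mon_idx[OF t(1)] idx_le[OF t(1)]
    by (intro bexI[of _ "add_mset (idx (mset (take d xs))) M"]) (auto simp: msets_iff)
qed

lemma image_expand: "expand ` msets N t = msets n (d * t)"
proof (intro equalityI subsetI)
  fix K assume "K \<in> msets n (d * t)"
  then obtain M where "M \<in> msets N t" "expand M = K" using expand_surj by blast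
  then show "K \<in> expand ` msets N t" by blast
qed (use expand_mem in blast)

abbreviation nu :: "(nat \<Rightarrow> 'k::field) \<Rightarrow> nat \<Rightarrow> 'k" where
  "nu v \<equiv> veronese_vector N e v"

lemma nu_eq: "nu v i = (if i \<le> N then ev v (mon i) else 0)"
  by (simp add: veronese_vector_def pm_mon[symmetric])

lemma ev_nu: "set_mset M \<subseteq> {..N} \<Longrightarrow> ev (nu v) M = ev v (expand M)"
  by (induction M) (auto simp: nu_eq)

definition cone :: "(nat \<Rightarrow> 'k::field) set \<Rightarrow> (nat \<Rightarrow> 'k) set" where
  "cone S = {\<lambda>i. c * nu v i | c v. c \<noteq> 0 \<and> v \<in> S}"

text \<open>Rescaling a point multiplies a form of degree t by a t-th power, so relations on the
  cone are those on the image of \<open>S\<close>. By \<open>ev_nu\<close> they are relations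
  between the pulled-back monomials, which by \<open>image_expand\<close> are all those of degree
  \<open>d * t\<close>.\<close>

lemma hfun_cone: "hfun (cone S) N t = hfun S n (d * t)"
proof -
  have "fs.dim (rest_ev (cone S) ` msets N t) = fs.dim ((\<lambda>M. rest_ev S (expand M)) ` msets N t)"
  proof (rule dim_image_cong[OF finite_msets])
    fix c :: "nat multiset \<Rightarrow> 'a"
    have scale: "(\<Sum>M\<in>msets N t. c M * ev (\<lambda>i. b * nu v i) M) = b ^ t * (\<Sum>M\<in>msets N t. c M * ev v (expand M))" for b v
      by (auto simp: ev_scale ev_nu msets_iff sum_distrib_left mult_ac intro!: sum.cong)
    have "(\<forall>w. (\<Sum>M\<in>msets N t. c M * rest_ev (cone S) M w) = 0) \<longleftrightarrow>
        (\<forall>w\<in>cone S. (\<Sum>M\<in>msets N t. c M * ev w M) = 0)"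
    proof -
      have "(\<Sum>M\<in>msets N t. c M * rest_ev (cone S) M w) =
          (if w \<in> cone S then (\<Sum>M\<in>msets N t. c M * ev w M) else 0)" for w
        by (simp add: rest_ev_def)
      then show ?thesis by auto
    qed
    also have "\<dots> \<longleftrightarrow> (\<forall>v\<in>S. (\<Sum>M\<in>msets N t. c M * ev v (expand M)) = 0)"
    proof
      assume *: "\<forall>w\<in>cone S. (\<Sum>M\<in>msets N t. c M * ev w M) = 0"
      show "\<forall>v\<in>S. (\<Sum>M\<in>msets N t. c M * ev v (expand M)) = 0"
      proof
        fix v assume "v \<in> S"
        then have "\<exists>b u. (\<lambda>i. 1 * nu v i) = (\<lambda>i. b * nu u i) \<and> b \<noteq> 0 \<and> u \<in> S"
          by (intro exI[of _ 1] exI[of _ v]) simp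
        then have "(\<lambda>i. 1 * nu v i) \<in> cone S" unfolding cone_def by blast
        then have "(\<Sum>M\<in>msets N t. c M * ev (\<lambda>i. 1 * nu v i) M) = 0" using * by blast
        then show "(\<Sum>M\<in>msets N t. c M * ev v (expand M)) = 0" unfolding scale by simp
      qed
    next
      assume "\<forall>v\<in>S. (\<Sum>M\<in>msets N t. c M * ev v (expand M)) = 0"
      then show "\<forall>w\<in>cone S. (\<Sum>M\<in>msets N t. c M * ev w M) = 0"
        by (auto simp: cone_def scale)
    qed
    also have "\<dots> \<longleftrightarrow> (\<forall>v. (\<Sum>M\<in>msets N t. c M * rest_ev S (expand M) v) = 0)"
    proof -
      have "(\<Sum>M\<in>msets N t. c M * rest_ev S (expand M) v) =
          (if v \<in> S then (\<Sum>M\<in>msets N t. c M * ev v (expand M)) else 0)" for v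
        by (simp add: rest_ev_def)
      then show ?thesis by auto
    qed
    finally show "(\<forall>w. (\<Sum>M\<in>msets N t. c M * rest_ev (cone S) M w) = 0) \<longleftrightarrow>
        (\<forall>v. (\<Sum>M\<in>msets N t. c M * rest_ev S (expand M) v) = 0)" .
  qed
  also have "(\<lambda>M. rest_ev S (expand M)) ` msets N t = rest_ev S ` msets n (d * t)"
    by (simp add: image_expand[symmetric] image_image)
  finally show ?thesis by (simp add: hfun_def)
qed

lemma nu_nonzero:
  assumes "v \<in> nonzero_vectors n"
  shows "nu v \<in> nonzero_vectors N"
proof -
  obtain i where i: "i \<le> n" "v i \<noteq> 0" using assms by (auto simp: nonzero_vectors_def)
  have m: "replicate_mset d i \<in> msets n d" using i(1) by (auto simp: msets_iff split: if_splits)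
  have "nu v (idx (replicate_mset d i)) = v i ^ d"
    using idx_le[OF m] by (simp add: nu_eq mon_idx[OF m]) (simp add: ev_def)
  then show ?thesis
    using i(2) idx_le[OF m] by (auto simp: nonzero_vectors_def nu_eq intro!: exI[of _ "idx (replicate_mset d i)"])
qed

lemma differentiable_e_sequence_hilbert_function:
  fixes X :: "(nat \<Rightarrow> 'k::{field, ring_char_0}) set set"
  assumes X: "X \<subseteq> veronese_variety n N e" and h0: "hilbert_function N X 0 = 1"
  shows "differentiable_e_sequence (d - 1) (hilbert_function N X)"
proof -
  define S where "S = {v \<in> nonzero_vectors n. nu v \<in> \<Union>X}"
  have self: "w \<in> proj_point w" for w :: "nat \<Rightarrow> 'k"
    unfolding proj_point_def using zero_neq_one by force
  have cone: "\<Union>X = cone S"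
  proof (intro equalityI subsetI)
    fix w assume "w \<in> \<Union>X"
    then obtain P where P: "P \<in> X" "w \<in> P" by blast
    then obtain v where v: "v \<in> nonzero_vectors n" "P = proj_point (nu v)"
      using X by (auto simp: veronese_variety_def)
    then have "v \<in> S" using P(1) self by (auto simp: S_def)
    then show "w \<in> cone S" using P(2) v(2) by (auto simp: cone_def proj_point_def)
  next
    fix w assume "w \<in> cone S"
    then obtain c v where w: "c \<noteq> 0" "v \<in> S" "w = (\<lambda>i. c * nu v i)" by (auto simp: cone_def)
    then obtain P where P: "P \<in> X" "nu v \<in> P" by (auto simp: S_def)
    then obtain u where "P = proj_point (nu u)" using X by (auto simp: veronese_variety_def)
    then have "w \<in> P" using P(2) w(1,3) by (auto simp: proj_point_def mult.assoc[symmetric])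
    then show "w \<in> \<Union>X" using P(1) by blast
  qed
  have "\<Union>X \<noteq> {}"
  proof
    assume empty: "\<Union>X = {}"
    have "X = {}"
    proof (rule ccontr)
      assume "X \<noteq> {}"
      then obtain P where "P \<in> X" by blast
      moreover then obtain v :: "nat \<Rightarrow> 'k" where "P = proj_point (nu v)" using X by (auto simp: veronese_variety_def)
      ultimately show False using empty self by blast
    qed
    then show False using h0 hilbert_function_empty[where 'k = 'k, of N 0] by simp
  qed
  then obtain w where "w \<in> cone S" unfolding cone by blast
  then have S: "S \<noteq> {}" "S \<subseteq> nonzero_vectors n" unfolding cone_def by (blast, simp add: S_def)
  have hX: "hilbert_function N X t = hfun (\<Union>X) N t" for t
    by (rule hilbert_function_eq_hfun[OF \<open>\<Union>X \<noteq> {}\<close>])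
  then have "hilbert_function N X = hfun (\<Union>X) N" by (simp add: fun_eq_iff)
  \<comment> \<open>That the sequence itself is a 0-sequence comes from the growth bound for the
    cone of X in the ambient space with indices up to \<open>N\<close>, not from that for
    \<open>S\<close>.\<close>
  then have "zero_sequence (hilbert_function N X)" using zero_sequence_hfun[OF \<open>\<Union>X \<noteq> {}\<close>] by simp
  moreover have "hilbert_function N X t = hfun S n ((d - 1 + 1) * t)" for t
    using d_pos by (simp add: hX cone hfun_cone)
  ultimately show ?thesis
    unfolding differentiable_e_sequence_def
    using differentiable_zero_sequence_hfun[OF S] by blast
qed

end

section \<open>Distractions\<close>

text \<open>Forms are kept as functions, since zero sets and \<open>hfun\<close> see only values and
  distractions arise as products of linear functions.\<close>

definition is_form :: "nat \<Rightarrow> nat \<Rightarrow> ((nat \<Rightarrow> 'k::field) \<Rightarrow> 'k) \<Rightarrow> bool" where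
  "is_form n t f \<longleftrightarrow> f \<in> fs.span ((\<lambda>M v. ev v M) ` msets n t)"

lemma is_form_iff: "is_form n t f \<longleftrightarrow> (\<exists>c. \<forall>v. f v = (\<Sum>M\<in>msets n t. c M * ev v M))"
  unfolding is_form_def by (rule mem_span_image) (rule finite_msets)

lemma is_form_ev: "M \<in> msets n t \<Longrightarrow> is_form n t (\<lambda>v. ev v M)"
  unfolding is_form_def by (rule fs.span_base) (rule image_eqI[OF refl])

lemma is_form_diff: "is_form n t f \<Longrightarrow> is_form n t g \<Longrightarrow> is_form n t (\<lambda>v. f v - c * g v)"
proof -
  assume "is_form n t f" "is_form n t g"
  then have "f - fscale c g \<in> fs.span ((\<lambda>M v. ev v M) ` msets n t)"
    unfolding is_form_def by (intro fs.span_diff fs.span_scale)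
  moreover have "f - fscale c g = (\<lambda>v. f v - c * g v)" by (simp add: fun_eq_iff fscale_apply)
  ultimately show ?thesis by (simp only: is_form_def)
qed

lemma span_times:
  assumes "f \<in> fs.span A" and "\<And>g. g \<in> A \<Longrightarrow> g * \<chi> \<in> fs.span B"
  shows "f * \<chi> \<in> fs.span B"
  using assms(1)
proof (induction rule: fs.span_induct_alt)
  case base
  have "0 * \<chi> = 0" by (simp add: fun_eq_iff)
  then show ?case by (simp only: fs.span_zero)
next
  case (step c x y)
  have "(fscale c x + y) * \<chi> = fscale c (x * \<chi>) + y * \<chi>"
    by (simp add: fun_eq_iff fscale_apply algebra_simps)
  then show ?case using step.IH assms(2)[OF step.hyps(1)] by (simp only: fs.span_add fs.span_scale)
qed

lemma is_form_times:
  assumes "is_form n t f" "k \<le> n"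
  shows "is_form n (Suc t) (\<lambda>v. f v * v k)"
proof -
  have "f * (\<lambda>v. v k) \<in> fs.span ((\<lambda>M v. ev v M) ` msets n (Suc t))"
  proof (rule span_times)
    show "f \<in> fs.span ((\<lambda>M v. ev v M) ` msets n t)" using assms(1) by (simp only: is_form_def)
    fix g :: "(nat \<Rightarrow> 'a) \<Rightarrow> 'a" assume "g \<in> (\<lambda>M v. ev v M) ` msets n t"
    then obtain M where M: "M \<in> msets n t" "g = (\<lambda>v. ev v M)" by blast
    have "g * (\<lambda>v. v k) = (\<lambda>v. ev v (add_mset k M))" by (simp add: M(2) fun_eq_iff)
    moreover have "add_mset k M \<in> msets n (Suc t)" using M(1) assms(2) by (simp add: msets_iff)
    ultimately show "g * (\<lambda>v. v k) \<in> fs.span ((\<lambda>M v. ev v M) ` msets n (Suc t))"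
      by (simp only: is_form_ev[unfolded is_form_def])
  qed
  moreover have "f * (\<lambda>v. v k) = (\<lambda>v. f v * v k)" by (simp add: fun_eq_iff)
  ultimately show ?thesis by (simp only: is_form_def)
qed

lemma is_form_times_power:
  assumes "is_form n t f" "k \<le> n"
  shows "is_form n (t + r) (\<lambda>v. f v * v k ^ r)"
proof (induction r)
  case (Suc r)
  have "is_form n (Suc (t + r)) (\<lambda>v. (f v * v k ^ r) * v k)" by (rule is_form_times[OF Suc assms(2)])
  then show ?case by (simp add: mult_ac)
qed (use assms in simp)

text \<open>The variable of index \<open>n\<close> homogenizes.\<close>

definition distraction :: "nat \<Rightarrow> nat multiset \<Rightarrow> (nat \<Rightarrow> 'k::field) \<Rightarrow> 'k" where
  "distraction n m v = (\<Prod>i<n. \<Prod>j<count m i. v i - of_nat j * v n)"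

lemma distraction_add:
  assumes "i < n"
  shows "distraction n (add_mset i m) v = distraction n m v * (v i - of_nat (count m i) * v n)"
proof -
  let ?p = "\<lambda>m i. \<Prod>j<count m i. v i - of_nat j * v n"
  have "distraction n (add_mset i m) v = ?p (add_mset i m) i * (\<Prod>k\<in>{..<n} - {i}. ?p (add_mset i m) k)"
    unfolding distraction_def using assms by (intro prod.remove) auto
  also have "(\<Prod>k\<in>{..<n} - {i}. ?p (add_mset i m) k) = (\<Prod>k\<in>{..<n} - {i}. ?p m k)"
    by (intro prod.cong) auto
  also have "?p (add_mset i m) i = (v i - of_nat (count m i) * v n) * ?p m i" by simp
  also have "(v i - of_nat (count m i) * v n) * ?p m i * (\<Prod>k\<in>{..<n} - {i}. ?p m k) =
      (v i - of_nat (count m i) * v n) * (\<Prod>k<n. ?p m k)"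
    using assms by (simp add: prod.remove[of "{..<n}" i] mult.assoc)
  finally show ?thesis by (simp add: distraction_def mult.commute)
qed

lemma is_form_distraction: "set_mset m \<subseteq> {..<n} \<Longrightarrow> is_form n (size m) (distraction n m :: (nat \<Rightarrow> 'k::field) \<Rightarrow> 'k)"
proof (induction m)
  case empty
  have "(\<lambda>v. ev v {#}) = (distraction n {#} :: (nat \<Rightarrow> 'k) \<Rightarrow> 'k)" by (simp add: fun_eq_iff distraction_def)
  moreover have "is_form n 0 (\<lambda>v. ev v {#} :: 'k)" by (rule is_form_ev) (simp add: msets_iff)
  ultimately show ?case by (simp only: size_empty)
next
  case (add i m)
  then have i: "i < n" and IH: "is_form n (size m) (distraction n m :: (nat \<Rightarrow> 'k) \<Rightarrow> 'k)" by auto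
  have "is_form n (Suc (size m)) (\<lambda>v. distraction n m v * v i - of_nat (count m i) * (distraction n m v * v n) :: 'k)"
    using IH i by (intro is_form_diff is_form_times) auto
  then show ?case by (simp add: distraction_add[OF i, abs_def] right_diff_distrib mult_ac fun_eq_iff)
qed

text \<open>Homogenized to degree \<open>t\<close>; the exponent is truncated unless \<open>size m \<le> t\<close>.\<close>

definition hdist :: "nat \<Rightarrow> nat \<Rightarrow> nat multiset \<Rightarrow> (nat \<Rightarrow> 'k::field) \<Rightarrow> 'k" where
  "hdist n t m v = distraction n m v * v n ^ (t - size m)"

definition monoms_upto :: "nat \<Rightarrow> nat \<Rightarrow> nat multiset set" where
  "monoms_upto n t = {m. set_mset m \<subseteq> {..<n} \<and> size m \<le> t}"

lemma finite_monoms_upto: "finite (monoms_upto n t)"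
proof (rule finite_subset)
  show "monoms_upto n t \<subseteq> (\<Union>s\<le>t. msets n s)" using less_imp_le by (fastforce simp: monoms_upto_def msets_iff)
qed (auto intro: finite_msets)

lemma is_form_hdist: "m \<in> monoms_upto n t \<Longrightarrow> is_form n t (hdist n t m)"
  using is_form_times_power[OF is_form_distraction, of m n n "t - size m"]
  by (simp add: hdist_def[abs_def] monoms_upto_def)

text \<open>Distractions span all forms because multiplication by a variable preserves their span,
  so monomials are reached one factor at a time.\<close>

lemma ev_in_span_hdist:
  "M \<in> msets n t \<Longrightarrow> (\<lambda>v. ev v M :: 'k::field) \<in> fs.span (hdist n t ` monoms_upto n t)"
proof (induction t arbitrary: M)
  case 0
  then have "M = {#}" by (simp add: msets_iff)
  then have "(\<lambda>v. ev v M :: 'k) = hdist n 0 {#}" by (simp add: fun_eq_iff hdist_def distraction_def)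
  moreover have "{#} \<in> monoms_upto n 0" by (simp add: monoms_upto_def)
  ultimately show ?case by (simp only: fs.span_base imageI)
next
  case (Suc t)
  let ?S = "fs.span (hdist n (Suc t) ` monoms_upto n (Suc t)) :: ((nat \<Rightarrow> 'k) \<Rightarrow> 'k) set"
  obtain k M' where M: "M = add_mset k M'" using Suc.prems by (metis msets_iff multiset_cases nat.distinct(1) size_empty)
  then have k: "k \<le> n" and M': "M' \<in> msets n t" using Suc.prems by (auto simp: msets_iff)
  have "(\<lambda>v. ev v M' :: 'k) * (\<lambda>v. v k) \<in> ?S"
  proof (rule span_times[OF Suc.IH[OF M']])
    fix g :: "(nat \<Rightarrow> 'k) \<Rightarrow> 'k" assume "g \<in> hdist n t ` monoms_upto n t"
    then obtain m where m: "set_mset m \<subseteq> {..<n}" "size m \<le> t" "g = hdist n t m" by (auto simp: monoms_upto_def)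
    have pw: "v n ^ (Suc t - size m) = v n * v n ^ (t - size m)" for v :: "nat \<Rightarrow> 'k"
      using m(2) by (simp add: Suc_diff_le)
    have up: "hdist n (Suc t) m \<in> ?S" using m by (intro fs.span_base imageI) (auto simp: monoms_upto_def)
    show "g * (\<lambda>v. v k) \<in> ?S"
    proof (cases "k = n")
      case True
      then have "g * (\<lambda>v. v k) = hdist n (Suc t) m" by (simp add: m(3) fun_eq_iff hdist_def pw mult_ac)
      then show ?thesis using up by simp
    next
      case False
      then have kn: "k < n" using k by simp
      \<comment> \<open>Write x_k as (x_k - a x_n) + a x_n with \<open>a = count m k\<close>: the
        first summand is the next factor of the distraction, the second only raises the power of
        x_n.\<close>
      have "g * (\<lambda>v. v k) = hdist n (Suc t) (add_mset k m) + fscale (of_nat (count m k)) (hdist n (Suc t) m)"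
        by (simp add: m(3) fun_eq_iff hdist_def pw distraction_add[OF kn] fscale_apply algebra_simps)
      moreover have "hdist n (Suc t) (add_mset k m) \<in> ?S"
        using m kn by (intro fs.span_base imageI) (auto simp: monoms_upto_def)
      ultimately show ?thesis using up by (simp only: fs.span_add fs.span_scale)
    qed
  qed
  moreover have "(\<lambda>v. ev v M' :: 'k) * (\<lambda>v. v k) = (\<lambda>v. ev v M)" by (simp add: M fun_eq_iff)
  ultimately show ?case by (simp only:)
qed

definition lattice_point :: "nat \<Rightarrow> nat multiset \<Rightarrow> nat \<Rightarrow> 'k::field_char_0" where
  "lattice_point n m i = (if i < n then of_nat (count m i) else if i = n then 1 else 0)"

lemma lattice_point_nonzero: "lattice_point n m \<in> nonzero_vectors n"
  by (auto simp: nonzero_vectors_def lattice_point_def intro: exI[of _ n])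

text \<open>At (m, 1) the factors become \<open>count m i - j\<close> with j below
  \<open>count m' i\<close>. In characteristic 0 one of them vanishes exactly when
  \<open>count m i < count m' i\<close>.\<close>

lemma distraction_lattice_point:
  assumes "set_mset m' \<subseteq> {..<n}"
  shows "distraction n m' (lattice_point n m :: nat \<Rightarrow> 'k::field_char_0) \<noteq> 0 \<longleftrightarrow> m' \<subseteq># m"
proof -
  have "distraction n m' (lattice_point n m :: nat \<Rightarrow> 'k) \<noteq> 0 \<longleftrightarrow> (\<forall>i<n. \<forall>j<count m' i. count m i \<noteq> j)"
    by (auto simp: distraction_def lattice_point_def)
  also have "\<dots> \<longleftrightarrow> (\<forall>i<n. count m' i \<le> count m i)" 
  proof -
    have "(\<forall>j<b. a \<noteq> j) \<longleftrightarrow> b \<le> a" for a b :: nat by (metis linorder_not_less)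
    then show ?thesis by simp
  qed
  also have "\<dots> \<longleftrightarrow> m' \<subseteq># m"
  proof -
    have "count m' i \<le> count m i" if "\<not> i < n" for i
    proof -
      have "i \<notin># m'" using assms that by auto
      then have "count m' i = 0" by (rule not_in_iff[THEN iffD1])
      then show ?thesis by simp
    qed
    then show ?thesis unfolding subseteq_mset_def by blast
  qed
  finally show ?thesis .
qed

lemma subset_closed_of_closed:
  assumes closed: "\<And>m k. m \<in> D \<Longrightarrow> k \<in># m \<Longrightarrow> m - {#k#} \<in> D"
    and "m' \<subseteq># m" "m \<in> D"
  shows "m' \<in> D"
proof -
  obtain r where "m = m' + r" using assms(2) by (auto simp: subset_mset.le_iff_add)
  then have "m' + r \<in> D" using assms(3) by simp
  then show ?thesis
  proof (induction r)
    case (add k r)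
    then show ?case using closed[of "m' + add_mset k r" k] by simp
  qed simp
qed

locale order_ideal =
  fixes n :: nat and D :: "nat multiset set"
  assumes empty_mem: "{#} \<in> D"
    and vars: "m \<in> D \<Longrightarrow> set_mset m \<subseteq> {..<n}"
    and closed: "m \<in> D \<Longrightarrow> k \<in># m \<Longrightarrow> m - {#k#} \<in> D"
begin

definition zeros :: "(nat \<Rightarrow> 'k::field_char_0) set" where
  "zeros = {v \<in> nonzero_vectors n. \<forall>m. set_mset m \<subseteq> {..<n} \<longrightarrow> m \<notin> D \<longrightarrow> distraction n m v = 0}"

lemma lattice_point_zeros:
  assumes "m \<in> D"
  shows "lattice_point n m \<in> zeros"
proof -
  have "distraction n m' (lattice_point n m :: nat \<Rightarrow> 'k::field_char_0) = 0"
    if "set_mset m' \<subseteq> {..<n}" "m' \<notin> D" for m'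
    using distraction_lattice_point[OF that(1), of m] subset_closed_of_closed[OF closed _ assms] that(2) by blast
  then show ?thesis unfolding zeros_def using lattice_point_nonzero by blast
qed

text \<open>All degrees up to t are counted, because powers of x_n fill up the missing degree of
  each distraction.\<close>

lemma hfun_zeros: "hfun (zeros :: (nat \<Rightarrow> 'k::field_char_0) set) n t = card {m \<in> D. size m \<le> t}"
proof -
  define F where "F = {m \<in> D. size m \<le> t}"
  have FS: "F \<subseteq> monoms_upto n t" using vars by (auto simp: F_def monoms_upto_def)
  then have finF: "finite F" using finite_monoms_upto by (rule finite_subset)
  define \<beta> where "\<beta> m v = (if v \<in> zeros then hdist n t m v else 0)" for m and v :: "nat \<Rightarrow> 'k"
  have "rest_ev zeros ` msets n t \<subseteq> fs.span (\<beta> ` F)"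
  proof (rule image_subsetI)
    fix M assume "M \<in> msets n t"
    then obtain c where c: "\<And>v :: nat \<Rightarrow> 'k. ev v M = (\<Sum>m\<in>monoms_upto n t. c m * hdist n t m v)"
      using ev_in_span_hdist[of M n t, where 'k = 'k] unfolding mem_span_image[OF finite_monoms_upto] by blast
    have "rest_ev zeros M v = (\<Sum>m\<in>F. c m * \<beta> m v)" for v :: "nat \<Rightarrow> 'k"
    proof (cases "v \<in> zeros")
      case True
      \<comment> \<open>Distractions of monomials outside \<open>D\<close> vanish on
        \<open>zeros\<close> by definition, so the terms outside \<open>F\<close> drop out.\<close>
      have "(\<Sum>m\<in>monoms_upto n t. c m * hdist n t m v) = (\<Sum>m\<in>F. c m * hdist n t m v)"
        using FS True by (intro sum.mono_neutral_right finite_monoms_upto)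
          (auto simp: F_def monoms_upto_def zeros_def hdist_def)
      then show ?thesis using True by (simp add: rest_ev_def \<beta>_def c)
    qed (simp add: rest_ev_def \<beta>_def)
    then show "rest_ev zeros M \<in> fs.span (\<beta> ` F)" unfolding mem_span_image[OF finF] by blast
  qed
  moreover have "\<beta> ` F \<subseteq> fs.span (rest_ev zeros ` msets n t)"
  proof (rule image_subsetI)
    fix m assume "m \<in> F"
    then obtain c where c: "\<And>v :: nat \<Rightarrow> 'k. hdist n t m v = (\<Sum>M\<in>msets n t. c M * ev v M)"
      using is_form_hdist[of m n t, where 'a = 'k] FS unfolding is_form_iff by blast
    have "\<beta> m v = (\<Sum>M\<in>msets n t. c M * rest_ev zeros M v)" for v
      by (simp add: \<beta>_def rest_ev_def c)
    then show "\<beta> m \<in> fs.span (rest_ev zeros ` msets n t)" unfolding mem_span_image[OF finite_msets] by blast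
  qed
  ultimately have "fs.span (rest_ev (zeros :: (nat \<Rightarrow> 'k) set) ` msets n t) = fs.span (\<beta> ` F)"
    by (intro equalityI fs.span_minimal fs.subspace_span)
  then have "hfun (zeros :: (nat \<Rightarrow> 'k) set) n t = fs.dim (\<beta> ` F)" unfolding hfun_def by (rule fs.span_eq_dim)
  also have "\<dots> = card F"
  proof -
    \<comment> \<open>Larger monomials come first, so that all of them vanish at the lattice point of \<open>m\<close>.\<close>
    define R where "R m' m \<longleftrightarrow> size m < size m' \<or> size m' = size m \<and> m' < m" for m' m :: "nat multiset"
    have R: "asymp_on F R" "transp_on F R" "totalp_on F R"
      by (auto simp: R_def asymp_on_def transp_on_def totalp_on_def)
    have "\<beta> m \<notin> fs.span (\<beta> ` {m' \<in> F. R m' m})" if m: "m \<in> F" for m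
    proof
      assume *: "\<beta> m \<in> fs.span (\<beta> ` {m' \<in> F. R m' m})"
      have "finite {m' \<in> F. R m' m}" using finF by simp
      then obtain c where c: "\<And>v. \<beta> m v = (\<Sum>m'\<in>{m' \<in> F. R m' m}. c m' * \<beta> m' v)"
        using * mem_span_image by blast
      let ?p = "lattice_point n m :: nat \<Rightarrow> 'k"
      have p: "?p \<in> zeros" using m by (intro lattice_point_zeros) (simp add: F_def)
      have "?p n = 1" by (simp add: lattice_point_def)
      then have \<beta>p: "\<beta> m' ?p = distraction n m' ?p" for m' using p by (simp add: \<beta>_def hdist_def)
      have "\<beta> m' ?p = 0" if "m' \<in> F" "R m' m" for m'
      proof -
        have "\<not> m' \<subseteq># m"
        proof
          assume s: "m' \<subseteq># m"
          then have "size m' = size m" using that(2) size_mset_mono[OF s] by (auto simp: R_def)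
          then have "m' = m" using s by (metis mset_subset_size subset_mset.le_imp_less_or_eq less_irrefl)
          then show False using that(2) by (simp add: R_def)
        qed
        then show ?thesis using distraction_lattice_point[of m' n m] vars[of m'] that(1) \<beta>p by (auto simp: F_def)
      qed
      then have "\<beta> m ?p = 0" unfolding c by (intro sum.neutral) auto
      moreover have "\<beta> m ?p \<noteq> 0"
        using distraction_lattice_point[of m n m] vars[of m] m \<beta>p by (auto simp: F_def)
      ultimately show False by simp
    qed
    then have "std_monoms \<beta> R F = F" by (auto simp: std_monoms_def)
    then show ?thesis using card_std_monoms[OF finF R, of \<beta>] by simp
  qed
  finally show ?thesis by (simp add: F_def)
qed

end

section \<open>Closed subsets of Veronese varieties\<close>

lemma eval_homogeneous_scale:
  fixes w :: "nat \<Rightarrow> 'k::field"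
  assumes "g \<in> homogeneous_part N t"
  shows "eval_mpoly (\<lambda>i. c * w i) g = c ^ t * eval_mpoly w g"
proof -
  have g: "Poly_Mapping.keys g \<subseteq> pm ` msets N t" using assms by (simp add: homogeneous_part_eq)
  have "eval_monom (\<lambda>i. c * w i) m = c ^ t * eval_monom w m" if "m \<in> pm ` msets N t" for m
    using that by (auto simp: ev_scale msets_iff)
  then show ?thesis
    using eval_mpoly_superset[OF finite_imageI[OF finite_msets] g]
    by (auto simp: sum_distrib_left mult_ac intro!: sum.cong)
qed

lemma proj_point_scale:
  assumes "c \<noteq> 0"
  shows "proj_point (\<lambda>i. c * v i) = proj_point v"
proof (intro equalityI subsetI)
  fix w assume "w \<in> proj_point (\<lambda>i. c * v i)"
  then obtain b where "b \<noteq> 0" "w = (\<lambda>i. b * (c * v i))" by (auto simp: proj_point_def)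
  then show "w \<in> proj_point v"
    using assms by (auto simp: proj_point_def mult.assoc intro!: exI[of _ "b * c"])
next
  fix w assume "w \<in> proj_point v"
  then obtain b where "b \<noteq> 0" "w = (\<lambda>i. b * v i)" by (auto simp: proj_point_def)
  then show "w \<in> proj_point (\<lambda>i. c * v i)"
    using assms by (auto simp: proj_point_def intro!: exI[of _ "b / c"])
qed

lemma proj_point_self: "v \<in> proj_point v"
  unfolding proj_point_def by (intro CollectI exI[of _ 1]) simp

context veronese
begin

text \<open>One preimage under \<open>expand\<close> is chosen for each monomial, and the
  coefficients are carried over.\<close>

lemma pullback_form:
  fixes f :: "(nat \<Rightarrow> 'k::field) \<Rightarrow> 'k"
  assumes "is_form n (d * s) f"
  shows "\<exists>g\<in>homogeneous_part N s. \<forall>v. eval_mpoly (nu v) g = f v"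
proof -
  obtain c where c: "\<And>v. f v = (\<Sum>K\<in>msets n (d * s). c K * ev v K)"
    using assms unfolding is_form_iff by blast
  obtain M where M: "\<And>K. K \<in> msets n (d * s) \<Longrightarrow> M K \<in> msets N s \<and> expand (M K) = K"
    using expand_surj[of _ s] by metis
  let ?g = "\<Sum>K\<in>msets n (d * s). Poly_Mapping.single (pm (M K)) (c K)"
  have "Poly_Mapping.keys ?g \<subseteq> (\<Union>K\<in>msets n (d * s). Poly_Mapping.keys (Poly_Mapping.single (pm (M K)) (c K)))"
    by (rule keys_sum)
  also have "\<dots> \<subseteq> pm ` msets N s" using M by (auto split: if_splits)
  finally have "?g \<in> homogeneous_part N s" by (simp add: homogeneous_part_eq)
  moreover have "eval_mpoly (nu v) ?g = f v" for v
    using M by (auto simp: c ev_nu msets_iff intro!: sum.cong)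
  ultimately show ?thesis by blast
qed

text \<open>Writing \<open>y\<^sub>M\<close> for the coordinate of \<open>w\<close> at the monomial \<open>M\<close>, some \<open>y\<close> at a pure power \<open>x\<^sub>i\<^sup>d\<close> is
  nonzero, and the preimage has coordinates \<open>u\<^sub>j = y\<close> at \<open>x\<^sub>i\<^sup>d\<^sup>-\<^sup>1 x\<^sub>j\<close>.\<close>

lemma mem_image_nu_of_relations:
  fixes w :: "nat \<Rightarrow> 'k::field"
  assumes w: "w \<in> nonzero_vectors N"
    and rel: "\<And>t M M'. M \<in> msets N t \<Longrightarrow> M' \<in> msets N t \<Longrightarrow> expand M = expand M' \<Longrightarrow> ev w M = ev w M'"
  shows "\<exists>u\<in>nonzero_vectors n. \<exists>c. c \<noteq> 0 \<and> nu u = (\<lambda>i. c * w i)"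
proof -
  have ev_img: "ev w (image_mset g K) = (\<Prod>j\<in>#K. w (g j))" for g :: "nat \<Rightarrow> nat" and K
    by (simp add: ev_def image_mset.compositionality comp_def)
  have expand_rep: "expand (replicate_mset k i) = repeat_mset k (mon i)" for k i
    by (induction k) auto
  obtain a where a: "a \<le> N" "w a \<noteq> 0" using w by (auto simp: nonzero_vectors_def)
  have Ka: "mon a \<in> msets n d" by (rule mon_mem[OF a(1)])
  have pure: "replicate_mset d j \<in> msets n d" if "j \<le> n" for j
    using that by (auto simp: msets_iff split: if_splits)
  \<comment> \<open>Both the d-th power of y_a and the product of the coordinates at x_j^d, over the
    factors x_j of \<open>mon a\<close>, expand to the d-th power of \<open>mon a\<close>. Hence
    those pure-power coordinates are nonzero.\<close>
  have "expand (image_mset (\<lambda>j. idx (replicate_mset d j)) K) = repeat_mset d K"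
    if "set_mset K \<subseteq> {..n}" for K
    using that by (induction K) (auto simp: mon_idx pure)
  then have "ev w (replicate_mset d a) = ev w (image_mset (\<lambda>j. idx (replicate_mset d j)) (mon a))"
    using Ka a(1) idx_le[OF pure]
    by (intro rel[of _ d]) (auto simp: msets_iff expand_rep split: if_splits)
  moreover have "ev w (replicate_mset d a) = w a ^ d" by (simp add: ev_def)
  ultimately have "(\<Prod>j\<in>#mon a. w (idx (replicate_mset d j))) = w a ^ d" by (simp add: ev_img)
  then have prod_nz: "(\<Prod>j\<in>#mon a. w (idx (replicate_mset d j))) \<noteq> 0"
    using power_not_zero[OF a(2)] by (simp only: not_False_eq_True)
  have nz: "w (idx (replicate_mset d j)) \<noteq> 0" if "j \<in># mon a" for j
  proof
    assume "w (idx (replicate_mset d j)) = 0"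
    then have "0 \<in># {#w (idx (replicate_mset d j)). j \<in># mon a#}" using that by (force simp: image_iff)
    then show False using prod_nz by (simp only: prod_mset_zero_iff not_True_eq_False)
  qed
  have "mon a \<noteq> {#}" using Ka d_pos by (auto simp: msets_iff)
  then obtain i where i: "i \<in># mon a" by blast
  then have "i \<le> n" using Ka by (auto simp: msets_iff)
  have near: "add_mset j (replicate_mset (d - 1) i) \<in> msets n d" if "j \<le> n" for j
    using that \<open>i \<le> n\<close> d_pos by (auto simp: msets_iff split: if_splits)
  have mon_near: "mon (idx (add_mset j (replicate_mset (d - Suc 0) i))) = add_mset j (replicate_mset (d - Suc 0) i)"
    if "j \<le> n" for j
    using mon_idx[OF near[OF that]] by simp
  define u where "u j = (if j \<le> n then w (idx (add_mset j (replicate_mset (d - 1) i))) else 0)" for j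
  define c where "c = w (idx (replicate_mset d i)) ^ (d - 1)"
  have "add_mset i (replicate_mset (d - 1) i) = replicate_mset d i"
    using d_pos by (metis Suc_diff_1 less_le_trans replicate_mset_Suc zero_less_one)
  then have "u i \<noteq> 0" using nz[OF i] \<open>i \<le> n\<close> by (simp add: u_def)
  then have "u \<in> nonzero_vectors n" using \<open>i \<le> n\<close> by (auto simp: nonzero_vectors_def u_def)
  moreover have "c \<noteq> 0" using nz[OF i] by (simp add: c_def)
  moreover have "nu u = (\<lambda>i. c * w i)"
  proof
    fix b
    show "nu u b = c * w b"
    proof (cases "b \<le> N")
      case False
      then show ?thesis using w by (simp add: nu_eq nonzero_vectors_def)
    next
      case True
      have Kb: "mon b \<in> msets n d" by (rule mon_mem[OF True])
      \<comment> \<open>Both sides expand to \<open>mon b\<close> times x_i^((d-1)d). On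
        \<open>w\<close> the left one evaluates to \<open>w b * c\<close> and the right one to
        \<open>ev u (mon b)\<close>, which explains the scalar \<open>c\<close>.\<close>
      let ?M = "add_mset b (replicate_mset (d - 1) (idx (replicate_mset d i)))"
      let ?M' = "image_mset (\<lambda>j. idx (add_mset j (replicate_mset (d - 1) i))) (mon b)"
      have "expand (image_mset (\<lambda>j. idx (add_mset j (replicate_mset (d - 1) i))) K)
          = K + replicate_mset ((d - 1) * size K) i" if "set_mset K \<subseteq> {..n}" for K
        using that by (induction K) (auto simp: mon_near multiset_eq_iff)
      then have "expand ?M' = mon b + replicate_mset ((d - 1) * d) i" using Kb by (simp add: msets_iff)
      also have "\<dots> = expand ?M"
        using pure[OF \<open>i \<le> n\<close>] by (simp add: expand_rep mon_idx multiset_eq_iff)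
      finally have "expand ?M = expand ?M'" by simp
      then have "ev w ?M = ev w ?M'"
        using True d_pos Kb idx_le[OF pure[OF \<open>i \<le> n\<close>]] idx_le[OF near]
        by (intro rel[of _ d]) (auto simp: msets_iff split: if_splits)
      moreover have "ev w ?M = w b * c" by (simp add: c_def) (simp add: ev_def)
      moreover have "ev w ?M' = ev u (mon b)"
        using Kb unfolding ev_img by (auto simp: ev_def u_def msets_iff intro!: arg_cong[where f = prod_mset] image_mset_cong)
      ultimately show ?thesis using True by (simp add: nu_eq mult.commute)
    qed
  qed
  ultimately show ?thesis by blast
qed

text \<open>All forms vanishing on the image serve as equations. They include the binomials that
  force a point onto the Veronese variety, and enough pullbacks to recover the equations in
  \<open>G\<close>.\<close>

lemma projective_variety_image_nu:
  fixes G :: "((nat \<Rightarrow> 'k::field) \<Rightarrow> 'k) set"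
  assumes G: "\<And>f. f \<in> G \<Longrightarrow> \<exists>s. is_form n s f"
  defines "S \<equiv> {v \<in> nonzero_vectors n. \<forall>f\<in>G. f v = 0}"
  shows "projective_variety N ((\<lambda>v. proj_point (nu v)) ` S)"
proof -
  define F where "F = {g \<in> (\<Union>t. homogeneous_part N t). \<forall>v\<in>S. eval_mpoly (nu v) g = 0}"
  have "(\<lambda>v. proj_point (nu v)) ` S = {P \<in> proj_space N. \<forall>f\<in>F. \<forall>v\<in>P. eval_mpoly v f = 0}"
  proof (intro equalityI subsetI)
    fix P assume "P \<in> (\<lambda>v. proj_point (nu v)) ` S"
    then obtain v where v: "v \<in> S" "P = proj_point (nu v)" by blast
    have "P \<in> proj_space N" using v nu_nonzero by (auto simp: proj_space_def S_def)
    moreover have "eval_mpoly w f = 0" if f: "f \<in> F" and wP: "w \<in> P" for f w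
    proof -
      obtain c where "w = (\<lambda>i. c * nu v i)" using wP v(2) by (auto simp: proj_point_def)
      moreover obtain t where "f \<in> homogeneous_part N t" using f by (auto simp: F_def)
      ultimately show ?thesis using f v(1) by (simp add: eval_homogeneous_scale F_def)
    qed
    ultimately show "P \<in> {P \<in> proj_space N. \<forall>f\<in>F. \<forall>v\<in>P. eval_mpoly v f = 0}" by blast
  next
    fix P assume P: "P \<in> {P \<in> proj_space N. \<forall>f\<in>F. \<forall>v\<in>P. eval_mpoly v f = 0}"
    then obtain w where w: "w \<in> nonzero_vectors N" "P = proj_point w" by (auto simp: proj_space_def)
    have zero: "eval_mpoly w f = 0" if "f \<in> F" for f using P that w(2) proj_point_self by blast
    have "\<exists>u\<in>nonzero_vectors n. \<exists>c. c \<noteq> 0 \<and> nu u = (\<lambda>i. c * w i)"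
    proof (rule mem_image_nu_of_relations[OF w(1)])
      fix t M M' assume M: "M \<in> msets N t" "M' \<in> msets N t" "expand M = expand M'"
      let ?g = "Poly_Mapping.single (pm M) 1 - Poly_Mapping.single (pm M') 1 :: 'k mpoly"
      have "Poly_Mapping.keys ?g \<subseteq> pm ` msets N t"
        using M(1,2) by (auto simp: in_keys_iff lookup_minus lookup_single when_def split: if_splits)
      then have "?g \<in> homogeneous_part N t" by (simp add: homogeneous_part_eq)
      moreover have "eval_mpoly (nu v) ?g = 0" for v :: "nat \<Rightarrow> 'k"
        using M by (simp add: ev_nu msets_iff)
      ultimately have "?g \<in> F" by (auto simp: F_def)
      then show "ev w M = ev w M'" using zero[of ?g] by simp
    qed
    then obtain u c where u: "u \<in> nonzero_vectors n" "c \<noteq> 0" "nu u = (\<lambda>i. c * w i)" by blast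
    have "f u = 0" if f: "f \<in> G" for f
    proof -
      obtain s where s: "is_form n s f" using G[OF f] by blast
      obtain i where i: "i \<le> n" "u i \<noteq> 0" using u(1) by (auto simp: nonzero_vectors_def)
      \<comment> \<open>Only forms of degree divisible by \<open>d\<close> pull back, so
        \<open>f\<close> is multiplied by a power of a coordinate that is nonzero at
        \<open>u\<close> and can be cancelled afterwards.\<close>
      have "s + (d - 1) * s = d * s" using d_pos by (simp add: algebra_simps)
      then have "is_form n (d * s) (\<lambda>v. f v * v i ^ ((d - 1) * s))"
        using is_form_times_power[OF s i(1), of "(d - 1) * s"] by simp
      then obtain g where g: "g \<in> homogeneous_part N s" "\<And>v. eval_mpoly (nu v) g = f v * v i ^ ((d - 1) * s)"
        using pullback_form by blast
      then have "g \<in> F" using f by (auto simp: F_def S_def)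
      then have "eval_mpoly (nu u) g = 0" unfolding u(3) using eval_homogeneous_scale[OF g(1)] zero by simp
      then show ?thesis using g(2)[of u] i(2) by simp
    qed
    then have "u \<in> S" using u(1) by (simp add: S_def)
    moreover have "P = proj_point (nu u)" unfolding u(3) w(2) using proj_point_scale[OF u(2)] by blast
    ultimately show "P \<in> (\<lambda>v. proj_point (nu v)) ` S" by blast
  qed
  moreover have "F \<subseteq> (\<Union>t. homogeneous_part N t)" by (auto simp: F_def)
  ultimately show ?thesis unfolding projective_variety_def by blast
qed

lemma hilbert_function_image_nu:
  fixes S :: "(nat \<Rightarrow> 'k::field) set"
  assumes "S \<noteq> {}"
  shows "hilbert_function N ((\<lambda>v. proj_point (nu v)) ` S) t = hfun S n (d * t)"
proof -
  have "\<Union>((\<lambda>v. proj_point (nu v)) ` S) = cone S" by (auto simp: cone_def proj_point_def)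
  moreover have "\<Union>((\<lambda>v. proj_point (nu v)) ` S) \<noteq> {}" using assms proj_point_self by blast
  ultimately show ?thesis using hilbert_function_eq_hfun hfun_cone by metis
qed

lemma ex_variety_of_differentiable:
  assumes n: "n \<ge> 1" and h: "differentiable_e_sequence (d - 1) h" "h 0 = 1" "h 1 = (n + d) choose d"
  shows "\<exists>X :: (nat \<Rightarrow> 'k::field_char_0) set set. projective_variety N X \<and>
    X \<subseteq> veronese_variety n N e \<and> (\<forall>t. hilbert_function N X t = h t)"
proof -
  obtain c where c: "differentiable_zero_sequence c" "\<And>t. h t = c (d * t)"
    using h(1) d_pos by (auto simp: differentiable_e_sequence_def)
  have "c d = (n + d) choose d" using c(2)[of 1] h(3) by simp
  then obtain b where b: "zero_sequence b" "b 1 = n" "\<And>t. t \<ge> d \<Longrightarrow> (\<Sum>s\<le>t. b s) = c t"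
    using truncated_difference_sequence[OF c(1) n d_pos] by blast
  obtain D where D: "{#} \<in> D" "\<forall>m\<in>D. set_mset m \<subseteq> {..<n}" "\<forall>m\<in>D. \<forall>k\<in>#m. m - {#k#} \<in> D"
    "\<And>t. card {m \<in> D. size m = t} = b t"
    using ex_order_ideal[OF b(1,2)] by blast
  interpret order_ideal n D using D by unfold_locales auto
  have finD: "finite {m \<in> D. size m = s}" for s
    by (rule finite_subset[OF _ finite_monoms_upto[of n s]]) (use D(2) in \<open>auto simp: monoms_upto_def\<close>)
  have count: "card {m \<in> D. size m \<le> t} = (\<Sum>s\<le>t. b s)" for t
  proof -
    have "{m \<in> D. size m \<le> t} = (\<Union>s\<le>t. {m \<in> D. size m = s})" by auto
    moreover have "card (\<Union>s\<in>{..t}. {m \<in> D. size m = s}) = (\<Sum>s\<le>t. card {m \<in> D. size m = s})"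
      using finD by (intro card_UN_disjoint) auto
    ultimately show ?thesis by (simp add: D(4))
  qed
  define G where "G = {distraction n m :: (nat \<Rightarrow> 'k) \<Rightarrow> 'k | m. set_mset m \<subseteq> {..<n} \<and> m \<notin> D}"
  have Z: "zeros = {v \<in> nonzero_vectors n. \<forall>f\<in>G. f v = 0}" by (auto simp: zeros_def G_def)
  have Zne: "(zeros :: (nat \<Rightarrow> 'k) set) \<noteq> {}" using lattice_point_zeros[OF D(1)] by blast
  let ?X = "(\<lambda>v. proj_point (nu v)) ` (zeros :: (nat \<Rightarrow> 'k) set)"
  have "projective_variety N ?X"
    unfolding Z by (rule projective_variety_image_nu) (use is_form_distraction in \<open>auto simp: G_def\<close>)
  moreover have "?X \<subseteq> veronese_variety n N e" by (auto simp: veronese_variety_def zeros_def)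
  moreover have "hilbert_function N ?X t = h t" for t
  \<comment> \<open>The partial sums of \<open>b\<close> are known to agree with \<open>c\<close>
    only from degree \<open>d\<close> on; the remaining multiple of \<open>d\<close> is 0, where
    \<open>h 0 = 1\<close> settles the value.\<close>
  proof (cases "t = 0")
    case True
    then show ?thesis using hfun_0[OF Zne] hilbert_function_image_nu[OF Zne, of 0] h(2) by simp
  next
    case False
    then have "d \<le> d * t" by simp
    then show ?thesis
      using hilbert_function_image_nu[OF Zne, of t] b(3) c(2) by (simp add: hfun_zeros count)
  qed
  ultimately show ?thesis by blast
qed

end

theorem theorem2p16:
  fixes n d N :: nat and h :: "nat \<Rightarrow> nat" and e :: "nat \<Rightarrow> monom"
  assumes "n \<ge> 1" and "d \<ge> 1"
    and "N = ((n + d) choose d) - 1"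
    and "bij_betw e {..N} (monoms_of_degree n d)"
    and "h 0 = 1" and "h 1 = N + 1"
  shows "(\<exists>X :: (nat \<Rightarrow> 'k::{alg_closed_field, field_char_0}) set set.
            projective_variety N X \<and> X \<subseteq> veronese_variety n N e \<and>
            (\<forall>t. hilbert_function N X t = h t)) \<longleftrightarrow>
         differentiable_e_sequence (d - 1) h"
proof -
  interpret veronese n d N e by unfold_locales (fact assms)+
  show ?thesis
  proof
    assume "\<exists>X :: (nat \<Rightarrow> 'k) set set. projective_variety N X \<and> X \<subseteq> veronese_variety n N e \<and>
        (\<forall>t. hilbert_function N X t = h t)"
    then obtain X :: "(nat \<Rightarrow> 'k) set set" where X: "X \<subseteq> veronese_variety n N e"
      "\<And>t. hilbert_function N X t = h t" by blast
    then have "hilbert_function N X = h" by (simp add: fun_eq_iff)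
    then show "differentiable_e_sequence (d - 1) h"
      using differentiable_e_sequence_hilbert_function[OF X(1)] assms(5) by simp
  next
    assume "differentiable_e_sequence (d - 1) h"
    moreover have "h 1 = (n + d) choose d" using assms(3,6) by simp
    ultimately show "\<exists>X :: (nat \<Rightarrow> 'k) set set. projective_variety N X \<and> X \<subseteq> veronese_variety n N e \<and>
        (\<forall>t. hilbert_function N X t = h t)"
      using ex_variety_of_differentiable[OF assms(1)] assms(5) by blast
  qed
qed

end
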